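(* Let $n\ge 2$ and let $D\subset\mathbb{R}^n$ be an open, connected and bounded set which is regular in the sense of solvability of the Dirichlet problem. Let $r\ge 0$ be an integer. Then there exists a constant $C>0$, depending only on $D$ and $r$, such that for every $f\in HC^r(\overline D)$ and every natural number $p\ge r+1$ there exists a function $T_p$ on $\overline D$, polyharmonic of order $p$ in $D$, satisfying $$|f(x)-T_p(x)|\le C\,\omega^h\!\left(\Delta^r F_r;\frac1p\right)\frac{1}{p^{2r}}\qquad\text{for every }x\in\overline D,$$ where $F_r$ is the function on $\mathbb{R}^n$ associated with $f$ by $F_r=f-h_f$ on $\overline D$ and $F_r=0$ outside $\overline D$ (with $h_f$ as defined in the context), and $\omega^h$ is the harmonicity modulus on $\mathbb{R}^n$.
   Context: All functions are real-valued. $D$ is regular if for every continuous $\varphi$ on $\partial D$ there is a function continuous on $\overline D$, harmonic in $D$, and equal to $\varphi$ on $\partial D$. $HC^r(\overline D)$ is the space of functions $f$ such that $\Delta^r f$ (the $r$-th iterate of the Laplacian, $\Delta^0=\mathrm{id}$) exists and is continuous in $\overline D$; $HC^0(\overline D)=C(\overline D)$. The lower iterates $f,\Delta f,\dots,\Delta^{r-1}f$ are likewise understood to be continuous on $\overline D$, so that their boundary values make sense. A function $T$ is polyharmonic of order $p$ in an open set $D$ if $\Delta^pT(x)=0$ for all $x\in D$. For $f\in HC^r(\overline D)$, $h_f$ denotes the solution (obtained inductively by solving Dirichlet problems) of the boundary value problem $$\Delta^{r+1}h_f(x)=0\ \ (x\in D),\qquad \Delta^jh_f(x)=\Delta^jf(x)\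 \ (x\in\partial D),\quad j=0,1,\dots,r,$$ with $\Delta^jh_f$ continuous on $\overline D$ for $j=0,\dots,r$. The function $F_r$ is defined on $\mathbb{R}^n$ by $F_r(x)=f(x)-h_f(x)$ for $x\in\overline D$ and $F_r(x)=0$ for $x\notin\overline D$. The function $\Delta^rF_r$ means the function equal to $\Delta^rf-\Delta^rh_f$ on $\overline D$ and to $0$ outside $\overline D$; it is continuous on $\mathbb{R}^n$. For a continuous function $g$ on $\mathbb{R}^n$, put $$\mu_0(g;x,t)=\frac1{\omega_n}\int_{\Omega}g(x+t\xi)\,d\omega_\xi,\qquad \Delta_t(g;x)=\mu_0(g;x,t)-g(x),$$ where $\Omega$ is the unit sphere of $\mathbb{R}^n$, $\omega_n$ its area and $d\omega_\xi$ its area element. The harmonicity modulus of $g$ on $\mathbb{R}^n$ is $$\omega^h(g;u)=\sup\{|\Delta_t(g;x)|:\ 0<t\le u,\ x\in\mathbb{R}^n\},\qquad u>0.$$ *)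

theory Defs
  imports "HOL-Analysis.Analysis"
begin

definition partially_differentiable :: "'a::euclidean_space \<Rightarrow> ('a \<Rightarrow> real) \<Rightarrow> 'a \<Rightarrow> bool" where
  "partially_differentiable b f x \<longleftrightarrow> (\<lambda>s. f (x + s *\<^sub>R b)) differentiable (at 0)"

definition partial :: "'a::euclidean_space \<Rightarrow> ('a \<Rightarrow> real) \<Rightarrow> 'a \<Rightarrow> real" where
  "partial b f x = deriv (\<lambda>s. f (x + s *\<^sub>R b)) 0"

definition laplacian :: "('a::euclidean_space \<Rightarrow> real) \<Rightarrow> 'a \<Rightarrow> real" where
  "laplacian f x = (\<Sum>b\<in>Basis. partial b (partial b f) x)"

definition laplacian_exists_on :: "'a::euclidean_space set \<Rightarrow> ('a \<Rightarrow> real) \<Rightarrow> bool" where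
  "laplacian_exists_on D f \<longleftrightarrow>
    (\<forall>x\<in>D. \<forall>b\<in>Basis. partially_differentiable b f x \<and> partially_differentiable b (partial b f) x)"

primrec Ck_on :: "nat \<Rightarrow> 'a::euclidean_space set \<Rightarrow> ('a \<Rightarrow> real) \<Rightarrow> bool" where
  "Ck_on 0 D f \<longleftrightarrow> continuous_on D f"
| "Ck_on (Suc k) D f \<longleftrightarrow> continuous_on D f \<and>
    (\<forall>b\<in>Basis. (\<forall>x\<in>D. partially_differentiable b f x) \<and> Ck_on k D (partial b f))"

definition polyharmonic_on :: "nat \<Rightarrow> 'a::euclidean_space set \<Rightarrow> ('a \<Rightarrow> real) \<Rightarrow> bool" where
  "polyharmonic_on p D f \<longleftrightarrow> Ck_on (2 * p) D f \<and> (\<forall>x\<in>D. (laplacian ^^ p) f x = 0)"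

definition harmonic_on :: "'a::euclidean_space set \<Rightarrow> ('a \<Rightarrow> real) \<Rightarrow> bool" where
  "harmonic_on D f \<longleftrightarrow> polyharmonic_on 1 D f"

definition dirichlet_regular :: "'a::euclidean_space set \<Rightarrow> bool" where
  "dirichlet_regular D \<longleftrightarrow>
    (\<forall>\<phi>. continuous_on (frontier D) \<phi> \<longrightarrow>
      (\<exists>u. continuous_on (closure D) u \<and> harmonic_on D u \<and> (\<forall>x\<in>frontier D. u x = \<phi> x)))"

text \<open>
  The iterated Laplacian as a function on the closure of the open set \<open>D\<close>. On the frontier the
  derivatives have no meaning, so the values of the iterates of order \<open>j > 0\<close> are there the
  limits from inside \<open>D\<close>; the iterate of order \<open>0\<close> is \<open>f\<close> itself. Only the values of \<open>f\<close> on
  \<open>closure D\<close> matter. When \<open>laplacian_cl D j f\<close> is continuous on \<open>closure D\<close>, it is the unique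
  continuous extension of the iterate from \<open>D\<close>.
\<close>

definition laplacian_cl :: "'a::euclidean_space set \<Rightarrow> nat \<Rightarrow> ('a \<Rightarrow> real) \<Rightarrow> 'a \<Rightarrow> real" where
  "laplacian_cl D j f x =
    (if j = 0 \<or> x \<in> D then (laplacian ^^ j) f x else Lim (at x within D) ((laplacian ^^ j) f))"

text \<open>
  The space \<open>HC\<^sup>r\<close> on the closure of \<open>D\<close>. The Laplacians are only required to exist as sums of
  second partial derivatives; no continuity of individual derivatives is imposed.
\<close>

definition HC :: "nat \<Rightarrow> 'a::euclidean_space set \<Rightarrow> ('a \<Rightarrow> real) set" where
  "HC r D = {f. (\<forall>j<r. laplacian_exists_on D ((laplacian ^^ j) f)) \<and>
                (\<forall>j\<le>r. continuous_on (closure D) (laplacian_cl D j f))}"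

definition polyharmonic_bvp ::
  "nat \<Rightarrow> 'a::euclidean_space set \<Rightarrow> ('a \<Rightarrow> real) \<Rightarrow> ('a \<Rightarrow> real) \<Rightarrow> bool" where
  "polyharmonic_bvp r D f h \<longleftrightarrow>
    polyharmonic_on (r + 1) D h \<and>
    (\<forall>j\<le>r. continuous_on (closure D) (laplacian_cl D j h) \<and>
           (\<forall>x\<in>frontier D. laplacian_cl D j h x = laplacian_cl D j f x))"

text \<open>
  The function \<open>h\<^sub>f\<close>. For bounded open \<open>D\<close>, solutions of the boundary value problem are unique on
  \<open>closure D\<close> by the maximum principle; the choice operator only leaves the irrelevant values
  outside \<open>closure D\<close> open.
\<close>

definition bvp_solution :: "nat \<Rightarrow> 'a::euclidean_space set \<Rightarrow> ('a \<Rightarrow> real) \<Rightarrow> 'a \<Rightarrow> real" where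
  "bvp_solution r D f = (SOME h. polyharmonic_bvp r D f h)"

text \<open>
  \<open>remainder r D f j\<close> is \<open>\<Delta>\<^sup>j F\<^sub>r\<close>, defined to be \<open>\<Delta>\<^sup>j f - \<Delta>\<^sup>j h\<^sub>f\<close> on \<open>closure D\<close> and \<open>0\<close> outside.
  Thus \<open>F\<^sub>r\<close> is the case \<open>j = 0\<close>. For \<open>j > 0\<close> this is in general not the distributional iterated
  Laplacian of \<open>F\<^sub>r\<close> on the whole space.
\<close>

definition remainder ::
  "nat \<Rightarrow> 'a::euclidean_space set \<Rightarrow> ('a \<Rightarrow> real) \<Rightarrow> nat \<Rightarrow> 'a \<Rightarrow> real" where
  "remainder r D f j x =
    (if x \<in> closure D then laplacian_cl D j f x - laplacian_cl D j (bvp_solution r D f) x else 0)"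

text \<open>
  The area measure of the unit sphere in polar coordinates: the area of a Borel set \<open>A\<close> of unit
  vectors is \<open>n\<close> times the volume of the cone \<open>{s *\<^sub>R \<xi> | \<xi> \<in> A, 0 < s < 1}\<close>. Here \<open>sgn x = x /\<^sub>R norm x\<close>;
  the exceptional point \<open>0\<close> is a null set.
\<close>

definition sphere_measure :: "'a::euclidean_space measure" where
  "sphere_measure =
    distr (density lborel (\<lambda>x. ennreal (real DIM('a)) * indicator (ball 0 1) x)) borel sgn"

definition spherical_mean :: "('a::euclidean_space \<Rightarrow> real) \<Rightarrow> 'a \<Rightarrow> real \<Rightarrow> real" where
  "spherical_mean g x t =
    (1 / measure sphere_measure (sphere (0::'a) 1)) *
    (LINT \<xi>:sphere 0 1|sphere_measure. g (x + t *\<^sub>R \<xi>))"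

definition spherical_difference :: "real \<Rightarrow> ('a::euclidean_space \<Rightarrow> real) \<Rightarrow> 'a \<Rightarrow> real" where
  "spherical_difference t g x = spherical_mean g x t - g x"

text \<open>The supremum is the intended one for bounded continuous \<open>g\<close>, as for real-valued \<open>Sup\<close>.\<close>

definition harmonicity_modulus :: "('a::euclidean_space \<Rightarrow> real) \<Rightarrow> real \<Rightarrow> real" where
  "harmonicity_modulus g u = Sup {\<bar>spherical_difference t g x\<bar> | t x. 0 < t \<and> t \<le> u}"

end

theory Submission
  imports Defs
begin

text \<open>
  Write \<open>n\<close> for the dimension, \<open>S\<^sub>t\<close> for the spherical mean of radius \<open>t\<close>, \<open>F = f - h\<^sub>f\<close>, \<open>g\<close> for the
  extension of \<open>\<Delta>\<^sup>r F\<close> by zero and \<open>\<omega>\<close> for the harmonicity modulus of \<open>g\<close> at \<open>1/p\<close>. The approximant is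
  \<open>T = h\<^sub>f + P + H\<close>, where \<open>P\<close> is a polynomial that is polyharmonic of order \<open>p\<close> and \<open>H\<close> is
  polyharmonic of order \<open>r\<close> and corrects the boundary values.

  The polynomial comes from averages. If \<open>k\<close> is a nonnegative polynomial of degree at most \<open>p - 1 - r\<close> in the
  square of the radius, then the average \<open>K v\<close> of \<open>S\<^sub>s v(x)\<close> with weight \<open>k(s) s\<^bsup>n-1\<^esup>\<close> is, up to a constant factor, the
  convolution of a compactly supported \<open>v\<close> with \<open>k(|y|)\<close>; on \<open>D\<close> it is a polynomial annihilated by
  \<open>\<Delta>\<^bsup>p-r\<^esup>\<close> (\<open>kmean_eq_integral\<close>, \<open>kernel_polynomial_potential\<close>). The question is how to correct
  \<open>v - K v\<close> so that its \<open>r\<close>-fold potential becomes small. Green's formula for spherical means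
  (\<open>spherical_mean_green\<close>) reads \<open>S\<^sub>t w(x) = w(x) + \<P>(S \<Delta>w(x))(t)\<close> with an explicit operator \<open>\<P>\<close> on functions
  of the radius that gains a factor \<open>t\<^sup>2\<close>. Start from the functional \<open>\<phi> \<mapsto> \<phi>(0) - K \<phi>\<close> on
  such functions and repeat \<open>\<mu> \<mapsto> \<mu> \<circ> \<P> - \<mu>(\<P> 1) K\<close>; all these functionals annihilate constants, so that
  \<open>\<mu>\<^sub>j(S w) = \<mu>\<^bsub>j+1\<^esub>(S \<Delta>w) + c\<^sub>j K(S \<Delta>w)\<close> (\<open>defect_expand\<close>). Therefore \<open>V(x) = \<mu>\<^sub>r(S v(x))\<close> satisfies
  \<open>\<Delta>\<^sup>r V = v - Q\<close> in \<open>D\<close> with a polynomial \<open>Q\<close> annihilated by \<open>\<Delta>\<^bsup>p-r\<^esup>\<close>.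

  \<open>V\<close> is small. For a Jackson kernel the moments of order \<open>2i\<close> are of size \<open>p\<^bsup>-2i\<^esup>\<close> (\<open>jackson_kernel\<close>),
  whence \<open>\<mu>\<^sub>r \<phi>\<close> is of size \<open>p\<^bsup>-2r-2i\<^esup>\<close> whenever \<open>|\<phi>(t)| \<le> t\<^bsup>2i\<^esup>\<close> (\<open>defect_bound\<close>). Split \<open>v\<close> into
  \<open>v - v\<^sub>1\<close> and its average \<open>v\<^sub>1\<close> over balls of radius \<open>1/p\<close> with a radial weight. The first part is of
  size \<open>\<omega>\<close>, and \<open>\<Delta>v\<^sub>1\<close> is of size \<open>p\<^sup>2 \<omega>\<close>, because it is again a radial average of differences \<open>S\<^sub>s v - v\<close>
  (\<open>regularisation_at_scale\<close>). Applied to the first part \<open>\<mu>\<^sub>r\<close> gains \<open>p\<^bsup>-2r\<^esup>\<close>; since it annihilates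
  constants it gains \<open>p\<^bsup>-2r-2\<^esup>\<close> on the second. Altogether \<open>V\<close> is of size \<open>p\<^bsup>-2r\<^esup> \<omega>\<close>.

  It remains to pass from \<open>v\<close> to \<open>F\<close>. Let \<open>v\<close> be smooth, compactly supported and very close to
  \<open>g\<close>, and let \<open>P\<close> be a polynomial with \<open>\<Delta>\<^sup>r P = Q\<close>. Then \<open>\<Delta>\<^sup>r (F - V - P) = g - v\<close> in \<open>D\<close> is
  negligible. If \<open>H\<close> is polyharmonic of order \<open>r\<close> in \<open>D\<close> and its iterated Laplacians have the same boundary
  values as those of \<open>F - V - P\<close>, then \<open>F - V - P - H\<close> is negligible by the maximum principle applied \<open>r\<close>
  times (\<open>laplacian_chain_bound\<close>), and \<open>f - T = V + (F - V - P - H)\<close>. The maximum principle uses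
  second partial derivatives only pointwise, which is all that \<open>HC\<close> provides.

  The functions \<open>h\<^sub>f\<close> and \<open>H\<close> are built by solving Poisson equations in \<open>D\<close> repeatedly, with
  right-hand sides that are known to be smooth only inside \<open>D\<close>. A continuous right-hand side has a potential
  that solves the equation in the sense of Green's formula for spherical means (\<open>weak_laplacian\<close>), a relation
  that survives uniform limits; adding a harmonic function from the regularity of \<open>D\<close> adjusts the boundary
  values. Averaging the relation with a bump turns it into smoothness
  (\<open>weak_laplacian_regularity\<close>).
\<close>

section \<open>Partial derivatives and functions of class \<open>C\<^sup>k\<close>\<close>

text \<open>
  The value and the existence of a partial derivative are bundled into one relation, so that the derivative
  rules for one real variable apply directly.
\<close>

definition has_partial :: "'a::euclidean_space \<Rightarrow> ('a \<Rightarrow> real) \<Rightarrow> 'a \<Rightarrow> real \<Rightarrow> bool" where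
  "has_partial b f x d \<longleftrightarrow> ((\<lambda>s. f (x + s *\<^sub>R b)) has_real_derivative d) (at 0)"

lemma has_partialD:
  assumes "has_partial b f x d"
  shows "partially_differentiable b f x" "partial b f x = d"
  using assms unfolding has_partial_def partially_differentiable_def partial_def
  by (auto intro: DERIV_imp_deriv simp: real_differentiable_def)

lemma has_partialI: "partially_differentiable b f x \<Longrightarrow> has_partial b f x (partial b f x)"
  unfolding has_partial_def partially_differentiable_def partial_def
  by (metis DERIV_imp_deriv real_differentiable_def)

lemma has_partial_along:
  assumes "partially_differentiable b f (x + s *\<^sub>R b)"
  shows "((\<lambda>s. f (x + s *\<^sub>R b)) has_real_derivative partial b f (x + s *\<^sub>R b)) (at s)"
proof -
  have "((\<lambda>t. f ((x + s *\<^sub>R b) + t *\<^sub>R b)) has_real_derivative partial b f (x + s *\<^sub>R b)) (at 0)"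
    using has_partialI[OF assms] unfolding has_partial_def .
  then have "((\<lambda>t. (\<lambda>s. f (x + s *\<^sub>R b)) (t + s)) has_real_derivative partial b f (x + s *\<^sub>R b)) (at 0)"
    by (simp add: algebra_simps)
  then show ?thesis
    using DERIV_shift[of "\<lambda>s. f (x + s *\<^sub>R b)" "partial b f (x + s *\<^sub>R b)" 0 s] by simp
qed

lemma eventually_line_in_open:
  fixes x b :: "'a::real_normed_vector"
  assumes "open S" "x \<in> S"
  shows "eventually (\<lambda>s::real. x + s *\<^sub>R b \<in> S) (nhds 0)"
proof -
  have "open ((\<lambda>s::real. x + s *\<^sub>R b) -` S)"
    by (intro open_vimage assms(1) continuous_intros)
  then show ?thesis using assms(2) by (auto simp: eventually_nhds)
qed

text \<open>
  Solutions of boundary value problems are prescribed on an open set only; derivatives inside the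
  set do not see the arbitrary values outside.
\<close>

lemma has_partial_cong:
  assumes "open S" "x \<in> S" "\<forall>y\<in>S. f y = g y"
  shows "has_partial b f x d = has_partial b g x d"
  unfolding has_partial_def
proof (rule DERIV_cong_ev)
  show "eventually (\<lambda>s. f (x + s *\<^sub>R b) = g (x + s *\<^sub>R b)) (nhds 0)"
    using eventually_line_in_open[OF assms(1,2)] by eventually_elim (use assms in auto)
qed auto

lemma partially_differentiable_cong:
  assumes "open S" "x \<in> S" "\<forall>y\<in>S. f y = g y"
  shows "partially_differentiable b f x = partially_differentiable b g x"
  using has_partial_cong[OF assms, of b] has_partialD(1)[of b] has_partialI[of b f x] has_partialI[of b g x]
  by blast

lemma partial_cong:
  assumes "open S" "x \<in> S" "\<forall>y\<in>S. f y = g y"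
  shows "partial b f x = partial b g x"
proof -
  have "eventually (\<lambda>s. f (x + s *\<^sub>R b) = g (x + s *\<^sub>R b)) (nhds 0)"
    using eventually_line_in_open[OF assms(1,2)] by eventually_elim (use assms in auto)
  then show ?thesis unfolding partial_def by (intro deriv_cong_ev) auto
qed

lemma laplacian_cong:
  assumes "open S" "x \<in> S" "\<forall>y\<in>S. f y = g y"
  shows "laplacian f x = laplacian g x"
proof -
  have "\<forall>y\<in>S. partial b f y = partial b g y" for b
    using partial_cong[OF assms(1) _ assms(3)] by blast
  then show ?thesis
    unfolding laplacian_def using partial_cong[OF assms(1,2)] by (intro sum.cong) auto
qed

lemma laplacian_exists_on_cong:
  assumes "open S" "\<forall>y\<in>S. f y = g y" "laplacian_exists_on S f"
  shows "laplacian_exists_on S g"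
  unfolding laplacian_exists_on_def
proof (intro ballI conjI)
  fix x b :: 'a assume xb: "x \<in> S" "b \<in> Basis"
  have *: "partially_differentiable b f x" "partially_differentiable b (partial b f) x"
    using assms(3) xb unfolding laplacian_exists_on_def by auto
  show "partially_differentiable b g x"
    using * partially_differentiable_cong[OF assms(1) xb(1) assms(2)] by blast
  have "\<forall>y\<in>S. partial b f y = partial b g y"
    using partial_cong[OF assms(1) _ assms(2)] by blast
  from partially_differentiable_cong[OF assms(1) xb(1) this, of b]
  show "partially_differentiable b (partial b g) x"
    using * by blast
qed

lemma laplacian_funpow_cong:
  assumes "open S" "\<forall>y\<in>S. f y = g y" "x \<in> S"
  shows "(laplacian ^^ j) f x = (laplacian ^^ j) g x"
  using assms(3)
proof (induction j arbitrary: x)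
  case (Suc j)
  have "\<forall>x\<in>S. (laplacian ^^ j) f x = (laplacian ^^ j) g x" using Suc.IH by blast
  then show ?case using laplacian_cong[OF assms(1) Suc.prems] by simp
qed (use assms in auto)

lemma has_partial_lin:
  assumes "has_partial b f x d" "has_partial b g x e"
  shows "has_partial b (\<lambda>x. c * f x + k * g x) x (c * d + k * e)"
  using assms unfolding has_partial_def by (auto intro!: derivative_eq_intros)

lemma has_partial_mult:
  assumes "has_partial b f x d" "has_partial b g x e"
  shows "has_partial b (\<lambda>x. f x * g x) x (d * g x + f x * e)"
  using assms unfolding has_partial_def by (auto intro!: derivative_eq_intros)

lemma has_partial_const: "has_partial b (\<lambda>x. c) x 0"
  unfolding has_partial_def by simp

lemma has_partial_inner: "has_partial b (\<lambda>x. x \<bullet> v) x (b \<bullet> v)"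
  unfolding has_partial_def by (auto intro!: derivative_eq_intros simp: inner_add_left)

lemma laplacian_lin:
  assumes "open S" "laplacian_exists_on S f" "laplacian_exists_on S g"
  shows "laplacian_exists_on S (\<lambda>x. c * f x + k * g x)"
    and "x \<in> S \<Longrightarrow> laplacian (\<lambda>x. c * f x + k * g x) x = c * laplacian f x + k * laplacian g x"
proof -
  let ?h = "\<lambda>x. c * f x + k * g x"
  have 1: "has_partial b ?h y (c * partial b f y + k * partial b g y)"
    if "y \<in> S" "b \<in> Basis" for y b
    using assms that unfolding laplacian_exists_on_def by (intro has_partial_lin has_partialI) auto
  have 2: "has_partial b (partial b ?h) y (c * partial b (partial b f) y + k * partial b (partial b g) y)"
    if "y \<in> S" "b \<in> Basis" for y b
  proof -
    have "has_partial b (\<lambda>y. c * partial b f y + k * partial b g y) y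
            (c * partial b (partial b f) y + k * partial b (partial b g) y)"
      using assms that unfolding laplacian_exists_on_def by (intro has_partial_lin has_partialI) auto
    then show ?thesis
      using has_partial_cong[OF assms(1) that(1), of "partial b ?h" "\<lambda>y. c * partial b f y + k * partial b g y"]
        has_partialD(2)[OF 1[OF _ that(2)]] by blast
  qed
  show "laplacian_exists_on S ?h"
    unfolding laplacian_exists_on_def using has_partialD(1)[OF 1] has_partialD(1)[OF 2] by blast
  show "laplacian ?h x = c * laplacian f x + k * laplacian g x" if "x \<in> S"
    unfolding laplacian_def using has_partialD(2)[OF 2[OF that]]
    by (simp add: sum.distrib sum_distrib_left)
qed

lemma Ck_on_imp_continuous: "Ck_on k D f \<Longrightarrow> continuous_on D f"
  by (cases k) auto

lemma Ck_on_cong: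
  assumes "open D" "\<forall>x\<in>D. f x = g x"
  shows "Ck_on k D f \<longleftrightarrow> Ck_on k D g"
  using assms(2)
proof (induction k arbitrary: f g)
  case 0
  then show ?case by (simp cong: continuous_on_cong)
next
  case (Suc k)
  have "Ck_on k D (partial b f) \<longleftrightarrow> Ck_on k D (partial b g)" for b
    by (rule Suc.IH) (use partial_cong[OF assms(1) _ Suc.prems] in blast)
  moreover have "\<forall>x\<in>D. partially_differentiable b f x \<longleftrightarrow> partially_differentiable b g x" for b
    using partially_differentiable_cong[OF assms(1) _ Suc.prems] by blast
  moreover have "continuous_on D f \<longleftrightarrow> continuous_on D g"
    using Suc.prems by (simp cong: continuous_on_cong)
  ultimately show ?case by simp
qed

lemma Ck_on_SucI:
  assumes "open D" "continuous_on D f"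
    "\<And>b x. b \<in> Basis \<Longrightarrow> x \<in> D \<Longrightarrow> has_partial b f x (g b x)"
    "\<And>b. b \<in> Basis \<Longrightarrow> Ck_on k D (g b)"
  shows "Ck_on (Suc k) D f"
proof -
  have "Ck_on k D (partial b f)" if "b \<in> Basis" for b
    using assms(4)[OF that] Ck_on_cong[OF assms(1), of "partial b f" "g b"] has_partialD(2)[OF assms(3)[OF that]] by blast
  then show ?thesis using assms(2) has_partialD(1)[OF assms(3)] by simp
qed

lemma Ck_on_Suc_mono: "Ck_on (Suc k) D f \<Longrightarrow> Ck_on k D f"
  by (induction k arbitrary: f) auto

lemma Ck_on_mono: "Ck_on m D f \<Longrightarrow> k \<le> m \<Longrightarrow> Ck_on k D f"
proof (induction m)
  case (Suc m) then show ?case using Ck_on_Suc_mono le_Suc_eq by blast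
qed auto

lemma Ck_on_subset: "Ck_on k D f \<Longrightarrow> E \<subseteq> D \<Longrightarrow> Ck_on k E f"
  by (induction k arbitrary: f) (auto intro: continuous_on_subset)

text \<open>
  Smoothness of a solution of an elliptic equation is obtained by a representation near each point
  separately.
\<close>

lemma Ck_on_local:
  assumes "open D" "\<And>x. x \<in> D \<Longrightarrow> \<exists>S. open S \<and> x \<in> S \<and> Ck_on k S f"
  shows "Ck_on k D f"
  using assms(2)
proof (induction k arbitrary: f)
  case 0
  have "isCont f x" if "x \<in> D" for x
    using 0[OF that] continuous_on_eq_continuous_at by fastforce
  then show ?case by (simp add: continuous_at_imp_continuous_on)
next
  case (Suc k)
  have "isCont f x" if "x \<in> D" for x
    using Suc.prems[OF that] continuous_on_eq_continuous_at by fastforce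
  then have "continuous_on D f" by (simp add: continuous_at_imp_continuous_on)
  moreover have "Ck_on k D (partial b f)" if "b \<in> Basis" for b
  proof (rule Suc.IH)
    fix x assume "x \<in> D"
    from Suc.prems[OF this] that show "\<exists>S. open S \<and> x \<in> S \<and> Ck_on k S (partial b f)" by auto
  qed
  moreover have "partially_differentiable b f x" if "b \<in> Basis" "x \<in> D" for b x
    using Suc.prems[OF that(2)] that(1) by auto
  ultimately show ?case by auto
qed

lemma Ck_on_const: "open D \<Longrightarrow> Ck_on k D (\<lambda>x. c)"
proof (induction k arbitrary: c)
  case (Suc k)
  show ?case
    by (rule Ck_on_SucI[where g = "\<lambda>b x. 0"]) (use Suc has_partial_const in auto)
qed auto

lemma Ck_on_inner: "open D \<Longrightarrow> Ck_on k D (\<lambda>x. x \<bullet> v)"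
proof (induction k)
  case (Suc k)
  show ?case
    by (rule Ck_on_SucI[where g = "\<lambda>b x. b \<bullet> v"])
       (use Suc in \<open>auto intro: has_partial_inner Ck_on_const intro!: continuous_intros\<close>)
qed (auto intro!: continuous_intros)

lemma Ck_on_lin:
  assumes "open D" "Ck_on k D f" "Ck_on k D g"
  shows "Ck_on k D (\<lambda>x. c * f x + d * g x)"
  using assms(2,3)
proof (induction k arbitrary: f g)
  case 0 then show ?case by (auto intro!: continuous_intros)
next
  case (Suc k)
  show ?case
    by (rule Ck_on_SucI[where g = "\<lambda>b x. c * partial b f x + d * partial b g x"])
       (use Suc.prems in \<open>auto intro!: has_partial_lin has_partialI continuous_intros assms(1) Suc.IH\<close>)
qed

lemma Ck_on_add: "open D \<Longrightarrow> Ck_on k D f \<Longrightarrow> Ck_on k D g \<Longrightarrow> Ck_on k D (\<lambda>x. f x + g x)"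
  using Ck_on_lin[of D k f g 1 1] by simp

lemma Ck_on_cmult: "open D \<Longrightarrow> Ck_on k D f \<Longrightarrow> Ck_on k D (\<lambda>x. c * f x)"
  using Ck_on_lin[of D k f f c 0] by simp

lemma Ck_on_sum:
  assumes "open D" "\<And>i. i \<in> I \<Longrightarrow> Ck_on k D (f i)"
  shows "Ck_on k D (\<lambda>x. \<Sum>i\<in>I. f i x)"
  using assms(2)
proof (induction I rule: infinite_finite_induct)
  case (insert i I)
  then show ?case by (simp add: Ck_on_add[OF assms(1)])
qed (simp_all add: Ck_on_const[OF assms(1)])

lemma Ck_on_mult:
  assumes "open D" "Ck_on k D f" "Ck_on k D g"
  shows "Ck_on k D (\<lambda>x. f x * g x)"
  using assms(2,3)
proof (induction k arbitrary: f g)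
  case 0 then show ?case by (auto intro!: continuous_intros)
next
  case (Suc k)
  show ?case
    by (rule Ck_on_SucI[where g = "\<lambda>b x. partial b f x * g x + f x * partial b g x"])
       (use Suc.prems in \<open>auto intro!: has_partial_mult has_partialI continuous_intros
          Ck_on_add assms(1) Suc.IH intro: Ck_on_Suc_mono\<close>)
qed

lemma Ck_on_power: "open D \<Longrightarrow> Ck_on k D f \<Longrightarrow> Ck_on k D (\<lambda>x. f x ^ m)"
  by (induction m) (auto intro: Ck_on_const Ck_on_mult)

lemma Ck_on_norm_sq: "open D \<Longrightarrow> Ck_on k D (\<lambda>x::'a::euclidean_space. (norm x)\<^sup>2)"
proof -
  assume D: "open D"
  have "(\<lambda>x::'a. (norm x)\<^sup>2) = (\<lambda>x. \<Sum>b\<in>Basis. (x \<bullet> b) * (x \<bullet> b))"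
    unfolding power2_norm_eq_inner by (rule ext) (rule euclidean_inner)
  then show ?thesis
    using D by (simp only:) (intro Ck_on_sum Ck_on_mult Ck_on_inner)
qed

lemma Ck_on_2_laplacian_exists: "Ck_on 2 D f \<Longrightarrow> laplacian_exists_on D f"
  unfolding laplacian_exists_on_def by (simp add: eval_nat_numeral)

lemma Ck_on_laplacian:
  assumes "open D" "Ck_on (k + 2) D f"
  shows "Ck_on k D (laplacian f)"
  unfolding laplacian_def
proof (intro Ck_on_sum assms(1))
  fix b :: 'a assume b: "b \<in> Basis"
  have "Ck_on (Suc (Suc k)) D f" using assms(2) by simp
  then have "Ck_on (Suc k) D (partial b f)" using b by auto
  then show "Ck_on k D (partial b (partial b f))" using b by auto
qed

lemma Ck_on_laplacian_funpow:
  assumes "open D" "Ck_on (k + 2 * j) D f"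
  shows "Ck_on k D ((laplacian ^^ j) f)"
  using assms(2)
proof (induction j arbitrary: k)
  case (Suc j)
  have "Ck_on (k + 2) D ((laplacian ^^ j) f)"
    using Suc.IH[of "k + 2"] Suc.prems by (simp only: mult_Suc_right add.assoc)
  then show ?case using Ck_on_laplacian[OF assms(1)] by (simp only: funpow.simps o_def)
qed auto

lemma laplacian_lin_C2:
  assumes "open S" "Ck_on 2 S f" "Ck_on 2 S g" "x \<in> S"
  shows "laplacian (\<lambda>x. c * f x + k * g x) x = c * laplacian f x + k * laplacian g x"
  by (rule laplacian_lin(2)[OF assms(1) Ck_on_2_laplacian_exists[OF assms(2)] Ck_on_2_laplacian_exists[OF assms(3)] assms(4)])

lemma laplacian_const: "laplacian (\<lambda>_. c) (x :: 'a::euclidean_space) = 0"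
proof -
  have "partial b (\<lambda>_::'a. k) = (\<lambda>_. 0)" for b and k :: real using has_partialD(2)[OF has_partial_const] by blast
  then show ?thesis unfolding laplacian_def by simp
qed

lemma laplacian_sum_C2:
  fixes f :: "'i \<Rightarrow> 'a::euclidean_space \<Rightarrow> real"
  assumes S: "open S" "x \<in> S" and f: "\<And>i. i \<in> I \<Longrightarrow> Ck_on 2 S (f i)"
  shows "laplacian (\<lambda>x. \<Sum>i\<in>I. a i * f i x) x = (\<Sum>i\<in>I. a i * laplacian (f i) x)"
  using f
proof (induction I rule: infinite_finite_induct)
  case (insert i I)
  have "laplacian (\<lambda>x. a i * f i x + 1 * (\<Sum>i\<in>I. a i * f i x)) x = a i * laplacian (f i) x + 1 * laplacian (\<lambda>x. \<Sum>i\<in>I. a i * f i x) x"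
    by (rule laplacian_lin_C2[OF S(1) _ _ S(2)]) (use insert.prems in \<open>auto intro!: Ck_on_sum Ck_on_cmult S(1)\<close>)
  then show ?case using insert by simp
qed (simp_all add: laplacian_const)

text \<open>
  The even powers of the norm are closed under the Laplacian up to explicit factors. This makes
  a polynomial in the square of the norm polyharmonic, of order one more than its degree, and lets such
  polynomials be integrated term by term.
\<close>

lemma laplacian_norm_power:
  fixes x :: "'a::euclidean_space"
  shows "laplacian (\<lambda>y. (norm y) ^ (2 * Suc i)) x = (2 * real i + 2) * (2 * real i + real DIM('a)) * norm x ^ (2 * i)"
proof -
  define q where "q y = (norm y)\<^sup>2" for y :: 'a
  have e: "norm y ^ (2 * j) = q y ^ j" for j and y :: 'a unfolding q_def by (simp add: power_mult)
  have 1: "has_partial b q y (2 * (y \<bullet> b))" for y b :: 'a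
  proof -
    have l: "(\<lambda>s. q (y + s *\<^sub>R b)) = (\<lambda>s. y \<bullet> y + s * (2 * (y \<bullet> b)) + s * s * (b \<bullet> b))"
      unfolding q_def by (rule ext) (simp add: power2_norm_eq_inner inner_add_left inner_add_right inner_commute algebra_simps)
    show ?thesis unfolding has_partial_def l by (auto intro!: derivative_eq_intros)
  qed
  have 2: "has_partial b (\<lambda>y. q y ^ j) y (real j * q y ^ (j - 1) * (2 * (y \<bullet> b)))" for y b :: 'a and j
    using DERIV_chain2[of "\<lambda>t. t ^ j" _ "\<lambda>s. q (y + s *\<^sub>R b)", OF DERIV_pow 1[unfolded has_partial_def, of y b]]
    unfolding has_partial_def by simp
  have p: "partial b (\<lambda>y. q y ^ Suc i) = (\<lambda>y. (2 * real i + 2) * (q y ^ i * (y \<bullet> b)))" for b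
    using has_partialD(2)[OF 2[of b "Suc i"]] by (auto simp: algebra_simps)
  have 3: "has_partial b (\<lambda>y. q y ^ i * (y \<bullet> b)) x (real i * q x ^ (i - 1) * (2 * (x \<bullet> b)) * (x \<bullet> b) + q x ^ i * (b \<bullet> b))" for b
    by (rule has_partial_mult[OF 2 has_partial_inner])
  have 4: "partial b (\<lambda>y. (2 * real i + 2) * (q y ^ i * (y \<bullet> b))) x
     = (2 * real i + 2) * (2 * real i * q x ^ (i - 1) * ((x \<bullet> b) * (x \<bullet> b)) + q x ^ i * (b \<bullet> b))" for b
    using has_partialD(2)[OF has_partial_lin[OF 3[of b] 3[of b], of "2 * real i + 2" 0]]
    by (simp add: mult_ac)
  have s: "(\<Sum>b\<in>Basis. (x \<bullet> b) * (x \<bullet> b)) = q x"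
    unfolding q_def by (simp only: euclidean_inner[of x x, symmetric] dot_square_norm)
  have "laplacian (\<lambda>y. q y ^ Suc i) x
    = (\<Sum>b\<in>Basis. (2 * real i + 2) * (2 * real i * q x ^ (i - 1) * ((x \<bullet> b) * (x \<bullet> b)) + q x ^ i * (b \<bullet> b)))"
    unfolding laplacian_def p 4 ..
  also have "\<dots> = (2 * real i + 2) * (2 * real i * q x ^ (i - 1) * (\<Sum>b\<in>Basis. (x \<bullet> b) * (x \<bullet> b)) + q x ^ i * (\<Sum>b\<in>(Basis::'a set). b \<bullet> b))"
    by (simp only: sum_distrib_left[symmetric] sum.distrib)
  also have "\<dots> = (2 * real i + 2) * (2 * real i * (q x ^ (i - 1) * q x) + q x ^ i * real DIM('a))"
    unfolding s by (simp add: mult.assoc)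
  also have "\<dots> = (2 * real i + 2) * (2 * real i + real DIM('a)) * q x ^ i"
    by (cases i) (auto simp: algebra_simps)
  finally show ?thesis unfolding e .
qed

lemma Ck_on_norm_power: "open S \<Longrightarrow> Ck_on k S (\<lambda>y::'a::euclidean_space. norm y ^ (2 * i))"
  unfolding power_mult by (intro Ck_on_power Ck_on_norm_sq)

lemma continuous_on_laplacian: "open S \<Longrightarrow> Ck_on 2 S f \<Longrightarrow> continuous_on S (laplacian f)"
  using Ck_on_laplacian[of S 0 f] by (simp only: Ck_on.simps add_0)

lemma laplacian_norm_sq: "laplacian (\<lambda>x::'a::euclidean_space. (norm x)\<^sup>2) x = 2 * real DIM('a)"
  using laplacian_norm_power[of 0 x] by simp

section \<open>Bounded functionals applied to translates\<close>

text \<open>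
  A functional of this kind is a signed measure on a ball, but no measure is ever needed: every operator below
  has the form of such a functional applied to the translates of a function, and linearity together with the bound by
  the maximum suffices to differentiate it.
\<close>

definition bounded_functional :: "real \<Rightarrow> real \<Rightarrow> (('a::euclidean_space \<Rightarrow> real) \<Rightarrow> real) \<Rightarrow> bool" where
  "bounded_functional R C L \<longleftrightarrow>
    (\<forall>u v a c. continuous_on (cball 0 R) u \<longrightarrow> continuous_on (cball 0 R) v \<longrightarrow>
       L (\<lambda>z. a * u z + c * v z) = a * L u + c * L v) \<and>
    (\<forall>u B. continuous_on (cball 0 R) u \<longrightarrow> (\<forall>z\<in>cball 0 R. \<bar>u z\<bar> \<le> B) \<longrightarrow> \<bar>L u\<bar> \<le> C * B)"

lemma bounded_functionalD:
  assumes "bounded_functional R C L" "continuous_on (cball 0 R) u"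
  shows "continuous_on (cball 0 R) v \<Longrightarrow> L (\<lambda>z. a * u z + c * v z) = a * L u + c * L v"
    and "(\<And>z. z \<in> cball 0 R \<Longrightarrow> \<bar>u z\<bar> \<le> B) \<Longrightarrow> \<bar>L u\<bar> \<le> C * B"
  using assms unfolding bounded_functional_def by blast+

lemma bounded_functional_diff_le:
  assumes "bounded_functional R C L" "continuous_on (cball 0 R) u" "continuous_on (cball 0 R) v"
    "\<And>z. z \<in> cball 0 R \<Longrightarrow> \<bar>u z - v z\<bar> \<le> B"
  shows "\<bar>L u - L v\<bar> \<le> C * B"
proof -
  have "L (\<lambda>z. u z - v z) = L u - L v"
    using bounded_functionalD(1)[OF assms(1,2,3), of 1 "-1"] by simp
  moreover have "\<bar>L (\<lambda>z. u z - v z)\<bar> \<le> C * B"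
    by (rule bounded_functionalD(2)[OF assms(1)]) (use assms in \<open>auto intro!: continuous_intros\<close>)
  ultimately show ?thesis by simp
qed

lemma bounded_functional_nonneg:
  assumes "bounded_functional R C L" shows "C \<ge> 0"
  using bounded_functionalD(2)[OF assms, of "\<lambda>_. 0" 1] by auto

lemma continuous_on_translate:
  fixes x :: "'a::real_normed_vector"
  assumes "continuous_on S w" "cball x R \<subseteq> S"
  shows "continuous_on (cball 0 R) (\<lambda>z. w (x + z))"
proof (rule continuous_on_compose2[OF assms(1)])
  show "(\<lambda>z. x + z) ` cball 0 R \<subseteq> S" using assms(2) by (auto simp: subset_iff dist_norm)
qed (intro continuous_intros)

text \<open>
  A function on an open set is controlled on a slightly larger ball than the one where the functional lives; this is
  the room in which difference quotients are formed.
\<close>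

lemma cball_margin:
  fixes x :: "'a::euclidean_space"
  assumes "open S" "cball x R \<subseteq> S" "R \<ge> 0"
  obtains e where "e > 0" "cball x (R + e) \<subseteq> S"
proof -
  obtain e where e: "e > 0" "(\<Union>y\<in>cball x R. cball y e) \<subseteq> S"
    using compact_subset_open_imp_cball_epsilon_subset[OF compact_cball assms(1,2)] by blast
  have "cball x (R + e) \<subseteq> S"
  proof
    fix y assume y: "y \<in> cball x (R + e)"
    show "y \<in> S"
    proof (cases "norm (y - x) \<le> R")
      case True then show ?thesis using assms(2) by (auto simp: dist_norm norm_minus_commute)
    next
      case False
      define k where "k = R / norm (y - x)"
      define y' where "y' = x + k *\<^sub>R (y - x)"
      have n: "norm (y - x) > 0" using False assms(3) by linarith
      have "norm (y' - x) = R" unfolding y'_def k_def using n assms(3) by simp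
      then have 1: "y' \<in> cball x R" by (simp add: dist_norm norm_minus_commute)
      have "y - y' = (1 - k) *\<^sub>R (y - x)" unfolding y'_def by (simp add: algebra_simps)
      moreover have "1 - k \<ge> 0" unfolding k_def using False n by (simp add: field_simps)
      ultimately have "norm (y - y') = (1 - k) * norm (y - x)" by simp
      also have "\<dots> = norm (y - x) - R" unfolding k_def using n by (simp add: field_simps)
      also have "\<dots> \<le> e" using y by (simp add: dist_norm norm_minus_commute)
      finally have "y \<in> cball y' e" by (simp add: dist_norm norm_minus_commute)
      then show ?thesis using e(2) 1 by blast
    qed
  qed
  with e(1) show ?thesis using that by blast
qed

lemma cball_translate_subset:
  fixes x y :: "'a::real_normed_vector"
  assumes "dist x y \<le> e" "cball x (R + e) \<subseteq> S" shows "cball y R \<subseteq> S"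
proof
  fix z assume "z \<in> cball y R"
  then have "dist x z \<le> R + e" using dist_triangle[of x z y] assms(1) by auto
  then show "z \<in> S" using assms(2) by auto
qed

lemma open_inner_parallel:
  fixes S :: "'a::euclidean_space set"
  assumes "open S" "R \<ge> 0"
  shows "open {x. cball x R \<subseteq> S}"
  unfolding open_contains_ball
proof (rule ballI)
  fix x assume "x \<in> {x. cball x R \<subseteq> S}"
  then have "cball x R \<subseteq> S" by simp
  then obtain e where e: "e > 0" "cball x (R + e) \<subseteq> S" using cball_margin[OF assms(1) _ assms(2)] by blast
  have "cball y R \<subseteq> S" if "y \<in> ball x e" for y
    by (rule cball_translate_subset[OF _ e(2)]) (use that in simp)
  then have "ball x e \<subseteq> {x. cball x R \<subseteq> S}" by blast
  with e(1) show "\<exists>e>0. ball x e \<subseteq> {x. cball x R \<subseteq> S}" by blast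
qed

lemma uniformly_close_on_margin:
  fixes w :: "'a::euclidean_space \<Rightarrow> real"
  assumes "open S" "continuous_on S w" "cball x R \<subseteq> S" "R \<ge> 0" "\<epsilon> > 0"
  obtains d where "d > 0" "cball x (R + d) \<subseteq> S"
    "\<And>z h. norm z \<le> R \<Longrightarrow> norm h \<le> d \<Longrightarrow> \<bar>w (x + z + h) - w (x + z)\<bar> \<le> \<epsilon>"
proof -
  obtain e where e: "e > 0" "cball x (R + e) \<subseteq> S" using cball_margin[OF assms(1,3,4)] .
  have "uniformly_continuous_on (cball x (R + e)) w"
    by (intro compact_uniformly_continuous continuous_on_subset[OF assms(2) e(2)] compact_cball)
  then obtain d where d: "d > 0" "\<And>y y'. y \<in> cball x (R + e) \<Longrightarrow> y' \<in> cball x (R + e) \<Longrightarrow> dist y' y < d \<Longrightarrow> dist (w y') (w y) < \<epsilon>"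
    using assms(5) unfolding uniformly_continuous_on_def by metis
  define d' where "d' = min e (d / 2)"
  show ?thesis
  proof (rule that[of d'])
    show "d' > 0" "cball x (R + d') \<subseteq> S" using d(1) e unfolding d'_def by auto
    fix z h :: 'a assume zh: "norm z \<le> R" "norm h \<le> d'"
    have "norm (z + h) \<le> R + e" using norm_triangle_ineq[of z h] zh unfolding d'_def by linarith
    then have "x + z + h \<in> cball x (R + e)" "x + z \<in> cball x (R + e)"
      using zh e(1) norm_minus_cancel[of z] norm_minus_cancel[of "z + h"] by (auto simp: dist_norm add.assoc)
    from d(2)[OF this(2,1)] zh(2) d(1) show "\<bar>w (x + z + h) - w (x + z)\<bar> \<le> \<epsilon>"
      unfolding d'_def by (auto simp: dist_norm)
  qed
qed

lemma bounded_functional_continuous: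
  fixes w :: "'a::euclidean_space \<Rightarrow> real"
  assumes L: "bounded_functional R C L" and R: "R \<ge> 0" and S: "open S" and w: "continuous_on S w"
  shows "continuous_on {x. cball x R \<subseteq> S} (\<lambda>x. L (\<lambda>z. w (x + z)))"
  unfolding continuous_on_iff
proof (intro ballI allI impI)
  fix x \<epsilon> assume x: "x \<in> {x. cball x R \<subseteq> S}" and eps: "0 < (\<epsilon>::real)"
  define \<eta> where "\<eta> = \<epsilon> / (2 * (C + 1))"
  have C: "C \<ge> 0" using bounded_functional_nonneg[OF L] .
  have eta: "\<eta> > 0" unfolding \<eta>_def using C eps by simp
  have "cball x R \<subseteq> S" using x by simp
  from uniformly_close_on_margin[OF S w this R eta] obtain d where
    d: "d > 0" "cball x (R + d) \<subseteq> S" "\<And>z h. norm z \<le> R \<Longrightarrow> norm h \<le> d \<Longrightarrow> \<bar>w (x + z + h) - w (x + z)\<bar> \<le> \<eta>"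
    by blast
  show "\<exists>d>0. \<forall>x'\<in>{x. cball x R \<subseteq> S}. dist x' x < d \<longrightarrow> dist (L (\<lambda>z. w (x' + z))) (L (\<lambda>z. w (x + z))) < \<epsilon>"
  proof (intro exI[of _ d] conjI d(1) ballI impI)
    fix x' assume x': "x' \<in> {x. cball x R \<subseteq> S}" "dist x' x < d"
    have "\<bar>L (\<lambda>z. w (x' + z)) - L (\<lambda>z. w (x + z))\<bar> \<le> C * \<eta>"
    proof (rule bounded_functional_diff_le[OF L])
      show "\<bar>w (x' + z) - w (x + z)\<bar> \<le> \<eta>" if "z \<in> cball 0 R" for z
        using d(3)[of z "x' - x"] that x'(2) by (simp add: dist_norm algebra_simps)
    qed (use x x' continuous_on_translate[OF w] in auto)
    also have "\<dots> < \<epsilon>" unfolding \<eta>_def using C eps by (simp add: field_simps add_nonneg_pos)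
    finally show "dist (L (\<lambda>z. w (x' + z))) (L (\<lambda>z. w (x + z))) < \<epsilon>" by (simp add: dist_norm)
  qed
qed

text \<open>
  The difference quotients of a function with continuous partial derivative converge uniformly on compact
  sets, by the mean value theorem, and the functional is continuous for uniform convergence. Hence it can be
  interchanged with the derivative without any theorem on integrals.
\<close>

lemma bounded_functional_has_partial:
  fixes w :: "'a::euclidean_space \<Rightarrow> real"
  assumes L: "bounded_functional R C L" and R: "R \<ge> 0" and S: "open S" and w: "continuous_on S w"
    and pd: "\<And>y. y \<in> S \<Longrightarrow> partially_differentiable b w y" and cw: "continuous_on S (partial b w)"
    and x: "cball x R \<subseteq> S" and b: "b \<in> Basis"
  shows "has_partial b (\<lambda>x. L (\<lambda>z. w (x + z))) x (L (\<lambda>z. partial b w (x + z)))"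
  unfolding has_partial_def DERIV_def LIM_eq
proof (intro allI impI)
  fix \<epsilon> :: real assume eps: "0 < \<epsilon>"
  define \<eta> where "\<eta> = \<epsilon> / (2 * (C + 1))"
  have C: "C \<ge> 0" using bounded_functional_nonneg[OF L] .
  have eta: "\<eta> > 0" unfolding \<eta>_def using C eps by simp
  from uniformly_close_on_margin[OF S cw x R eta] obtain d where
    d: "d > 0" "cball x (R + d) \<subseteq> S" "\<And>z h. norm z \<le> R \<Longrightarrow> norm h \<le> d \<Longrightarrow> \<bar>partial b w (x + z + h) - partial b w (x + z)\<bar> \<le> \<eta>"
    by blast
  show "\<exists>s>0. \<forall>t. t \<noteq> 0 \<and> norm (t - 0) < s \<longrightarrow>
     norm ((L (\<lambda>z. w (x + (0 + t) *\<^sub>R b + z)) - L (\<lambda>z. w (x + 0 *\<^sub>R b + z))) / t - L (\<lambda>z. partial b w (x + z))) < \<epsilon>"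
  proof (intro exI[of _ d] conjI d(1) allI impI)
    fix t :: real assume "t \<noteq> 0 \<and> norm (t - 0) < d"
    then have t: "t \<noteq> 0" "\<bar>t\<bar> < d" by auto
    have xt: "cball (x + t *\<^sub>R b) R \<subseteq> S"
      using cball_translate_subset[OF _ d(2)] t(2) b by (simp add: dist_norm)
    note c1 = continuous_on_translate[OF w xt] and c2 = continuous_on_translate[OF w x]
      and c3 = continuous_on_translate[OF cw x]
    let ?q = "\<lambda>z. (1 / t) * w (x + t *\<^sub>R b + z) + (- 1 / t) * w (x + z)"
    have "\<bar>L ?q - L (\<lambda>z. partial b w (x + z))\<bar> \<le> C * \<eta>"
    proof (rule bounded_functional_diff_le[OF L])
      fix z :: 'a assume z: "z \<in> cball 0 R"
      let ?g = "\<lambda>s. w (x + z + s *\<^sub>R b)"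
      have inS: "x + z + s *\<^sub>R b \<in> S" if "\<bar>s\<bar> \<le> d" for s
      proof -
        have "norm (z + s *\<^sub>R b) \<le> norm z + \<bar>s\<bar>" using norm_triangle_ineq[of z "s *\<^sub>R b"] b by simp
        then have "norm (z + s *\<^sub>R b) \<le> R + d" using z that by simp
        then have "x + z + s *\<^sub>R b \<in> cball x (R + d)"
          by (metis add.assoc add_diff_cancel_left' dist_commute dist_norm mem_cball)
        then show ?thesis using d(2) by blast
      qed
      have der: "(?g has_real_derivative partial b w (x + z + s *\<^sub>R b)) (at s)" if "\<bar>s\<bar> \<le> d" for s
        by (rule has_partial_along[OF pd[OF inS[OF that]]])
      have "\<exists>\<xi>. \<bar>\<xi>\<bar> \<le> \<bar>t\<bar> \<and> ?g t - ?g 0 = t * partial b w (x + z + \<xi> *\<^sub>R b)"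
      proof (cases "t > 0")
        case True
        have "\<exists>\<xi>. \<xi> > 0 \<and> \<xi> < t \<and> ?g t - ?g 0 = (t - 0) * partial b w (x + z + \<xi> *\<^sub>R b)"
          using MVT2[OF True, of ?g "\<lambda>s. partial b w (x + z + s *\<^sub>R b)"] der t(2) by auto
        then show ?thesis by force
      next
        case False
        then have "t < 0" using t by simp
        then have "\<exists>\<xi>. \<xi> > t \<and> \<xi> < 0 \<and> ?g 0 - ?g t = (0 - t) * partial b w (x + z + \<xi> *\<^sub>R b)"
          using MVT2[of t 0 ?g "\<lambda>s. partial b w (x + z + s *\<^sub>R b)"] der t(2) by auto
        then obtain \<xi> where "\<xi> > t" "\<xi> < 0" "?g 0 - ?g t = (0 - t) * partial b w (x + z + \<xi> *\<^sub>R b)" by blast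
        then show ?thesis by (intro exI[of _ \<xi>]) auto
      qed
      then obtain \<xi> where xi: "\<bar>\<xi>\<bar> \<le> \<bar>t\<bar>" "?g t - ?g 0 = t * partial b w (x + z + \<xi> *\<^sub>R b)" by blast
      have "?q z = (?g t - ?g 0) / t" by (simp add: diff_divide_distrib algebra_simps)
      also have "\<dots> = partial b w (x + z + \<xi> *\<^sub>R b)" using xi(2) t(1) by simp
      finally have "?q z = partial b w (x + z + \<xi> *\<^sub>R b)" .
      then show "\<bar>?q z - partial b w (x + z)\<bar> \<le> \<eta>"
        using d(3)[of z "\<xi> *\<^sub>R b"] z xi(1) t(2) b by simp
    qed (use c1 c2 c3 t(1) in \<open>auto intro!: continuous_intros\<close>)
    also have "C * \<eta> < \<epsilon>" unfolding \<eta>_def using C eps by (simp add: field_simps add_nonneg_pos)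
    finally have "\<bar>L ?q - L (\<lambda>z. partial b w (x + z))\<bar> < \<epsilon>" .
    moreover have "L ?q = (L (\<lambda>z. w (x + t *\<^sub>R b + z)) - L (\<lambda>z. w (x + z))) / t"
      using bounded_functionalD(1)[OF L c1 c2, of "1 / t" "-1/t"] by (simp add: diff_divide_distrib)
    ultimately show "norm ((L (\<lambda>z. w (x + (0 + t) *\<^sub>R b + z)) - L (\<lambda>z. w (x + 0 *\<^sub>R b + z))) / t - L (\<lambda>z. partial b w (x + z))) < \<epsilon>"
      by simp
  qed
qed

lemma bounded_functional_Ck_on:
  fixes w :: "'a::euclidean_space \<Rightarrow> real"
  assumes L: "bounded_functional R C L" and R: "R \<ge> 0" and S: "open S" and w: "Ck_on k S w"
  shows "Ck_on k {x. cball x R \<subseteq> S} (\<lambda>x. L (\<lambda>z. w (x + z)))"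
  using w
proof (induction k arbitrary: w)
  case 0
  then show ?case using bounded_functional_continuous[OF L R S] by simp
next
  case (Suc k)
  show ?case
  proof (rule Ck_on_SucI)
    show "open {x. cball x R \<subseteq> S}" by (rule open_inner_parallel[OF S R])
    show "continuous_on {x. cball x R \<subseteq> S} (\<lambda>x. L (\<lambda>z. w (x + z)))"
      using bounded_functional_continuous[OF L R S] Suc.prems by simp
    show "has_partial b (\<lambda>x. L (\<lambda>z. w (x + z))) x (L (\<lambda>z. partial b w (x + z)))"
      if "b \<in> Basis" "x \<in> {x. cball x R \<subseteq> S}" for b x
      using bounded_functional_has_partial[OF L R S, of w b x] Suc.prems that
        Ck_on_imp_continuous[of k S "partial b w"] by auto
    show "Ck_on k {x. cball x R \<subseteq> S} (\<lambda>x. L (\<lambda>z. partial b w (x + z)))" if "b \<in> Basis" for b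
      using Suc.IH Suc.prems that by auto
  qed
qed

lemma bounded_functional_sum:
  assumes L: "bounded_functional R C L" and "finite I" "\<And>i. i \<in> I \<Longrightarrow> continuous_on (cball 0 R) (u i)"
  shows "L (\<lambda>z. \<Sum>i\<in>I. u i z) = (\<Sum>i\<in>I. L (u i))"
  using assms(2,3)
proof (induction I)
  case empty
  show ?case using bounded_functionalD(1)[OF L, of "\<lambda>_. 0" "\<lambda>_. 0" 0 0] by simp
next
  case (insert i I)
  then have "continuous_on (cball 0 R) (\<lambda>z. \<Sum>i\<in>I. u i z)" by (intro continuous_intros) auto
  then show ?case
    using insert bounded_functionalD(1)[OF L, of "u i" "\<lambda>z. \<Sum>i\<in>I. u i z" 1 1] by simp
qed

lemma bounded_functional_laplacian:
  fixes w :: "'a::euclidean_space \<Rightarrow> real"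
  assumes L: "bounded_functional R C L" and R: "R \<ge> 0" and S: "open S" and w: "Ck_on 2 S w"
    and x: "cball x R \<subseteq> S"
  shows "laplacian (\<lambda>x. L (\<lambda>z. w (x + z))) x = L (\<lambda>z. laplacian w (x + z))"
proof -
  let ?F = "\<lambda>x. L (\<lambda>z. w (x + z))" and ?S = "{x. cball x R \<subseteq> S}"
  have xS: "x \<in> ?S" using x by simp
  have S': "open ?S" by (rule open_inner_parallel[OF S R])
  have 2: "partial b (partial b ?F) x = L (\<lambda>z. partial b (partial b w) (x + z))" if b: "b \<in> Basis" for b
  proof -
    have w1: "Ck_on 1 S (partial b w)" using w b by (simp add: eval_nat_numeral)
    have "partial b ?F y = L (\<lambda>z. partial b w (y + z))" if "y \<in> ?S" for y
      using has_partialD(2)[OF bounded_functional_has_partial[OF L R S, of w b y]] w b that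
      by (simp add: eval_nat_numeral)
    then have "partial b (partial b ?F) x = partial b (\<lambda>y. L (\<lambda>z. partial b w (y + z))) x"
      by (intro partial_cong[OF S' xS]) auto
    also have "\<dots> = L (\<lambda>z. partial b (partial b w) (x + z))"
      using has_partialD(2)[OF bounded_functional_has_partial[OF L R S, of "partial b w" b x]] w1 b x by simp
    finally show ?thesis .
  qed
  have "continuous_on (cball 0 R) (\<lambda>z. partial b (partial b w) (x + z))" if "b \<in> Basis" for b
    using w that by (intro continuous_on_translate[OF _ x]) (simp add: eval_nat_numeral)
  then have "L (\<lambda>z. \<Sum>b\<in>Basis. partial b (partial b w) (x + z)) = (\<Sum>b\<in>Basis. L (\<lambda>z. partial b (partial b w) (x + z)))"
    by (intro bounded_functional_sum[OF L]) auto
  then show ?thesis unfolding laplacian_def using 2 by simp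
qed

section \<open>Polar coordinates\<close>

lemma borel_measurable_sgn_euclidean [measurable]:
  "(sgn :: 'a::euclidean_space \<Rightarrow> 'a) \<in> borel_measurable borel"
  unfolding sgn_div_norm by measurable

lemma space_sphere_measure [simp]: "space (sphere_measure :: 'a::euclidean_space measure) = UNIV"
  and sets_sphere_measure [simp, measurable_cong]: "sets (sphere_measure :: 'a::euclidean_space measure) = sets borel"
  by (simp_all add: sphere_measure_def)

lemma nn_integral_sphere_measure:
  fixes f :: "'a::euclidean_space \<Rightarrow> ennreal"
  assumes [measurable]: "f \<in> borel_measurable borel"
  shows "(\<integral>\<^sup>+\<xi>. f \<xi> \<partial>sphere_measure) =
    (\<integral>\<^sup>+y. ennreal (real DIM('a)) * indicator (ball 0 1) y * f (sgn y) \<partial>lborel)"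
  unfolding sphere_measure_def
proof -
  have [measurable]: "ball (0::'a) 1 \<in> sets borel" by simp
  show "integral\<^sup>N (distr (density lborel (\<lambda>x. ennreal (real DIM('a)) * indicator (ball 0 1) x)) borel sgn) f =
    (\<integral>\<^sup>+y. ennreal (real DIM('a)) * indicator (ball 0 1) y * f (sgn y) \<partial>lborel)"
    by (subst nn_integral_distr, simp, simp, subst nn_integral_density) measurable
qed

lemma AE_sphere_measure: "AE \<xi> in (sphere_measure :: 'a::euclidean_space measure). \<xi> \<in> sphere 0 1"
proof -
  have "AE y in (lborel :: 'a measure). y \<noteq> 0" by (rule AE_lborel_singleton)
  then have "AE y in density lborel (\<lambda>y::'a. ennreal (real DIM('a)) * indicator (ball 0 1) y). sgn y \<in> sphere 0 1"
  proof (subst AE_density)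
    have [measurable]: "ball (0::'a) 1 \<in> sets borel" by simp
    show "(\<lambda>y::'a. ennreal (real DIM('a)) * indicator (ball 0 1) y) \<in> borel_measurable lborel" by measurable
  qed (auto elim!: eventually_mono simp: norm_sgn)
  then show ?thesis unfolding sphere_measure_def
    by (subst AE_distr_iff) (auto simp: dist_norm)
qed

lemma emeasure_sphere_measure_UNIV:
  "emeasure (sphere_measure :: 'a::euclidean_space measure) UNIV = ennreal (real DIM('a) * measure lborel (ball (0::'a) 1))"
proof -
  have fin: "emeasure lborel (ball (0::'a) 1) < \<infinity>" by (rule emeasure_lborel_ball_finite)
  have "emeasure (sphere_measure :: 'a measure) UNIV = (\<integral>\<^sup>+\<xi>. 1 \<partial>(sphere_measure :: 'a measure))"
    by simp
  also have "\<dots> = (\<integral>\<^sup>+y. ennreal (real DIM('a)) * indicator (ball (0::'a) 1) y * 1 \<partial>lborel)"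
    by (rule nn_integral_sphere_measure) simp
  also have "\<dots> = ennreal (real DIM('a)) * emeasure lborel (ball (0::'a) 1)"
    by (simp add: nn_integral_cmult_indicator)
  also have "\<dots> = ennreal (real DIM('a) * measure lborel (ball (0::'a) 1))"
    using fin by (simp add: emeasure_eq_ennreal_measure ennreal_mult less_top)
  finally show ?thesis .
qed

interpretation sphere_measure: finite_measure "sphere_measure :: 'a::euclidean_space measure"
  by standard (simp add: emeasure_sphere_measure_UNIV)

definition sphere_area :: "'a::euclidean_space itself \<Rightarrow> real" where
  "sphere_area _ = measure (sphere_measure :: 'a measure) (sphere 0 1)"

lemma measure_sphere_measure_UNIV: "measure (sphere_measure :: 'a::euclidean_space measure) UNIV = sphere_area TYPE('a)"
  unfolding sphere_area_def
  by (rule sphere_measure.finite_measure_eq_AE)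
     (use AE_sphere_measure[where 'a='a] in \<open>auto elim!: eventually_mono\<close>)

lemma sphere_area_pos: "sphere_area TYPE('a::euclidean_space) > 0"
proof -
  have "measure lborel (ball (0::'a) 1) > 0"
    by (simp add: content_ball_pos)
  then have "measure (sphere_measure :: 'a measure) UNIV > 0"
    using emeasure_sphere_measure_UNIV[where 'a='a]
    by (simp add: measure_def)
  then show ?thesis by (simp add: measure_sphere_measure_UNIV)
qed

lemma nn_integral_lborel_scale:
  fixes f :: "'a::euclidean_space \<Rightarrow> ennreal"
  assumes [measurable]: "f \<in> borel_measurable borel" and c: "c > 0"
  shows "(\<integral>\<^sup>+y. f (c *\<^sub>R y) \<partial>lborel) = ennreal ((1 / c) ^ DIM('a)) * (\<integral>\<^sup>+z. f z \<partial>lborel)"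
proof -
  have "(\<integral>\<^sup>+z. f z \<partial>lborel) = (\<integral>\<^sup>+z. f z \<partial>density (distr lborel borel (\<lambda>x. 0 + c *\<^sub>R x)) (\<lambda>_. \<bar>c\<bar> ^ DIM('a)))"
    using lborel_affine[of c "0::'a"] c by simp
  also have "\<dots> = (\<integral>\<^sup>+y. ennreal (c ^ DIM('a)) * f (c *\<^sub>R y) \<partial>lborel)"
    using c by (subst nn_integral_density) (auto simp: nn_integral_distr)
  also have "\<dots> = ennreal (c ^ DIM('a)) * (\<integral>\<^sup>+y. f (c *\<^sub>R y) \<partial>lborel)"
    by (rule nn_integral_cmult) simp
  finally show ?thesis
    using c by (simp add: mult.assoc[symmetric] ennreal_mult[symmetric] power_mult_distrib[symmetric])
qed

text \<open>
  The factor \<open>1 / a\<^sup>n\<close> cancels the weight \<open>|z|\<^sup>n\<close> that the change of variables in polar coordinates leaves behind.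
\<close>

lemma nn_integral_tail_power:
  assumes "a > 0" "n > 0"
  shows "(\<integral>\<^sup>+t. ennreal (real n / t ^ (n + 1)) * indicator {a<..} t \<partial>lborel) = ennreal (1 / a ^ n)"
proof -
  have "(\<integral>\<^sup>+t. ennreal (real n / t ^ (n + 1)) * indicator {a<..} t \<partial>lborel)
      = (\<integral>\<^sup>+t. ennreal (real n / t ^ (n + 1)) * indicator {a..} t \<partial>lborel)"
    by (rule nn_integral_cong_AE, rule AE_mp[OF AE_lborel_singleton[of a]]) (auto split: split_indicator)
  also have "\<dots> = ennreal (0 - (- (1 / a ^ n)))"
  proof (rule nn_integral_FTC_atLeast)
    show "((\<lambda>t. - (1 / t ^ n)) has_real_derivative real n / x ^ (n + 1)) (at x)" if "a \<le> x" for x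
      using that assms by (auto intro!: derivative_eq_intros simp: field_simps power_Suc[symmetric] simp del: power_Suc)
         (cases n, auto simp: field_simps)
    show "((\<lambda>t::real. - (1 / t ^ n)) \<longlongrightarrow> 0) at_top"
      using tendsto_minus[OF tendsto_inverse_0_at_top[OF filterlim_pow_at_top[OF assms(2) filterlim_ident[of "at_top :: real filter"]]]]
      by (simp add: inverse_eq_divide)
  qed (use assms in auto)
  finally show ?thesis by simp
qed

text \<open>
  The area measure is the image of Lebesgue measure on the unit ball under \<open>y \<mapsto> y / |y|\<close>. Substituting
  \<open>s = t |y|\<close> in the inner integral removes this projection; after exchanging the integrals,
  the substitution \<open>z = t y\<close> and one more exchange leave an elementary integral over \<open>t > |z|\<close>.
\<close>

lemma nn_integral_polar:
  fixes f :: "'a::euclidean_space \<Rightarrow> ennreal"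
  assumes f [measurable]: "f \<in> borel_measurable borel"
  shows "(\<integral>\<^sup>+z. f z \<partial>lborel) =
    (\<integral>\<^sup>+s. \<integral>\<^sup>+\<xi>. ennreal (s ^ (DIM('a) - 1)) * indicator {0<..} s * f (s *\<^sub>R \<xi>) \<partial>sphere_measure \<partial>lborel)"
proof -
  define n where "n = DIM('a)"
  have n: "n > 0" unfolding n_def by simp
  have n1: "s ^ n = s * s ^ (n - 1)" for s :: real using n by (cases n) auto
  let ?B = "ball (0::'a) 1"
  have [measurable]: "?B \<in> sets borel" by simp
  have "(\<integral>\<^sup>+s. \<integral>\<^sup>+\<xi>. ennreal (s ^ (n - 1)) * indicator {0<..} s * f (s *\<^sub>R \<xi>) \<partial>sphere_measure \<partial>lborel)
      = (\<integral>\<^sup>+s. \<integral>\<^sup>+y. ennreal (real n) * indicator ?B y * (ennreal (s ^ (n - 1)) * indicator {0<..} s * f (s *\<^sub>R sgn y)) \<partial>lborel \<partial>lborel)"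
    unfolding n_def by (intro nn_integral_cong nn_integral_sphere_measure) simp
  also have "\<dots> = (\<integral>\<^sup>+y. \<integral>\<^sup>+s. ennreal (real n) * indicator ?B y * (ennreal (s ^ (n - 1)) * indicator {0<..} s * f (s *\<^sub>R sgn y)) \<partial>lborel \<partial>lborel)"
    by (rule lborel_pair.Fubini') measurable
  also have "\<dots> = (\<integral>\<^sup>+y. \<integral>\<^sup>+t. ennreal (real n) * indicator ?B y * (ennreal (norm y ^ n * t ^ (n - 1)) * indicator {0<..} t * f (t *\<^sub>R y)) \<partial>lborel \<partial>lborel)"
  proof (rule nn_integral_cong_AE, rule AE_mp[OF AE_lborel_singleton[of "0::'a"]], rule AE_I2, rule impI)
    fix y :: 'a assume y: "y \<noteq> 0"
    have "(\<integral>\<^sup>+s. ennreal (real n) * indicator ?B y * (ennreal (s ^ (n - 1)) * indicator {0<..} s * f (s *\<^sub>R sgn y)) \<partial>lborel)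
       = ennreal (norm y) * (\<integral>\<^sup>+t. ennreal (real n) * indicator ?B y * (ennreal ((norm y * t) ^ (n - 1)) * indicator {0<..} (norm y * t) * f ((norm y * t) *\<^sub>R sgn y)) \<partial>lborel)"
      using nn_integral_real_affine[of "\<lambda>s. ennreal (real n) * indicator ?B y * (ennreal (s ^ (n - 1)) * indicator {0<..} s * f (s *\<^sub>R sgn y))" "norm y" 0] y
      by simp
    also have "\<dots> = (\<integral>\<^sup>+t. ennreal (norm y) * (ennreal (real n) * indicator ?B y * (ennreal ((norm y * t) ^ (n - 1)) * indicator {0<..} (norm y * t) * f ((norm y * t) *\<^sub>R sgn y))) \<partial>lborel)"
      by (rule nn_integral_cmult[symmetric]) simp
    also have "\<dots> = (\<integral>\<^sup>+t. ennreal (real n) * indicator ?B y * (ennreal (norm y ^ n * t ^ (n - 1)) * indicator {0<..} t * f (t *\<^sub>R y)) \<partial>lborel)"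
    proof (rule nn_integral_cong)
      fix t :: real
      have 1: "(norm y * t) *\<^sub>R sgn y = t *\<^sub>R y" using y by (simp add: sgn_div_norm)
      have 2: "indicator {0<..} (norm y * t) = (indicator {0<..} t :: ennreal)"
        using y by (auto simp: zero_less_mult_iff split: split_indicator)
      show "ennreal (norm y) * (ennreal (real n) * indicator ?B y * (ennreal ((norm y * t) ^ (n - 1)) * indicator {0<..} (norm y * t) * f ((norm y * t) *\<^sub>R sgn y)))
        = ennreal (real n) * indicator ?B y * (ennreal (norm y ^ n * t ^ (n - 1)) * indicator {0<..} t * f (t *\<^sub>R y))"
      proof (cases "t > 0")
        case True
        have "ennreal (norm y ^ n * t ^ (n - 1)) = ennreal (norm y) * ennreal ((norm y * t) ^ (n - 1))"
          using True by (simp add: ennreal_mult[symmetric] n1 power_mult_distrib mult.assoc)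
        then show ?thesis unfolding 1 2 by (simp add: mult_ac)
      qed (simp add: 2)
    qed
    finally show "(\<integral>\<^sup>+s. ennreal (real n) * indicator ?B y * (ennreal (s ^ (n - 1)) * indicator {0<..} s * f (s *\<^sub>R sgn y)) \<partial>lborel)
       = (\<integral>\<^sup>+t. ennreal (real n) * indicator ?B y * (ennreal (norm y ^ n * t ^ (n - 1)) * indicator {0<..} t * f (t *\<^sub>R y)) \<partial>lborel)" .
  qed
  also have "\<dots> = (\<integral>\<^sup>+t. \<integral>\<^sup>+y. ennreal (real n) * indicator ?B y * (ennreal (norm y ^ n * t ^ (n - 1)) * indicator {0<..} t * f (t *\<^sub>R y)) \<partial>lborel \<partial>lborel)"
    by (rule lborel_pair.Fubini') measurable
  also have "\<dots> = (\<integral>\<^sup>+t. \<integral>\<^sup>+z. f z * (ennreal (norm z ^ n) * (ennreal (real n / t ^ (n + 1)) * (if norm z < t then 1 else 0))) \<partial>lborel \<partial>lborel)"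
  proof (rule nn_integral_cong)
    fix t :: real
    show "(\<integral>\<^sup>+y. ennreal (real n) * indicator ?B y * (ennreal (norm y ^ n * t ^ (n - 1)) * indicator {0<..} t * f (t *\<^sub>R y)) \<partial>lborel)
      = (\<integral>\<^sup>+z. f z * (ennreal (norm z ^ n) * (ennreal (real n / t ^ (n + 1)) * (if norm z < t then 1 else 0))) \<partial>lborel)"
    proof (cases "t > 0")
      case True
      let ?g = "\<lambda>z. f z * (ennreal (norm z ^ n) * (ennreal (real n / t) * (if norm z < t then 1 else 0)))"
      have eq: "indicator ?B y = (if norm (t *\<^sub>R y) < t then 1 else 0 :: ennreal)" for y
        using True by (auto split: split_indicator simp: field_simps)
      have "(\<integral>\<^sup>+y. ennreal (real n) * indicator ?B y * (ennreal (norm y ^ n * t ^ (n - 1)) * indicator {0<..} t * f (t *\<^sub>R y)) \<partial>lborel)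
         = (\<integral>\<^sup>+y. ?g (t *\<^sub>R y) \<partial>lborel)"
      proof (rule nn_integral_cong)
        fix y :: 'a
        have *: "ennreal (real n) * ennreal (norm y ^ n * t ^ (n - 1)) = ennreal (norm (t *\<^sub>R y) ^ n) * ennreal (real n / t)"
          using True by (simp add: ennreal_mult[symmetric] n1[of t] power_mult_distrib field_simps)
        have "ennreal (real n) * indicator ?B y * (ennreal (norm y ^ n * t ^ (n - 1)) * indicator {0<..} t * f (t *\<^sub>R y))
          = (ennreal (real n) * ennreal (norm y ^ n * t ^ (n - 1))) * (f (t *\<^sub>R y) * indicator ?B y)"
          using True by (simp add: mult_ac)
        also have "\<dots> = ?g (t *\<^sub>R y)"
          unfolding * eq by (simp only: mult_ac)
        finally show "ennreal (real n) * indicator ?B y * (ennreal (norm y ^ n * t ^ (n - 1)) * indicator {0<..} t * f (t *\<^sub>R y)) = ?g (t *\<^sub>R y)" .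
      qed
      also have "\<dots> = ennreal ((1 / t) ^ n) * (\<integral>\<^sup>+z. ?g z \<partial>lborel)"
        unfolding n_def by (rule nn_integral_lborel_scale[OF _ True]) measurable
      also have "\<dots> = (\<integral>\<^sup>+z. ennreal ((1 / t) ^ n) * ?g z \<partial>lborel)"
        by (rule nn_integral_cmult[symmetric]) measurable
      also have "\<dots> = (\<integral>\<^sup>+z. f z * (ennreal (norm z ^ n) * (ennreal (real n / t ^ (n + 1)) * (if norm z < t then 1 else 0))) \<partial>lborel)"
      proof (rule nn_integral_cong)
        fix z :: 'a
        have "ennreal (real n / t ^ (n + 1)) = ennreal ((1 / t) ^ n) * ennreal (real n / t)"
          using True by (simp add: ennreal_mult[symmetric] power_divide)
        then show "ennreal ((1 / t) ^ n) * ?g z = f z * (ennreal (norm z ^ n) * (ennreal (real n / t ^ (n + 1)) * (if norm z < t then 1 else 0)))"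
          by (simp add: mult_ac)
      qed
      finally show ?thesis .
    next
      case False
      then have "\<not> norm z < t" for z :: 'a
        using norm_ge_zero[of z] by linarith
      then show ?thesis using False by simp
    qed
  qed
  also have "\<dots> = (\<integral>\<^sup>+z. \<integral>\<^sup>+t. f z * (ennreal (norm z ^ n) * (ennreal (real n / t ^ (n + 1)) * (if norm z < t then 1 else 0))) \<partial>lborel \<partial>lborel)"
    by (rule lborel_pair.Fubini') measurable
  also have "\<dots> = (\<integral>\<^sup>+z. f z \<partial>lborel)"
  proof (rule nn_integral_cong_AE, rule AE_mp[OF AE_lborel_singleton[of "0::'a"]], rule AE_I2, rule impI)
    fix z :: 'a assume z: "z \<noteq> 0"
    have "(\<integral>\<^sup>+t. f z * (ennreal (norm z ^ n) * (ennreal (real n / t ^ (n + 1)) * (if norm z < t then 1 else 0))) \<partial>lborel)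
       = f z * (ennreal (norm z ^ n) * (\<integral>\<^sup>+t. ennreal (real n / t ^ (n + 1)) * (if norm z < t then 1 else 0) \<partial>lborel))"
      by (simp add: nn_integral_cmult)
    also have "(\<integral>\<^sup>+t. ennreal (real n / t ^ (n + 1)) * (if norm z < t then 1 else 0) \<partial>lborel)
       = (\<integral>\<^sup>+t. ennreal (real n / t ^ (n + 1)) * indicator {norm z<..} t \<partial>lborel)"
      by (rule nn_integral_cong) (auto split: split_indicator)
    also have "\<dots> = ennreal (1 / norm z ^ n)"
      using nn_integral_tail_power[of "norm z" n] z n by simp
    also have "f z * (ennreal (norm z ^ n) * ennreal (1 / norm z ^ n)) = f z"
      using z by (simp add: ennreal_mult[symmetric])
    finally show "(\<integral>\<^sup>+t. f z * (ennreal (norm z ^ n) * (ennreal (real n / t ^ (n + 1)) * (if norm z < t then 1 else 0))) \<partial>lborel) = f z" .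
  qed
  finally show ?thesis unfolding n_def by simp
qed

section \<open>Spherical means\<close>

lemma spherical_mean_translate: "spherical_mean g x t = spherical_mean (\<lambda>z. g (x + z)) 0 t"
  unfolding spherical_mean_def by simp

context
  fixes u :: "'a::euclidean_space \<Rightarrow> real" and R t :: real
  assumes u: "continuous_on (cball 0 R) u" and t: "0 \<le> t" "t \<le> R"
begin

lemma spherical_integrand_continuous: "continuous_on (sphere 0 1) (\<lambda>\<xi>. u (t *\<^sub>R \<xi>))"
  by (rule continuous_on_compose2[OF u]) (use t in \<open>auto intro!: continuous_intros\<close>)

lemma spherical_integrand_integrable:
  "integrable sphere_measure (\<lambda>\<xi>. indicator (sphere 0 1) \<xi> *\<^sub>R u (t *\<^sub>R \<xi>))"
proof -
  have "bounded ((\<lambda>\<xi>. u (t *\<^sub>R \<xi>)) ` sphere 0 1)"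
    by (intro compact_imp_bounded compact_continuous_image spherical_integrand_continuous compact_sphere)
  then obtain B where B: "\<And>\<xi>. \<xi> \<in> sphere 0 1 \<Longrightarrow> norm (u (t *\<^sub>R \<xi>)) \<le> B"
    unfolding bounded_iff by blast
  have "(\<lambda>\<xi>. indicator (sphere 0 1) \<xi> *\<^sub>R u (t *\<^sub>R \<xi>)) \<in> borel_measurable borel"
    by (rule borel_measurable_continuous_on_indicator) (auto intro: spherical_integrand_continuous borel_closed)
  then show ?thesis
    by (intro sphere_measure.integrable_const_bound[where B = "max B 0"])
       (use B in \<open>auto simp: indicator_def intro: le_max_iff_disj[THEN iffD2]\<close>)
qed

lemma spherical_mean_bound:
  assumes B: "\<And>z. norm z = t \<Longrightarrow> \<bar>u z\<bar> \<le> B"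
  shows "\<bar>spherical_mean u 0 t\<bar> \<le> B"
proof -
  define A where "A = sphere_area TYPE('a)"
  have A: "A > 0" unfolding A_def by (rule sphere_area_pos)
  have A': "measure sphere_measure (sphere (0::'a) 1) = A" unfolding A_def sphere_area_def ..
  let ?f = "\<lambda>\<xi>. indicator (sphere 0 1) \<xi> *\<^sub>R u (t *\<^sub>R \<xi>)"
  obtain e :: 'a where e: "norm e = 1" using vector_choose_size[of 1] by auto
  have B0: "B \<ge> 0" using B[of "t *\<^sub>R e"] e t by auto
  have "norm (integral\<^sup>L sphere_measure ?f) \<le> integral\<^sup>L sphere_measure (\<lambda>\<xi>. norm (?f \<xi>))"
    by (rule integral_norm_bound)
  also have "\<dots> \<le> integral\<^sup>L (sphere_measure :: 'a measure) (\<lambda>\<xi>. B)"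
    by (rule integral_mono) (use spherical_integrand_integrable B t B0 in \<open>auto simp: indicator_def\<close>)
  also have "\<dots> = A * B" by (simp add: measure_sphere_measure_UNIV A_def)
  finally show ?thesis
    unfolding spherical_mean_def A' set_lebesgue_integral_def
    using A by (simp add: field_simps abs_mult)
qed

end

lemma spherical_mean_lin:
  assumes u: "continuous_on (cball 0 R) u" and v: "continuous_on (cball 0 R) v" and t: "0 \<le> t" "t \<le> R"
  shows "spherical_mean (\<lambda>z. a * u z + c * v z) 0 t = a * spherical_mean u 0 t + c * spherical_mean v 0 t"
proof -
  note iu = spherical_integrand_integrable[OF u t] and iv = spherical_integrand_integrable[OF v t]
  have "(LINT \<xi>|sphere_measure. indicator (sphere 0 1) \<xi> *\<^sub>R (a * u (t *\<^sub>R \<xi>) + c * v (t *\<^sub>R \<xi>)))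
     = (LINT \<xi>|sphere_measure. a * (indicator (sphere 0 1) \<xi> *\<^sub>R u (t *\<^sub>R \<xi>)) + c * (indicator (sphere 0 1) \<xi> *\<^sub>R v (t *\<^sub>R \<xi>)))"
    by (intro Bochner_Integration.integral_cong) (auto simp: algebra_simps)
  also have "\<dots> = a * (LINT \<xi>|sphere_measure. indicator (sphere 0 1) \<xi> *\<^sub>R u (t *\<^sub>R \<xi>))
      + c * (LINT \<xi>|sphere_measure. indicator (sphere 0 1) \<xi> *\<^sub>R v (t *\<^sub>R \<xi>))"
    using iu iv by (simp add: Bochner_Integration.integral_add)
  finally show ?thesis
    unfolding spherical_mean_def set_lebesgue_integral_def by (simp add: algebra_simps)
qed

lemma spherical_mean_diff_le:
  assumes u: "continuous_on (cball 0 R) u" and v: "continuous_on (cball 0 R) v" and t: "0 \<le> t" "t \<le> R"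
    and B: "\<And>z. norm z = t \<Longrightarrow> \<bar>u z - v z\<bar> \<le> B"
  shows "\<bar>spherical_mean u 0 t - spherical_mean v 0 t\<bar> \<le> B"
proof -
  have "spherical_mean (\<lambda>z. 1 * u z + (-1) * v z) 0 t = spherical_mean u 0 t - spherical_mean v 0 t"
    using spherical_mean_lin[OF u v t, of 1 "-1"] by simp
  moreover have "\<bar>spherical_mean (\<lambda>z. 1 * u z + (-1) * v z) 0 t\<bar> \<le> B"
    by (rule spherical_mean_bound[OF _ t]) (use u v B in \<open>auto intro!: continuous_intros\<close>)
  ultimately show ?thesis by simp
qed

lemma spherical_mean_const: "spherical_mean (\<lambda>_. c) (x :: 'a::euclidean_space) t = c"
proof -
  have "measure sphere_measure (sphere (0::'a) 1) \<noteq> 0"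
    using sphere_area_pos[where 'a='a] unfolding sphere_area_def by simp
  then show ?thesis unfolding spherical_mean_def set_lebesgue_integral_def by simp
qed

lemma spherical_mean_0: "spherical_mean u (x :: 'a::euclidean_space) 0 = u x"
proof -
  have "spherical_mean u x 0 = spherical_mean (\<lambda>_. u x) x 0"
    unfolding spherical_mean_def by simp
  then show ?thesis using spherical_mean_const[of "u x" x 0] by simp
qed

lemma spherical_mean_rescale:
  "spherical_mean u 0 t = spherical_mean (\<lambda>z. u (t *\<^sub>R z)) 0 1"
  unfolding spherical_mean_def by simp

text \<open>
  Rescaling brings all radii to the unit sphere, where uniform continuity of \<open>u\<close> compares the integrands.
\<close>

lemma spherical_mean_continuous:
  fixes u :: "'a::euclidean_space \<Rightarrow> real"
  assumes u: "continuous_on (cball 0 R) u"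
  shows "continuous_on {0..R} (spherical_mean u 0)"
proof -
  have "uniformly_continuous_on (cball 0 R) u"
    by (intro compact_uniformly_continuous u compact_cball)
  then have uc: "\<And>\<epsilon>. \<epsilon> > 0 \<Longrightarrow> \<exists>d>0. \<forall>x\<in>cball 0 R. \<forall>x'\<in>cball 0 R. dist x' x < d \<longrightarrow> dist (u x') (u x) < \<epsilon>"
    unfolding uniformly_continuous_on_def by blast
  show ?thesis
    unfolding continuous_on_iff
  proof (intro ballI allI impI)
    fix t \<epsilon> :: real assume t: "t \<in> {0..R}" and e: "\<epsilon> > 0"
    obtain d where d: "d > 0" "\<And>x x'. x \<in> cball 0 R \<Longrightarrow> x' \<in> cball 0 R \<Longrightarrow> dist x' x < d \<Longrightarrow> dist (u x') (u x) < \<epsilon> / 2"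
      using uc[of "\<epsilon> / 2"] e by (auto simp: Ball_def)
    show "\<exists>d>0. \<forall>t'\<in>{0..R}. dist t' t < d \<longrightarrow> dist (spherical_mean u 0 t') (spherical_mean u 0 t) < \<epsilon>"
    proof (intro exI[of _ d] conjI d(1) ballI impI)
      fix t' assume t': "t' \<in> {0..R}" "dist t' t < d"
      have c: "continuous_on (cball 0 1) (\<lambda>z. u (s *\<^sub>R z))" if s: "s \<in> {0..R}" for s
      proof (rule continuous_on_compose2[OF u])
        show "(\<lambda>z. s *\<^sub>R z) ` cball 0 1 \<subseteq> cball (0::'a) R"
        proof (intro image_subsetI)
          fix z :: 'a assume "z \<in> cball 0 1"
          then have "s * norm z \<le> R * 1" using s by (intro mult_mono) auto
          then show "s *\<^sub>R z \<in> cball 0 R" using s by simp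
        qed
      qed (intro continuous_intros)
      have "\<bar>spherical_mean (\<lambda>z. u (t' *\<^sub>R z)) 0 1 - spherical_mean (\<lambda>z. u (t *\<^sub>R z)) 0 1\<bar> \<le> \<epsilon> / 2"
      proof (rule spherical_mean_diff_le[OF c c])
        fix z :: 'a assume z: "norm z = 1"
        have "dist (t' *\<^sub>R z) (t *\<^sub>R z) < d"
          using t'(2) z by (simp add: dist_norm scaleR_diff_left[symmetric])
        then show "\<bar>u (t' *\<^sub>R z) - u (t *\<^sub>R z)\<bar> \<le> \<epsilon> / 2"
          using d(2)[of "t *\<^sub>R z" "t' *\<^sub>R z"] z t t' by (auto simp: dist_norm)
      qed (use t t' in auto)
      then show "dist (spherical_mean u 0 t') (spherical_mean u 0 t) < \<epsilon>"
        unfolding spherical_mean_rescale[of u t] spherical_mean_rescale[of u t'] using e by (simp add: dist_norm)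
    qed
  qed
qed

text \<open>
  The polar formula as an identity of measures gives it for signed integrands as well.
\<close>

lemma lborel_eq_polar:
  "(lborel :: 'a::euclidean_space measure) =
    distr (density (lborel \<Otimes>\<^sub>M sphere_measure) (\<lambda>(s, \<xi>). ennreal (s ^ (DIM('a) - 1) * indicator {0<..} s))) borel (\<lambda>(s, \<xi>). s *\<^sub>R \<xi>)"
proof (rule measure_eqI)
  fix A :: "'a set" assume "A \<in> sets lborel"
  then have A [measurable]: "A \<in> sets borel" by simp
  let ?w = "\<lambda>(s, \<xi>::'a). ennreal (s ^ (DIM('a) - 1) * indicator {0<..} s)"
  interpret P: pair_sigma_finite "lborel :: real measure" "sphere_measure :: 'a measure"
    by (intro pair_sigma_finite.intro lborel.sigma_finite_measure_axioms sphere_measure.sigma_finite_measure_axioms)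
  have "emeasure (distr (density (lborel \<Otimes>\<^sub>M sphere_measure) ?w) borel (\<lambda>(s, \<xi>). s *\<^sub>R \<xi>)) A
    = (\<integral>\<^sup>+z. indicator A z \<partial>distr (density (lborel \<Otimes>\<^sub>M sphere_measure) ?w) borel (\<lambda>(s, \<xi>). s *\<^sub>R \<xi>))"
    by simp
  also have "\<dots> = (\<integral>\<^sup>+p. indicator A (case p of (s, \<xi>) \<Rightarrow> s *\<^sub>R \<xi>) \<partial>density (lborel \<Otimes>\<^sub>M sphere_measure) ?w)"
    by (rule nn_integral_distr) measurable
  also have "\<dots> = (\<integral>\<^sup>+p. ?w p * indicator A (case p of (s, \<xi>) \<Rightarrow> s *\<^sub>R \<xi>) \<partial>(lborel \<Otimes>\<^sub>M sphere_measure))"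
    by (rule nn_integral_density) measurable
  also have "\<dots> = (\<integral>\<^sup>+s. \<integral>\<^sup>+\<xi>. ?w (s, \<xi>) * indicator A (case (s, \<xi>) of (s, \<xi>) \<Rightarrow> s *\<^sub>R \<xi>) \<partial>sphere_measure \<partial>lborel)"
    by (rule sphere_measure.nn_integral_fst[symmetric]) measurable
  also have "\<dots> = (\<integral>\<^sup>+s. \<integral>\<^sup>+\<xi>. ennreal (s ^ (DIM('a) - 1)) * indicator {0<..} s * indicator A (s *\<^sub>R \<xi>) \<partial>(sphere_measure :: 'a measure) \<partial>lborel)"
    by (intro nn_integral_cong) (auto simp: indicator_def)
  also have "\<dots> = (\<integral>\<^sup>+z. indicator A z \<partial>lborel)"
    by (rule nn_integral_polar[symmetric]) measurable
  finally show "emeasure lborel A = emeasure (distr (density (lborel \<Otimes>\<^sub>M sphere_measure) ?w) borel (\<lambda>(s, \<xi>). s *\<^sub>R \<xi>)) A"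
    by simp
qed simp

text \<open>
  A radial weight only sees the spherical means of a function. Integrals over balls with radial weights
  are reduced in this way to integrals over the radius.
\<close>

lemma integral_cball_polar:
  fixes u :: "'a::euclidean_space \<Rightarrow> real"
  assumes u: "continuous_on (cball 0 R) u" and k: "continuous_on {0..R} k" and R: "R \<ge> 0"
  shows "(LINT z:cball 0 R|lborel. k (norm z) * u z) =
    sphere_area TYPE('a) * integral {0..R} (\<lambda>s. k s * s ^ (DIM('a) - 1) * spherical_mean u 0 s)"
proof -
  define n where "n = DIM('a)"
  interpret P: pair_sigma_finite "lborel :: real measure" "sphere_measure :: 'a measure"
    by (intro pair_sigma_finite.intro lborel.sigma_finite_measure_axioms sphere_measure.sigma_finite_measure_axioms)
  let ?w = "\<lambda>(s, \<xi>::'a). s ^ (n - 1) * indicator {0<..} s :: real"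
  let ?T = "\<lambda>(s::real, \<xi>::'a). s *\<^sub>R \<xi>"
  let ?P = "(lborel :: real measure) \<Otimes>\<^sub>M (sphere_measure :: 'a measure)"
  define f where "f z = indicator (cball 0 R) z *\<^sub>R (k (norm z) * u z)" for z
  have polar: "(lborel :: 'a measure) = distr (density ?P (\<lambda>p. ennreal (?w p))) borel ?T"
    using lborel_eq_polar[where 'a='a] unfolding n_def by (simp add: case_prod_unfold)
  have "continuous_on (cball 0 R) (\<lambda>z. k (norm z) * u z)"
    by (intro continuous_intros u continuous_on_compose2[OF k]) auto
  then have intf: "integrable lborel f" unfolding f_def by (intro borel_integrable_compact compact_cball)
  then have fm [measurable]: "f \<in> borel_measurable borel" using borel_measurable_integrable by fastforce
  have w0: "AE p in ?P. 0 \<le> ?w p" by (auto simp: indicator_def)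
  have wm [measurable]: "?w \<in> borel_measurable ?P" by measurable
  have i1: "integrable (density ?P (\<lambda>p. ennreal (?w p))) (\<lambda>p. f (?T p))"
    using intf by (subst (asm) polar, subst (asm) integrable_distr_eq) auto
  then have i2: "integrable ?P (\<lambda>p. ?w p *\<^sub>R f (?T p))"
    by (subst (asm) integrable_density) (use w0 in auto)
  define h where "h s = k s * s ^ (n - 1) * spherical_mean u 0 s" for s
  have mf: "(\<lambda>\<xi>. c * f (s *\<^sub>R \<xi>)) \<in> borel_measurable borel" for c s
    by measurable
  have inner: "(LINT \<xi>|sphere_measure. (s ^ (n - 1) * indicator {0<..} s) *\<^sub>R f (s *\<^sub>R \<xi>)) = indicator {0<..R} s *\<^sub>R (sphere_area TYPE('a) * h s)" for s
  proof (cases "0 < s \<and> s \<le> R")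
    case True
    have "(LINT \<xi>|sphere_measure. (s ^ (n - 1) * indicator {0<..} s) *\<^sub>R f (s *\<^sub>R \<xi>))
      = (LINT \<xi>|sphere_measure. (k s * s ^ (n - 1)) * (indicator (sphere 0 1) \<xi> *\<^sub>R u (s *\<^sub>R \<xi>)))"
    proof (rule Bochner_Integration.integral_cong_AE)
      show "AE \<xi> in sphere_measure. (s ^ (n - 1) * indicator {0<..} s) *\<^sub>R f (s *\<^sub>R \<xi>) = (k s * s ^ (n - 1)) * (indicator (sphere 0 1) \<xi> *\<^sub>R u (s *\<^sub>R \<xi>))"
        using AE_sphere_measure by eventually_elim (use True in \<open>auto simp: f_def\<close>)
      show "(\<lambda>\<xi>. (k s * s ^ (n - 1)) * (indicator (sphere 0 1) \<xi> *\<^sub>R u (s *\<^sub>R \<xi>))) \<in> borel_measurable sphere_measure"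
        using True
        by (intro borel_measurable_integrable integrable_mult_right spherical_integrand_integrable[OF u]) auto
    qed (simp_all add: mf)
    also have "\<dots> = sphere_area TYPE('a) * h s"
      using sphere_area_pos[where 'a='a]
      unfolding h_def spherical_mean_def set_lebesgue_integral_def sphere_area_def by simp
    finally show ?thesis using True by simp
  next
    case False
    have "(LINT \<xi>|sphere_measure. (s ^ (n - 1) * indicator {0<..} s) *\<^sub>R f (s *\<^sub>R \<xi>)) = (LINT \<xi>|(sphere_measure :: 'a measure). 0)"
    proof (rule Bochner_Integration.integral_cong_AE)
      show "AE \<xi> in sphere_measure. (s ^ (n - 1) * indicator {0<..} s) *\<^sub>R f (s *\<^sub>R \<xi>) = 0"
        using AE_sphere_measure by eventually_elim (use False in \<open>auto simp: f_def indicator_def\<close>)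
    qed (simp_all add: mf)
    then show ?thesis using False by auto
  qed
  have hc: "continuous_on {0..R} (\<lambda>s. sphere_area TYPE('a) * h s)"
    unfolding h_def by (intro continuous_intros k spherical_mean_continuous u)
  have "(LINT z:cball 0 R|lborel. k (norm z) * u z) = integral\<^sup>L lborel f"
    unfolding set_lebesgue_integral_def f_def ..
  also have "\<dots> = (LINT p|density ?P (\<lambda>p. ennreal (?w p)). f (?T p))"
    by (subst polar, subst integral_distr) auto
  also have "\<dots> = (LINT p|?P. ?w p *\<^sub>R f (?T p))"
    by (subst integral_density) (use w0 in auto)
  also have "\<dots> = (LINT s|lborel. (LINT \<xi>|sphere_measure. (s ^ (n - 1) * indicator {0<..} s) *\<^sub>R f (s *\<^sub>R \<xi>)))"
    using P.integral_fst'[OF i2] by simp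
  also have "\<dots> = (LINT s|lborel. indicator {0<..R} s *\<^sub>R (sphere_area TYPE('a) * h s))"
    unfolding inner ..
  also have "\<dots> = (LINT s|lborel. indicator {0..R} s *\<^sub>R (sphere_area TYPE('a) * h s))"
  proof (rule Bochner_Integration.integral_cong_AE)
    have *: "(\<lambda>s. indicator {0..R} s *\<^sub>R (sphere_area TYPE('a) * h s)) \<in> borel_measurable borel"
      by (rule borel_measurable_continuous_on_indicator[OF _ hc]) auto
    then show "(\<lambda>s. indicator {0..R} s *\<^sub>R (sphere_area TYPE('a) * h s)) \<in> borel_measurable lborel" by simp
    show "(\<lambda>s. indicator {0<..R} s *\<^sub>R (sphere_area TYPE('a) * h s)) \<in> borel_measurable lborel"
    proof -
      have "{0<..R} \<subseteq> {0..R}" by auto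
      from borel_measurable_continuous_on_indicator[OF _ continuous_on_subset[OF hc this]] show ?thesis by simp
    qed
    show "AE s in lborel. indicator {0<..R} s *\<^sub>R (sphere_area TYPE('a) * h s) = indicator {0..R} s *\<^sub>R (sphere_area TYPE('a) * h s)"
      using AE_lborel_singleton[of "0::real"] by eventually_elim (auto simp: indicator_def)
  qed
  also have "\<dots> = integral {0..R} (\<lambda>s. sphere_area TYPE('a) * h s)"
    using set_borel_integral_eq_integral(2)[of "{0..R}" "\<lambda>s. sphere_area TYPE('a) * h s"]
      borel_integrable_compact[OF compact_Icc hc]
    unfolding set_lebesgue_integral_def set_integrable_def by simp
  finally show ?thesis unfolding h_def n_def by simp
qed

section \<open>Polynomial bumps and integration by parts\<close>

text \<open>
  A power of the positive part of \<open>\<delta>\<^sup>2 - |z|\<^sup>2\<close> is supported in a ball and has as many continuous derivatives as desired.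
  Its derivatives are of the same form, and it is a polynomial on its support; this makes it more convenient
  than a bump of class \<open>C\<^sup>\<infinity>\<close>.
\<close>

definition bump :: "real \<Rightarrow> nat \<Rightarrow> 'a::euclidean_space \<Rightarrow> real" where
  "bump \<delta> N z = max 0 (\<delta>\<^sup>2 - z \<bullet> z) ^ N"

lemma has_real_derivative_pos_part_power:
  "((\<lambda>t::real. max 0 t ^ (k + 2)) has_real_derivative real (k + 2) * max 0 t ^ (k + 1)) (at t)"
proof -
  consider "t > 0" | "t < 0" | "t = 0" by linarith
  then show ?thesis
  proof cases
    case 1
    have ev: "eventually (\<lambda>s. max 0 s ^ (k + 2) = s ^ (k + 2)) (nhds t)"
      using eventually_nhds_in_open[of "{0<..}" t] 1 by (auto elim!: eventually_mono)
    show ?thesis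
      by (subst DERIV_cong_ev[OF refl ev refl]) (use 1 DERIV_pow[of "k + 2" t UNIV] in simp)
  next
    case 2
    have ev: "eventually (\<lambda>s. max 0 s ^ (k + 2) = 0) (nhds t)"
      using eventually_nhds_in_open[of "{..<0}" t] 2 by (auto elim!: eventually_mono)
    show ?thesis
      by (subst DERIV_cong_ev[OF refl ev refl]) (use 2 in auto)
  next
    case 3
    have "(\<lambda>h::real. max 0 h ^ (k + 2) / h) \<midarrow>0\<rightarrow> 0"
    proof (rule Lim_null_comparison)
      show "eventually (\<lambda>h::real. norm (max 0 h ^ (k + 2) / h) \<le> \<bar>h\<bar> ^ (k + 1)) (at 0)"
        by (intro always_eventually allI) (auto simp: max_def power_abs abs_mult field_simps mult_nonpos_nonneg)
      show "((\<lambda>h::real. \<bar>h\<bar> ^ (k + 1)) \<longlongrightarrow> 0) (at 0)"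
        by (auto intro!: tendsto_eq_intros)
    qed
    then show ?thesis using 3 by (simp add: DERIV_def)
  qed
qed

lemma has_partial_bump:
  "has_partial b (bump \<delta> (N + 2)) z (- (2 * real (N + 2)) * (z \<bullet> b) * bump \<delta> (N + 1) z)"
proof -
  let ?g = "\<lambda>s. \<delta>\<^sup>2 - (z + s *\<^sub>R b) \<bullet> (z + s *\<^sub>R b)"
  have g: "(?g has_real_derivative - (2 * (z \<bullet> b))) (at 0)"
  proof -
    have "?g = (\<lambda>s. \<delta>\<^sup>2 - (z \<bullet> z + s * (2 * (z \<bullet> b)) + s * s * (b \<bullet> b)))"
      by (rule ext) (simp add: inner_add_left inner_add_right inner_commute algebra_simps)
    then show ?thesis by (simp only:) (auto intro!: derivative_eq_intros)
  qed
  have g0: "?g 0 = \<delta>\<^sup>2 - z \<bullet> z" by simp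
  from DERIV_chain2[OF has_real_derivative_pos_part_power g, of N]
  show ?thesis unfolding has_partial_def bump_def g0 by (simp add: algebra_simps)
qed

lemma has_partial_bump_2: "has_partial b (bump \<delta> 2) z (- 4 * (z \<bullet> b) * bump \<delta> 1 z)"
  using has_partial_bump[of b \<delta> 0 z] by (simp add: numeral_2_eq_2)

lemma has_partial_bump_3: "has_partial b (bump \<delta> 3) z (- 6 * (z \<bullet> b) * bump \<delta> 2 z)"
  using has_partial_bump[of b \<delta> 1 z] by (simp add: numeral_2_eq_2 numeral_3_eq_3)

lemma continuous_on_bump: "continuous_on S (bump \<delta> N)"
  unfolding bump_def by (intro continuous_intros)

lemma bump_eq_0: "\<delta> \<ge> 0 \<Longrightarrow> norm z \<ge> \<delta> \<Longrightarrow> N > 0 \<Longrightarrow> bump \<delta> N z = 0"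
  by (simp add: bump_def dot_square_norm max_def power_mono)

lemma bump_eq: "norm z \<le> \<delta> \<Longrightarrow> bump \<delta> N z = (\<delta>\<^sup>2 - (norm z)\<^sup>2) ^ N"
  using power_mono[of "norm z" \<delta> 2] by (simp add: bump_def dot_square_norm max_def)

lemma bump_nonneg: "bump \<delta> N z \<ge> 0" by (simp add: bump_def)

lemma bump_uminus: "bump \<delta> N (- z) = bump \<delta> N z" by (simp add: bump_def)

lemma Ck_on_bump: "Ck_on N UNIV (bump \<delta> (N + 1) :: 'a::euclidean_space \<Rightarrow> real)"
proof (induction N)
  case 0
  then show ?case using continuous_on_bump by simp
next
  case (Suc N)
  show ?case
  proof (rule Ck_on_SucI[where g = "\<lambda>b z. - (2 * real (N + 2)) * ((z \<bullet> b) * bump \<delta> (N + 1) z)"])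
    show "has_partial b (bump \<delta> (Suc N + 1)) x (- (2 * real (N + 2)) * ((x \<bullet> b) * bump \<delta> (N + 1) x))" for b x :: 'a
      using has_partial_bump[of b \<delta> N x] by (simp add: mult.assoc)
    show "Ck_on N UNIV (\<lambda>z. - (2 * real (N + 2)) * ((z \<bullet> b) * bump \<delta> (N + 1) z))" for b :: 'a
      by (intro Ck_on_cmult Ck_on_mult Ck_on_inner Suc) auto
  qed (auto intro: continuous_on_bump)
qed

lemma has_partial_bump_second:
  "has_partial b (\<lambda>z. - 6 * (z \<bullet> b) * bump \<delta> 2 z) z
    (24 * (z \<bullet> b)\<^sup>2 * bump \<delta> 1 z - 6 * (b \<bullet> b) * bump \<delta> 2 z)"
  using has_partial_lin[OF has_partial_mult[OF has_partial_inner[of b b z] has_partial_bump_2[of b \<delta> z]] has_partial_const, of "-6" 0]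
  by (simp add: algebra_simps power2_eq_square)

lemma integral_cball_lin:
  fixes u v :: "'a::euclidean_space \<Rightarrow> real"
  assumes "continuous_on (cball 0 R) u" "continuous_on (cball 0 R) v"
  shows "(LINT z:cball 0 R|lborel. a * u z + c * v z) = a * (LINT z:cball 0 R|lborel. u z) + c * (LINT z:cball 0 R|lborel. v z)"
proof -
  have "set_integrable lborel (cball 0 R) u" "set_integrable lborel (cball 0 R) v"
    unfolding set_integrable_def by (intro borel_integrable_compact compact_cball assms)+
  then show ?thesis by (simp add: set_integral_add)
qed

lemma integral_cball_mono:
  fixes u v :: "'a::euclidean_space \<Rightarrow> real"
  assumes "continuous_on (cball 0 R) u" "continuous_on (cball 0 R) v" "\<And>z. z \<in> cball 0 R \<Longrightarrow> u z \<le> v z"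
  shows "(LINT z:cball 0 R|lborel. u z) \<le> (LINT z:cball 0 R|lborel. v z)"
proof -
  have "set_integrable lborel (cball 0 R) u" "set_integrable lborel (cball 0 R) v"
    unfolding set_integrable_def by (intro borel_integrable_compact compact_cball assms)+
  then show ?thesis using assms(3) by (intro set_integral_mono) auto
qed

lemma bounded_functional_integral:
  fixes w :: "'a::euclidean_space \<Rightarrow> real"
  assumes w: "continuous_on (cball 0 R) w"
  shows "bounded_functional R (LINT z:cball 0 R|lborel. \<bar>w z\<bar>) (\<lambda>u. LINT z:cball 0 R|lborel. w z * u z)"
  unfolding bounded_functional_def
proof (intro conjI allI impI)
  fix u v :: "'a \<Rightarrow> real" and a c assume uv: "continuous_on (cball 0 R) u" "continuous_on (cball 0 R) v"
  show "(LINT z:cball 0 R|lborel. w z * (a * u z + c * v z)) =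
     a * (LINT z:cball 0 R|lborel. w z * u z) + c * (LINT z:cball 0 R|lborel. w z * v z)"
    using integral_cball_lin[of R "\<lambda>z. w z * u z" "\<lambda>z. w z * v z" a c] w uv
    by (auto intro!: continuous_intros simp: algebra_simps)
next
  fix u :: "'a \<Rightarrow> real" and B assume u: "continuous_on (cball 0 R) u" "\<forall>z\<in>cball 0 R. \<bar>u z\<bar> \<le> B"
  have c: "continuous_on (cball 0 R) (\<lambda>z. B * \<bar>w z\<bar>)" "continuous_on (cball 0 R) (\<lambda>z. w z * u z)"
    "continuous_on (cball 0 R) (\<lambda>z. - (B * \<bar>w z\<bar>))" "continuous_on (cball 0 R) (\<lambda>z. \<bar>w z\<bar>)"
    using w u(1) by (auto intro!: continuous_intros)
  have e: "(LINT z:cball 0 R|lborel. B * \<bar>w z\<bar>) = B * (LINT z:cball 0 R|lborel. \<bar>w z\<bar>)"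
    "(LINT z:cball 0 R|lborel. - (B * \<bar>w z\<bar>)) = - (B * (LINT z:cball 0 R|lborel. \<bar>w z\<bar>))"
    using integral_cball_lin[OF c(4,4), of B 0] integral_cball_lin[OF c(4,4), of "-B" 0] by simp_all
  have b: "\<bar>w z * u z\<bar> \<le> B * \<bar>w z\<bar>" if "z \<in> cball 0 R" for z
    using u(2) that by (simp add: abs_mult mult.commute mult_right_mono)
  have "(LINT z:cball 0 R|lborel. w z * u z) \<le> (LINT z:cball 0 R|lborel. B * \<bar>w z\<bar>)"
    by (rule integral_cball_mono[OF c(2,1)]) (use b in \<open>auto dest: abs_le_D1\<close>)
  moreover have "(LINT z:cball 0 R|lborel. - (B * \<bar>w z\<bar>)) \<le> (LINT z:cball 0 R|lborel. w z * u z)"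
    by (rule integral_cball_mono[OF c(3,2)]) (use b in \<open>fastforce simp: abs_le_iff\<close>)
  ultimately show "\<bar>LINT z:cball 0 R|lborel. w z * u z\<bar> \<le> (LINT z:cball 0 R|lborel. \<bar>w z\<bar>) * B"
    unfolding e by (simp add: abs_le_iff mult.commute)
qed

lemma integral_translation_lborel:
  fixes f :: "'a::euclidean_space \<Rightarrow> real"
  assumes [measurable]: "f \<in> borel_measurable borel"
  shows "(LINT z|lborel. f (x + z)) = (LINT z|lborel. f z)"
proof -
  have "(LINT z|lborel. f z) = (LINT z|distr lborel borel ((+) x). f z)" by (simp add: lborel_distr_plus)
  also have "\<dots> = (LINT z|lborel. f (x + z))" by (subst integral_distr) auto
  finally show ?thesis ..
qed

text \<open>
  The integral of a compactly supported function does not change when the function is translated, and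
  the derivative of this constant under the integral sign is the integral of the derivative.
\<close>

lemma integral_partial_eq_0:
  fixes \<phi> :: "'a::euclidean_space \<Rightarrow> real"
  assumes hp: "\<And>z. has_partial b \<phi> z (\<psi> z)" and c\<phi>: "continuous_on UNIV \<phi>" and c\<psi>: "continuous_on UNIV \<psi>"
    and b: "b \<in> Basis" and supp: "\<And>z. norm z \<ge> \<delta> \<Longrightarrow> \<phi> z = 0" "\<And>z. norm z > \<delta> \<Longrightarrow> \<psi> z = 0" and d: "\<delta> \<ge> 0"
  shows "(LINT z:cball 0 \<delta>|lborel. \<psi> z) = 0"
proof -
  define L where "L u = (LINT z:cball (0::'a) (\<delta> + 1)|lborel. 1 * u z)" for u :: "'a \<Rightarrow> real"
  have L: "bounded_functional (\<delta> + 1) (LINT z:cball (0::'a) (\<delta> + 1)|lborel. \<bar>1\<bar>) L"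
    unfolding L_def by (rule bounded_functional_integral) auto
  have p: "partial b \<phi> = \<psi>" using has_partialD(2)[OF hp] by auto
  have 1: "has_partial b (\<lambda>x. L (\<lambda>z. \<phi> (x + z))) 0 (L (\<lambda>z. \<psi> (0 + z)))"
    using bounded_functional_has_partial[OF L _ open_UNIV c\<phi>, of b 0] has_partialD(1)[OF hp] c\<psi> b d
    unfolding p by auto
  have [measurable]: "\<phi> \<in> borel_measurable borel" using c\<phi> by (rule borel_measurable_continuous_onI)
  have const: "L (\<lambda>z. \<phi> (x + z)) = (LINT z|lborel. \<phi> z)" if "x \<in> ball 0 1" for x
  proof -
    have *: "indicator (cball 0 (\<delta> + 1)) z *\<^sub>R (1 * \<phi> (x + z)) = \<phi> (x + z)" for z
    proof (cases "z \<in> cball 0 (\<delta> + 1)")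
      case False
      then have "norm (x + z) \<ge> \<delta>" using that norm_triangle_ineq2[of z "-x"] by (simp add: add.commute)
      then show ?thesis using supp by simp
    qed simp
    then have "L (\<lambda>z. \<phi> (x + z)) = (LINT z|lborel. \<phi> (x + z))"
      unfolding L_def set_lebesgue_integral_def by (simp only: *)
    also have "\<dots> = (LINT z|lborel. \<phi> z)" by (rule integral_translation_lborel) simp
    finally show ?thesis .
  qed
  have "has_partial b (\<lambda>x. L (\<lambda>z. \<phi> (x + z))) 0 d \<longleftrightarrow> has_partial b (\<lambda>x. LINT z|lborel. \<phi> z) 0 d" for d
    by (rule has_partial_cong[of "ball 0 1"]) (use const in auto)
  then have "L (\<lambda>z. \<psi> (0 + z)) = 0"
    using 1 has_partial_const has_partialD(2) by metis
  moreover have "L (\<lambda>z. \<psi> (0 + z)) = (LINT z:cball 0 \<delta>|lborel. \<psi> z)"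
    unfolding L_def set_lebesgue_integral_def
    by (rule Bochner_Integration.integral_cong) (use supp(2) in \<open>auto simp: indicator_def\<close>)
  ultimately show ?thesis by simp
qed

text \<open>
  Green's identity for the weight \<open>q = (\<delta>\<^sup>2 - |z|\<^sup>2)\<^sup>3\<close>, which vanishes to third order at the sphere, so that no boundary
  terms occur. The polynomial on the right is \<open>\<Delta>q\<close>. For each basis vector \<open>b\<close> the integrand
  \<open>q \<partial>\<^sub>b\<^sup>2 v - v \<partial>\<^sub>b\<^sup>2 q\<close> is the \<open>b\<close>-derivative of \<open>q \<partial>\<^sub>b v - v \<partial>\<^sub>b q\<close>, in which the cross terms cancel.
\<close>

lemma integral_bump_laplacian:
  fixes v :: "'a::euclidean_space \<Rightarrow> real"
  assumes v: "Ck_on 2 S v" and S: "open S" "cball x \<delta> \<subseteq> S" and d: "\<delta> > 0"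
  shows "(LINT z:cball 0 \<delta>|lborel. (\<delta>\<^sup>2 - (norm z)\<^sup>2) ^ 3 * laplacian v (x + z)) =
    (LINT z:cball 0 \<delta>|lborel. (24 * (norm z)\<^sup>2 * (\<delta>\<^sup>2 - (norm z)\<^sup>2) - 6 * real DIM('a) * (\<delta>\<^sup>2 - (norm z)\<^sup>2)\<^sup>2) * v (x + z))"
proof -
  let ?S = "{z. x + z \<in> S}"
  have oS: "open ?S" 
  proof -
    have "open ((\<lambda>z. x + z) -` S)" by (intro open_vimage S continuous_intros)
    then show ?thesis by (simp add: vimage_def)
  qed
  have cS: "cball 0 \<delta> \<subseteq> ?S"
  proof
    fix z :: 'a assume "z \<in> cball 0 \<delta>"
    then have "x + z \<in> cball x \<delta>" by (simp add: dist_norm)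
    then show "z \<in> ?S" using S(2) by auto
  qed
  let ?qb = "\<lambda>b z. - 6 * (z \<bullet> b) * bump \<delta> 2 z"
  let ?qbb = "\<lambda>b z. 24 * (z \<bullet> b)\<^sup>2 * bump \<delta> 1 z - 6 * (b \<bullet> b) * bump \<delta> 2 z"
  define \<psi> where "\<psi> b z = bump \<delta> 3 z * partial b (partial b v) (x + z) - ?qbb b z * v (x + z)" for b z
  have shift: "has_partial b (\<lambda>z. g (x + z)) z d \<longleftrightarrow> has_partial b g (x + z) d" for g b z d
    unfolding has_partial_def by (simp add: add.assoc)
  have tr: "continuous_on ?S (\<lambda>z. g (x + z))" if "continuous_on S g" for g :: "'a \<Rightarrow> real"
    by (rule continuous_on_compose2[OF that]) (auto intro!: continuous_intros)
  have glue: "continuous_on UNIV g" if "continuous_on ?S g" "\<And>z. norm z > \<delta> \<Longrightarrow> g z = 0" for g :: "'a \<Rightarrow> real"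
  proof -
    have "continuous_on (- cball 0 \<delta>) g"
      using continuous_on_const[of "- cball (0::'a) \<delta>" "0::real"] by (rule continuous_on_eq) (use that(2) in auto)
    then have "continuous_on (?S \<union> (- cball 0 \<delta>)) g"
      by (intro continuous_on_open_Un oS that(1)) auto
    moreover have "?S \<union> (- cball 0 \<delta>) = UNIV" using cS by auto
    ultimately show ?thesis by simp
  qed
  have b0: "bump \<delta> N z = 0" if "norm z \<ge> \<delta>" "N > 0" for N and z :: 'a
    using bump_eq_0[OF _ that] d by simp
  have c\<psi>: "continuous_on UNIV (\<psi> b)" if b: "b \<in> Basis" for b
  proof (rule glue)
    have "continuous_on S (partial b (partial b v))" "continuous_on S v"
      using v b by (auto simp: eval_nat_numeral)
    then show "continuous_on ?S (\<psi> b)" unfolding \<psi>_def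
      by (intro continuous_intros tr continuous_on_bump)
  qed (simp add: \<psi>_def b0)
  have int0: "(LINT z:cball 0 \<delta>|lborel. \<psi> b z) = 0" if b: "b \<in> Basis" for b
  proof -
    define \<phi> where "\<phi> z = bump \<delta> 3 z * partial b v (x + z) - ?qb b z * v (x + z)" for z
    have vb: "continuous_on S v" "continuous_on S (partial b v)"
      "\<And>y. y \<in> S \<Longrightarrow> partially_differentiable b v y" "\<And>y. y \<in> S \<Longrightarrow> partially_differentiable b (partial b v) y"
      using v b by (auto simp: eval_nat_numeral)
    show ?thesis
    proof (rule integral_partial_eq_0[where \<phi> = \<phi> and b = b])
      show "has_partial b \<phi> z (\<psi> b z)" for z
      proof (cases "z \<in> ?S")
        case True
        have p1: "has_partial b (\<lambda>z. partial b v (x + z)) z (partial b (partial b v) (x + z))"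
          "has_partial b (\<lambda>z. v (x + z)) z (partial b v (x + z))"
          unfolding shift using vb True by (auto intro: has_partialI)
        have p2: "has_partial b (bump \<delta> 3) z (?qb b z)"
          by (rule has_partial_bump_3)
        from has_partial_lin[OF has_partial_mult[OF p2 p1(1)] has_partial_mult[OF has_partial_bump_second[of b \<delta>] p1(2)], of 1 "-1"]
        show ?thesis unfolding \<phi>_def \<psi>_def by (simp add: algebra_simps)
      next
        case False
        then have z: "z \<in> - cball 0 \<delta>" using cS by blast
        have "has_partial b \<phi> z 0 \<longleftrightarrow> has_partial b (\<lambda>_. 0) z 0"
          by (rule has_partial_cong[OF _ z]) (auto simp: \<phi>_def b0)
        then show ?thesis using has_partial_const z by (simp add: \<psi>_def b0)
      qed
      show "continuous_on UNIV \<phi>"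
      proof (rule glue)
        show "continuous_on ?S \<phi>" unfolding \<phi>_def
          by (intro continuous_intros tr continuous_on_bump vb)
      qed (simp add: \<phi>_def b0)
    qed (use c\<psi> b d in \<open>auto simp: \<phi>_def \<psi>_def b0\<close>)
  qed
  have cc: "continuous_on (cball 0 \<delta>) (\<psi> b)" if "b \<in> Basis" for b
    using c\<psi>[OF that] continuous_on_subset by blast
  have "(LINT z:cball 0 \<delta>|lborel. 1 * (\<Sum>b\<in>Basis. \<psi> b z)) = (\<Sum>b\<in>Basis. LINT z:cball 0 \<delta>|lborel. 1 * \<psi> b z)"
    by (rule bounded_functional_sum[OF bounded_functional_integral]) (use cc in auto)
  then have sum0: "(LINT z:cball 0 \<delta>|lborel. (\<Sum>b\<in>Basis. \<psi> b z)) = 0"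
    using int0 by simp
  let ?A = "\<lambda>z. (\<delta>\<^sup>2 - (norm z)\<^sup>2) ^ 3 * laplacian v (x + z)"
  let ?B = "\<lambda>z. (24 * (norm z)\<^sup>2 * (\<delta>\<^sup>2 - (norm z)\<^sup>2) - 6 * real DIM('a) * (\<delta>\<^sup>2 - (norm z)\<^sup>2)\<^sup>2) * v (x + z)"
  have eq: "(\<Sum>b\<in>Basis. \<psi> b z) = 1 * ?A z + (-1) * ?B z" if "z \<in> cball 0 \<delta>" for z
  proof -
    have z: "norm z \<le> \<delta>" using that by simp
    have "(\<Sum>b\<in>Basis. ?qbb b z) = 24 * (\<Sum>b\<in>Basis. (z \<bullet> b) * (z \<bullet> b)) * bump \<delta> 1 z - 6 * (\<Sum>b\<in>(Basis::'a set). b \<bullet> b) * bump \<delta> 2 z"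
      by (simp add: sum_subtractf sum_distrib_left sum_distrib_right power2_eq_square mult.assoc)
    also have "(\<Sum>b\<in>Basis. (z \<bullet> b) * (z \<bullet> b)) = (norm z)\<^sup>2"
      by (simp only: euclidean_inner[of z z, symmetric] dot_square_norm)
    also have "(\<Sum>b\<in>(Basis::'a set). b \<bullet> b) = real DIM('a)" by simp
    finally have q: "(\<Sum>b\<in>Basis. ?qbb b z) = 24 * (norm z)\<^sup>2 * (\<delta>\<^sup>2 - (norm z)\<^sup>2) - 6 * real DIM('a) * (\<delta>\<^sup>2 - (norm z)\<^sup>2)\<^sup>2"
      by (simp add: bump_eq[OF z])
    have gen: "(\<Sum>b\<in>Basis. c * f b - g b * k) = c * sum f Basis - sum g Basis * k" for f g :: "'a \<Rightarrow> real" and c k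
      by (simp add: sum_subtractf sum_distrib_left sum_distrib_right)
    have "(\<Sum>b\<in>Basis. \<psi> b z) = bump \<delta> 3 z * laplacian v (x + z) - (\<Sum>b\<in>Basis. ?qbb b z) * v (x + z)"
      unfolding \<psi>_def laplacian_def by (rule gen)
    then show ?thesis unfolding q by (simp add: bump_eq[OF z])
  qed
  have "continuous_on S (laplacian v)"
    using continuous_on_laplacian[OF S(1)] v by blast
  then have cA: "continuous_on (cball 0 \<delta>) ?A" and cB: "continuous_on (cball 0 \<delta>) ?B"
    using continuous_on_translate[OF _ S(2)] Ck_on_imp_continuous[OF v] by (auto intro!: continuous_intros)
  have "(LINT z:cball 0 \<delta>|lborel. 1 * ?A z + (-1) * ?B z) = (LINT z:cball 0 \<delta>|lborel. (\<Sum>b\<in>Basis. \<psi> b z))"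
    by (rule set_lebesgue_integral_cong) (use eq in auto)
  then show ?thesis using sum0 integral_cball_lin[OF cA cB, of 1 "-1"] by simp
qed

section \<open>Radial potentials\<close>

definition radial_moment :: "nat \<Rightarrow> (real \<Rightarrow> real) \<Rightarrow> real \<Rightarrow> real" where
  "radial_moment k g s = integral {0..s} (\<lambda>\<rho>. \<rho> ^ k * g \<rho>)"

text \<open>
  On functions of the radius \<open>t\<close> the Laplacian is \<open>t\<^bsup>1-n\<^esup> (t\<^bsup>n-1\<^esup> \<phi>')'\<close>. This is its inverse that
  vanishes at the origin. At \<open>s = 0\<close> the integrand is a quotient with numerator \<open>0\<close>, which is the right limit.
\<close>

definition radial_potential :: "nat \<Rightarrow> (real \<Rightarrow> real) \<Rightarrow> real \<Rightarrow> real" where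
  "radial_potential n g t = integral {0..t} (\<lambda>s. radial_moment (n - 1) g s / s ^ (n - 1))"

context
  fixes R :: real and g :: "real \<Rightarrow> real"
  assumes g: "continuous_on {0..R} g"
begin

lemma radial_moment_integrable: "s \<le> R \<Longrightarrow> (\<lambda>\<rho>. \<rho> ^ k * g \<rho>) integrable_on {0..s}"
  by (intro integrable_continuous_interval continuous_intros continuous_on_subset[OF g]) auto

lemma radial_moment_has_derivative:
  assumes "s \<in> {0..R}"
  shows "(radial_moment k g has_real_derivative s ^ k * g s) (at s within {0..R})"
  unfolding radial_moment_def
  by (rule integral_has_real_derivative[OF _ assms]) (intro continuous_intros g)

lemma radial_moment_continuous: "continuous_on {0..R} (radial_moment k g)"
  unfolding continuous_on_eq_continuous_within
  using radial_moment_has_derivative DERIV_continuous by blast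

lemma radial_moment_bound:
  assumes s: "s \<in> {0..R}" and B: "\<And>\<rho>. \<rho> \<in> {0..R} \<Longrightarrow> \<bar>g \<rho>\<bar> \<le> M * \<rho> ^ i" and M: "M \<ge> 0"
  shows "\<bar>radial_moment k g s\<bar> \<le> M * s ^ (k + i + 1)"
proof -
  have "norm (integral {0..s} (\<lambda>\<rho>. \<rho> ^ k * g \<rho>)) \<le> (M * s ^ (k + i)) * measure lborel {0..s}"
  proof (rule has_integral_bound_real[OF _ _ integrable_integral])
    show "(\<lambda>\<rho>. \<rho> ^ k * g \<rho>) integrable_on {0..s}" using radial_moment_integrable s by auto
    show "\<And>\<rho>. \<rho> \<in> {0..s} - {} \<Longrightarrow> norm (\<rho> ^ k * g \<rho>) \<le> M * s ^ (k + i)"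
    proof -
      fix \<rho> assume r: "\<rho> \<in> {0..s} - {}"
      have "\<bar>\<rho> ^ k * g \<rho>\<bar> = \<rho> ^ k * \<bar>g \<rho>\<bar>" using r by (simp add: abs_mult)
      also have "\<dots> \<le> \<rho> ^ k * (M * \<rho> ^ i)" using r s by (intro mult_left_mono B) auto
      also have "\<dots> = M * \<rho> ^ (k + i)" by (simp add: power_add mult_ac)
      also have "\<dots> \<le> M * s ^ (k + i)" using r M by (intro mult_left_mono power_mono) auto
      finally show "norm (\<rho> ^ k * g \<rho>) \<le> M * s ^ (k + i)" by simp
    qed
  qed (use s M in auto)
  then show ?thesis unfolding radial_moment_def using s by (simp add: mult_ac)
qed

lemma radial_potential_integrand_bound:
  assumes s: "s \<in> {0..R}" and B: "\<And>\<rho>. \<rho> \<in> {0..R} \<Longrightarrow> \<bar>g \<rho>\<bar> \<le> M * \<rho> ^ i" and M: "M \<ge> 0"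
  shows "\<bar>radial_moment k g s / s ^ k\<bar> \<le> M * s ^ (i + 1)"
proof (cases "s = 0")
  case True
  then show ?thesis by (simp add: radial_moment_def)
next
  case False
  then have s0: "s > 0" using s by simp
  have "\<bar>radial_moment k g s / s ^ k\<bar> \<le> M * s ^ (k + i + 1) / s ^ k"
    using radial_moment_bound[OF s B M, of k] s0 by (simp add: abs_divide divide_right_mono)
  also have "\<dots> = M * s ^ (i + 1)" using s0 by (simp add: power_add)
  finally show ?thesis .
qed

lemma radial_potential_integrand_continuous: "continuous_on {0..R} (\<lambda>s. radial_moment k g s / s ^ k)"
proof -
  obtain M where M: "\<And>\<rho>. \<rho> \<in> {0..R} \<Longrightarrow> norm (g \<rho>) \<le> M"
    using compact_imp_bounded[OF compact_continuous_image[OF g compact_Icc]] unfolding bounded_iff by blast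
  define M' where "M' = max M 0"
  have M': "\<And>\<rho>. \<rho> \<in> {0..R} \<Longrightarrow> \<bar>g \<rho>\<bar> \<le> M' * \<rho> ^ 0" "M' \<ge> 0" using M unfolding M'_def by fastforce+
  show ?thesis unfolding continuous_on_eq_continuous_within
  proof
    fix s assume s: "s \<in> {0..R}"
    show "continuous (at s within {0..R}) (\<lambda>s. radial_moment k g s / s ^ k)"
    proof (cases "s = 0")
      case True
      have "((\<lambda>s. radial_moment k g s / s ^ k) \<longlongrightarrow> 0) (at 0 within {0..R})"
      proof (rule Lim_null_comparison)
        show "\<forall>\<^sub>F s in at 0 within {0..R}. norm (radial_moment k g s / s ^ k) \<le> M' * s ^ (0 + 1)"
          using radial_potential_integrand_bound[OF _ M'] by (auto simp: eventually_at_filter)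
        show "((\<lambda>s. M' * s ^ (0 + 1)) \<longlongrightarrow> 0) (at 0 within {0..R})"
          by (auto intro!: tendsto_eq_intros)
      qed
      then show ?thesis using True by (simp add: continuous_within radial_moment_def)
    next
      case False
      have "(radial_moment k g \<longlongrightarrow> radial_moment k g s) (at s within {0..R})"
        using radial_moment_continuous s by (auto simp: continuous_on_def)
      with False show ?thesis unfolding continuous_within
        by (intro tendsto_divide tendsto_power tendsto_ident_at) auto
    qed
  qed
qed

lemma radial_potential_has_derivative:
  assumes "t \<in> {0..R}"
  shows "(radial_potential n g has_real_derivative radial_moment (n - 1) g t / t ^ (n - 1)) (at t within {0..R})"
  unfolding radial_potential_def
  by (rule integral_has_real_derivative[OF radial_potential_integrand_continuous assms])

lemma radial_potential_continuous: "continuous_on {0..R} (radial_potential n g)"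
  unfolding continuous_on_eq_continuous_within
  using radial_potential_has_derivative DERIV_continuous by blast

text \<open>
  Every application of the potential gains two powers of the radius.
\<close>

lemma radial_potential_bound:
  assumes t: "t \<in> {0..R}" and B: "\<And>\<rho>. \<rho> \<in> {0..R} \<Longrightarrow> \<bar>g \<rho>\<bar> \<le> M * \<rho> ^ i" and M: "M \<ge> 0"
  shows "\<bar>radial_potential n g t\<bar> \<le> M * t ^ (i + 2)"
proof -
  have "norm (integral {0..t} (\<lambda>s. radial_moment (n - 1) g s / s ^ (n - 1))) \<le> (M * t ^ (i + 1)) * measure lborel {0..t}"
  proof (rule has_integral_bound_real[OF _ _ integrable_integral])
    show "(\<lambda>s. radial_moment (n - 1) g s / s ^ (n - 1)) integrable_on {0..t}"
      using t by (intro integrable_continuous_interval continuous_on_subset[OF radial_potential_integrand_continuous]) auto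
    show "\<And>s. s \<in> {0..t} - {} \<Longrightarrow> norm (radial_moment (n - 1) g s / s ^ (n - 1)) \<le> M * t ^ (i + 1)"
    proof -
      fix s assume s: "s \<in> {0..t} - {}"
      have "\<bar>radial_moment (n - 1) g s / s ^ (n - 1)\<bar> \<le> M * s ^ (i + 1)"
        using s t by (intro radial_potential_integrand_bound B M) auto
      also have "\<dots> \<le> M * t ^ (i + 1)" using s M by (intro mult_left_mono power_mono) auto
      finally show "norm (radial_moment (n - 1) g s / s ^ (n - 1)) \<le> M * t ^ (i + 1)" by simp
    qed
  qed (use t M in auto)
  then show ?thesis unfolding radial_potential_def using t by (simp add: mult_ac)
qed

end

lemma radial_moment_lin:
  assumes "continuous_on {0..R} g" "continuous_on {0..R} \<psi>" "s \<in> {0..R}"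
  shows "radial_moment k (\<lambda>t. a * g t + c * \<psi> t) s = a * radial_moment k g s + c * radial_moment k \<psi> s"
proof -
  have "radial_moment k (\<lambda>t. a * g t + c * \<psi> t) s = integral {0..s} (\<lambda>\<rho>. a * (\<rho> ^ k * g \<rho>) + c * (\<rho> ^ k * \<psi> \<rho>))"
    unfolding radial_moment_def by (simp add: algebra_simps)
  also have "\<dots> = a * radial_moment k g s + c * radial_moment k \<psi> s"
    unfolding radial_moment_def
    using assms(3)
    by (simp add: integral_add integrable_on_mult_right radial_moment_integrable[OF assms(1)] radial_moment_integrable[OF assms(2)])
  finally show ?thesis .
qed

lemma radial_potential_lin:
  assumes "continuous_on {0..R} g" "continuous_on {0..R} \<psi>" "t \<in> {0..R}"
  shows "radial_potential n (\<lambda>t. a * g t + c * \<psi> t) t = a * radial_potential n g t + c * radial_potential n \<psi> t"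
proof -
  let ?E = "\<lambda>g s. radial_moment (n - 1) g s / s ^ (n - 1)"
  have i: "?E g integrable_on {0..t}" "?E \<psi> integrable_on {0..t}"
    using assms by (auto intro!: integrable_continuous_interval
        continuous_on_subset[OF radial_potential_integrand_continuous[OF assms(1)]]
        continuous_on_subset[OF radial_potential_integrand_continuous[OF assms(2)]])
  have "radial_potential n (\<lambda>t. a * g t + c * \<psi> t) t = integral {0..t} (\<lambda>s. a * ?E g s + c * ?E \<psi> s)"
    unfolding radial_potential_def
    by (rule integral_cong, subst radial_moment_lin[OF assms(1,2)]) (use assms(3) in \<open>auto simp: add_divide_distrib\<close>)
  also have "\<dots> = a * radial_potential n g t + c * radial_potential n \<psi> t"
    unfolding radial_potential_def
    by (simp only: integral_add[OF integrable_on_mult_right[OF i(1)] integrable_on_mult_right[OF i(2)]] integral_mult_right)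
  finally show ?thesis .
qed

lemma radial_potential_const:
  assumes "n > 0" "t \<ge> 0"
  shows "radial_potential n (\<lambda>_. c) t = c * t\<^sup>2 / (2 * real n)"
proof -
  have m: "radial_moment (n - 1) (\<lambda>_. c) s = c * s ^ n / real n" if s: "s \<ge> 0" for s
  proof -
    have "((\<lambda>\<rho>. \<rho> ^ (n - 1) * c) has_integral (c * s ^ n / real n - c * 0 ^ n / real n)) {0..s}"
      by (rule fundamental_theorem_of_calculus[OF s])
         (use assms(1) in \<open>auto intro!: derivative_eq_intros simp: has_real_derivative_iff_has_vector_derivative[symmetric]\<close>)
    then have "((\<lambda>\<rho>. \<rho> ^ (n - 1) * c) has_integral c * s ^ n / real n) {0..s}"
      using assms(1) by (simp add: power_0_left)
    then show ?thesis unfolding radial_moment_def by (rule integral_unique)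
  qed
  have "radial_potential n (\<lambda>_. c) t = integral {0..t} (\<lambda>s. c / real n * s)"
    unfolding radial_potential_def
  proof (rule integral_cong)
    fix s assume s: "s \<in> {0..t}"
    have "s ^ n = s * s ^ (n - 1)" using assms(1) by (cases n) auto
    then show "radial_moment (n - 1) (\<lambda>_. c) s / s ^ (n - 1) = c / real n * s"
      using s m[of s] by (cases "s = 0") auto
  qed
  also have "\<dots> = c * t\<^sup>2 / (2 * real n)"
  proof (rule integral_unique)
    have "((\<lambda>s. c / real n * s) has_integral (c * t\<^sup>2 / (2 * real n) - c * 0\<^sup>2 / (2 * real n))) {0..t}"
      by (rule fundamental_theorem_of_calculus[OF assms(2)])
         (use assms(1) in \<open>auto intro!: derivative_eq_intros simp: has_real_derivative_iff_has_vector_derivative[symmetric]\<close>)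
    then show "((\<lambda>s. c / real n * s) has_integral c * t\<^sup>2 / (2 * real n)) {0..t}" by simp
  qed
  finally show ?thesis .
qed

lemma radial_potential_0: "radial_potential n g 0 = 0"
  by (simp add: radial_potential_def)

lemma DERIV_zero_on_interval:
  fixes f :: "real \<Rightarrow> real"
  assumes "\<And>t. t \<in> {0<..<R} \<Longrightarrow> f t = 0" "t \<in> {0<..<R}" "(f has_real_derivative d) (at t)"
  shows "d = 0"
proof -
  have "eventually (\<lambda>s. f s = 0) (nhds t)"
    using eventually_nhds_in_open[of "{0<..<R}" t] assms(1,2) by (auto elim!: eventually_mono)
  then have "((\<lambda>_. 0) has_real_derivative d) (at t)"
    using DERIV_cong_ev[OF refl _ refl, of f "\<lambda>_. 0" t d] assms(3) by simp
  then show ?thesis by (rule DERIV_unique) (rule DERIV_const)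
qed

text \<open>
  The weight is, up to the factor \<open>s\<^bsup>n-1\<^esup>\<close>, the derivative of \<open>s\<^sup>n (\<delta>\<^sup>2 - s\<^sup>2)\<^sup>2\<close>. Expanding it in moments of \<open>d\<close>
  and differentiating twice in \<open>\<delta>\<close> eliminates the higher moments and leaves \<open>n M = \<delta>\<^sup>n d(\<delta>)\<close> for
  \<open>M = \<integral>\<^sub>0\<^sup>\<delta> s\<^bsup>n-1\<^esup> d\<close>. Then \<open>M / \<delta>\<^sup>n\<close> has derivative zero, \<open>d\<close> is constant, and the constant is its value at \<open>0\<close>.
\<close>

lemma radial_weak_solution_zero:
  fixes d :: "real \<Rightarrow> real"
  assumes d: "continuous_on {0..R} d" and d0: "d 0 = 0" and R: "R > 0" and n: "n > 0"
    and weak: "\<And>\<delta>. \<delta> \<in> {0<..<R} \<Longrightarrow>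
      integral {0..\<delta>} (\<lambda>s. (real n * (\<delta>\<^sup>2 - s\<^sup>2)\<^sup>2 - 4 * s\<^sup>2 * (\<delta>\<^sup>2 - s\<^sup>2)) * (s ^ (n - 1) * d s)) = 0"
    and t: "t \<in> {0..R}"
  shows "d t = 0"
proof -
  let ?D = "\<lambda>k. radial_moment k d"
  obtain m where m: "n = Suc m" using gr0_implies_Suc[OF n] ..
  have m1: "n - 1 = m" using m by simp
  have der: "(?D k has_real_derivative s ^ k * d s) (at s)" if "s \<in> {0<..<R}" for s k
  proof -
    have "s \<in> {0..R}" "at s within {0..R} = at s" using that by (auto intro: at_within_Icc_at)
    then show ?thesis using radial_moment_has_derivative[OF d, of s k] by (simp only:)
  qed
  have Q: "real n * \<delta> ^ 4 * ?D m \<delta> - (2 * real n + 4) * \<delta>\<^sup>2 * ?D (m + 2) \<delta> + (real n + 4) * ?D (m + 4) \<delta> = 0"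
    if \<delta>: "\<delta> \<in> {0<..<R}" for \<delta>
  proof -
    have i: "(\<lambda>s. s ^ k * d s) integrable_on {0..\<delta>}" for k
      using radial_moment_integrable[OF d] \<delta> by auto
    have "integral {0..\<delta>} (\<lambda>s. (real n * (\<delta>\<^sup>2 - s\<^sup>2)\<^sup>2 - 4 * s\<^sup>2 * (\<delta>\<^sup>2 - s\<^sup>2)) * (s ^ m * d s))
      = integral {0..\<delta>} (\<lambda>s. (real n * \<delta> ^ 4) * (s ^ m * d s) + (- (2 * real n + 4) * \<delta>\<^sup>2) * (s ^ (m + 2) * d s) + (real n + 4) * (s ^ (m + 4) * d s))"
      by (rule integral_cong) (simp add: power_add algebra_simps power2_eq_square eval_nat_numeral)
    also have "\<dots> = (real n * \<delta> ^ 4) * ?D m \<delta> + (- (2 * real n + 4) * \<delta>\<^sup>2) * ?D (m + 2) \<delta> + (real n + 4) * ?D (m + 4) \<delta>"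
      unfolding radial_moment_def
      by (subst integral_add; (intro integrable_add integrable_on_mult_right i)?)
         (subst integral_add; (intro integrable_add integrable_on_mult_right i)?; simp)
    finally show ?thesis using weak[OF \<delta>, unfolded m1] by (simp add: algebra_simps)
  qed
  \<comment> \<open>The derivative of the preceding relation; the terms containing \<open>d \<delta>\<close> itself cancel.\<close>
  have Q': "real n * \<delta>\<^sup>2 * ?D m \<delta> - (real n + 2) * ?D (m + 2) \<delta> = 0" if \<delta>: "\<delta> \<in> {0<..<R}" for \<delta>
  proof -
    have "((\<lambda>\<delta>. real n * \<delta> ^ 4 * ?D m \<delta> - (2 * real n + 4) * \<delta>\<^sup>2 * ?D (m + 2) \<delta> + (real n + 4) * ?D (m + 4) \<delta>)
      has_real_derivative 4 * \<delta> * (real n * \<delta>\<^sup>2 * ?D m \<delta> - (real n + 2) * ?D (m + 2) \<delta>)) (at \<delta>)"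
      by (auto intro!: derivative_eq_intros der[OF \<delta>] simp: algebra_simps power_add power2_eq_square eval_nat_numeral)
    from DERIV_zero_on_interval[OF Q \<delta> this] show ?thesis using \<delta> by auto
  qed
  have Q'': "real n * ?D m \<delta> = \<delta> ^ n * d \<delta>" if \<delta>: "\<delta> \<in> {0<..<R}" for \<delta>
  proof -
    have "((\<lambda>\<delta>. real n * \<delta>\<^sup>2 * ?D m \<delta> - (real n + 2) * ?D (m + 2) \<delta>)
      has_real_derivative 2 * \<delta> * (real n * ?D m \<delta> - \<delta> ^ n * d \<delta>)) (at \<delta>)"
      by (auto intro!: derivative_eq_intros der[OF \<delta>] simp: m algebra_simps power_add power2_eq_square)
    from DERIV_zero_on_interval[OF Q' \<delta> this] show ?thesis using \<delta> by auto
  qed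
  have "\<exists>c. \<forall>s\<in>{0<..<R}. ?D m s / s ^ n = c"
  proof (rule has_field_derivative_zero_constant)
    fix s assume s: "s \<in> {0<..<R}"
    have "((\<lambda>s. ?D m s / s ^ n) has_real_derivative ((s ^ m * d s) * s ^ n - ?D m s * (real n * s ^ (n - 1))) / (s ^ n * s ^ n)) (at s)"
      using s by (auto intro!: derivative_eq_intros der)
    moreover have "(s ^ m * d s) * s ^ n - ?D m s * (real n * s ^ (n - 1)) = s ^ m * (s ^ n * d s - real n * ?D m s)"
      by (simp add: m algebra_simps)
    ultimately show "((\<lambda>s. ?D m s / s ^ n) has_real_derivative 0) (at s within {0<..<R})"
      using Q''[OF s] has_field_derivative_at_within by fastforce
  qed auto
  then obtain c where c: "\<And>s. s \<in> {0<..<R} \<Longrightarrow> ?D m s / s ^ n = c" by blast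
  have dc: "d s = real n * c" if s: "s \<in> {0<..<R}" for s
    using c[OF s] Q''[OF s] s by (auto simp: field_simps)
  have cl: "closure {0<..<R} = {0..R}" using R by (rule closure_greaterThanLessThan)
  have "d s = real n * c" if "s \<in> {0..R}" for s
    by (rule continuous_constant_on_closure[of "{0<..<R}"]) (use d dc that cl in auto)
  from this[OF t] this[of 0] d0 R show ?thesis by simp
qed

text \<open>
  The hypothesis says in weak form that the radial Laplacian of \<open>\<phi>\<close> is \<open>g\<close>. The right-hand side satisfies the same
  relation, by two integrations by parts, so the difference is zero by the uniqueness lemma above.
\<close>

lemma radial_green:
  assumes \<phi>: "continuous_on {0..R} \<phi>" and g: "continuous_on {0..R} g" and n: "n > 0"
    and weak: "\<And>\<delta>. \<delta> \<in> {0<..<R} \<Longrightarrow>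
      integral {0..\<delta>} (\<lambda>s. (\<delta>\<^sup>2 - s\<^sup>2) ^ 3 * s ^ (n - 1) * g s) =
      integral {0..\<delta>} (\<lambda>s. (24 * s\<^sup>2 * (\<delta>\<^sup>2 - s\<^sup>2) - 6 * real n * (\<delta>\<^sup>2 - s\<^sup>2)\<^sup>2) * s ^ (n - 1) * \<phi> s)"
    and t: "t \<in> {0..R}"
  shows "\<phi> t = \<phi> 0 + radial_potential n g t"
proof (cases "R > 0")
  case False
  then have "t = 0" using t by auto
  then show ?thesis by (simp add: radial_potential_0)
next
  case R: True
  obtain m where m: "n = Suc m" using gr0_implies_Suc[OF n] ..
  let ?Y = "radial_moment m g"
  define Z where "Z s = \<phi> 0 + radial_potential n g s" for s
  have Zc: "continuous_on {0..R} Z" unfolding Z_def by (intro continuous_intros radial_potential_continuous g)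
  have "(\<lambda>s. \<phi> s - Z s) t = 0"
  proof (rule radial_weak_solution_zero[OF _ _ R n _ t])
    show "continuous_on {0..R} (\<lambda>s. \<phi> s - Z s)" by (intro continuous_intros Zc \<phi>)
    show "\<phi> 0 - Z 0 = 0" by (simp add: Z_def radial_potential_0)
    fix \<delta> assume \<delta>: "\<delta> \<in> {0<..<R}"
    have sub: "{0..\<delta>} \<subseteq> {0..R}" and d0: "0 \<le> \<delta>" using \<delta> by auto
    note c\<phi> = continuous_on_subset[OF \<phi> sub] and cg = continuous_on_subset[OF g sub] and cZ = continuous_on_subset[OF Zc sub]
    have dY: "(?Y has_real_derivative s ^ m * g s) (at s within {0..\<delta>})" if "s \<in> {0..\<delta>}" for s
      using radial_moment_has_derivative[OF g, of s m] that sub by (blast intro: has_field_derivative_subset)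
    have cY: "continuous_on {0..\<delta>} ?Y" using radial_moment_continuous[OF g] sub continuous_on_subset by blast
    have dZ: "(Z has_real_derivative ?Y s / s ^ m) (at s within {0..\<delta>})" if "s \<in> {0..\<delta>}" for s
    proof -
      have "(Z has_real_derivative ?Y s / s ^ m) (at s within {0..R})"
        unfolding Z_def using radial_potential_has_derivative[OF g, of s n] that sub m
        by (auto intro!: derivative_eq_intros)
      then show ?thesis using sub by (blast intro: has_field_derivative_subset)
    qed
    have 1: "((\<lambda>s. (\<delta>\<^sup>2 - s\<^sup>2) ^ 3 * s ^ m * g s - 6 * s * (\<delta>\<^sup>2 - s\<^sup>2)\<^sup>2 * ?Y s) has_integral
        ((\<delta>\<^sup>2 - \<delta>\<^sup>2) ^ 3 * ?Y \<delta> - (\<delta>\<^sup>2 - 0\<^sup>2) ^ 3 * ?Y 0)) {0..\<delta>}"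
      by (rule fundamental_theorem_of_calculus[OF d0], unfold has_real_derivative_iff_has_vector_derivative[symmetric])
         (auto intro!: derivative_eq_intros dY simp: algebra_simps power2_eq_square eval_nat_numeral)
    have 2: "((\<lambda>s. (real n * (\<delta>\<^sup>2 - s\<^sup>2)\<^sup>2 - 4 * s\<^sup>2 * (\<delta>\<^sup>2 - s\<^sup>2)) * s ^ m * Z s + s * (\<delta>\<^sup>2 - s\<^sup>2)\<^sup>2 * ?Y s) has_integral
        (\<delta> ^ n * (\<delta>\<^sup>2 - \<delta>\<^sup>2)\<^sup>2 * Z \<delta> - 0 ^ n * (\<delta>\<^sup>2 - 0\<^sup>2)\<^sup>2 * Z 0)) {0..\<delta>}"
    proof (rule fundamental_theorem_of_calculus[OF d0], unfold has_real_derivative_iff_has_vector_derivative[symmetric])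
      fix s assume s: "s \<in> {0..\<delta>}"
      define E where "E = ?Y s / s ^ m"
      have e: "s ^ n * E = s * ?Y s"
        using radial_moment_def[of m g 0] by (cases "s = 0") (auto simp: m E_def)
      have dZ': "(Z has_real_derivative E) (at s within {0..\<delta>})" unfolding E_def by (rule dZ[OF s])
      have "((\<lambda>s. s ^ n * (\<delta>\<^sup>2 - s\<^sup>2)\<^sup>2 * Z s) has_real_derivative
         (real n * (\<delta>\<^sup>2 - s\<^sup>2)\<^sup>2 - 4 * s\<^sup>2 * (\<delta>\<^sup>2 - s\<^sup>2)) * s ^ m * Z s + (s ^ n * E) * (\<delta>\<^sup>2 - s\<^sup>2)\<^sup>2) (at s within {0..\<delta>})"
        by (rule derivative_eq_intros dZ' refl | simp add: m algebra_simps power2_eq_square)+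
      then show "((\<lambda>s. s ^ n * (\<delta>\<^sup>2 - s\<^sup>2)\<^sup>2 * Z s) has_real_derivative
        (real n * (\<delta>\<^sup>2 - s\<^sup>2)\<^sup>2 - 4 * s\<^sup>2 * (\<delta>\<^sup>2 - s\<^sup>2)) * s ^ m * Z s + s * (\<delta>\<^sup>2 - s\<^sup>2)\<^sup>2 * ?Y s) (at s within {0..\<delta>})"
        unfolding e by (simp only: mult_ac)
    qed
    let ?I = "\<lambda>f. integral {0..\<delta>} f"
    let ?f1 = "\<lambda>s. (\<delta>\<^sup>2 - s\<^sup>2) ^ 3 * s ^ m * g s" and ?f2 = "\<lambda>s. s * (\<delta>\<^sup>2 - s\<^sup>2)\<^sup>2 * ?Y s"
      and ?f3 = "\<lambda>s. (real n * (\<delta>\<^sup>2 - s\<^sup>2)\<^sup>2 - 4 * s\<^sup>2 * (\<delta>\<^sup>2 - s\<^sup>2)) * s ^ m * Z s"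
      and ?f4 = "\<lambda>s. (real n * (\<delta>\<^sup>2 - s\<^sup>2)\<^sup>2 - 4 * s\<^sup>2 * (\<delta>\<^sup>2 - s\<^sup>2)) * s ^ m * \<phi> s"
    have ints: "?f1 integrable_on {0..\<delta>}" "?f2 integrable_on {0..\<delta>}" "?f3 integrable_on {0..\<delta>}" "?f4 integrable_on {0..\<delta>}"
      by (intro integrable_continuous_interval continuous_intros cY cg cZ c\<phi>)+
    have "?I (\<lambda>s. ?f1 s - 6 * ?f2 s) = 0"
      using integral_unique[OF 1] by (simp add: radial_moment_def mult.assoc)
    then have e1: "?I ?f1 = 6 * ?I ?f2"
      using ints by (simp add: integral_diff integrable_on_mult_right)
    have "?I (\<lambda>s. ?f3 s + ?f2 s) = 0"
      using integral_unique[OF 2] by (simp add: m)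
    then have e2: "?I ?f3 + ?I ?f2 = 0" using ints by (simp add: integral_add)
    have "?I ?f1 = ?I (\<lambda>s. (-6) * ?f4 s)"
      using weak[OF \<delta>] unfolding m by (simp add: algebra_simps)
    then have e3: "?I ?f1 = -6 * ?I ?f4" by simp
    have "?I (\<lambda>s. ?f4 s - ?f3 s) = 0"
      using e1 e2 e3 ints by (simp add: integral_diff)
    then show "?I (\<lambda>s. (real n * (\<delta>\<^sup>2 - s\<^sup>2)\<^sup>2 - 4 * s\<^sup>2 * (\<delta>\<^sup>2 - s\<^sup>2)) * (s ^ (n - 1) * (\<phi> s - Z s))) = 0"
      unfolding m by (simp add: algebra_simps)
  qed
  then show ?thesis by (simp add: Z_def)
qed

section \<open>Green's formula for spherical means and weak Laplacians\<close>

lemma spherical_mean_continuous_radius: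
  fixes v :: "'a::euclidean_space \<Rightarrow> real"
  assumes "continuous_on S v" "cball x R \<subseteq> S"
  shows "continuous_on {0..R} (spherical_mean v x)"
proof -
  have "spherical_mean v x = spherical_mean (\<lambda>z. v (x + z)) 0"
    using spherical_mean_translate[of v x] by blast
  then show ?thesis
    using spherical_mean_continuous[OF continuous_on_translate[OF assms]] by simp
qed

text \<open>
  Green's identity for the bumps of all radii \<open>\<delta>\<close> is, in polar coordinates, the weak radial equation for the
  spherical means. No surface integral of a gradient is involved.
\<close>

lemma spherical_mean_green:
  fixes v :: "'a::euclidean_space \<Rightarrow> real"
  assumes v: "Ck_on 2 S v" and S: "open S" "cball x R \<subseteq> S" and t: "t \<in> {0..R}"
  shows "spherical_mean v x t = v x + radial_potential DIM('a) (spherical_mean (laplacian v) x) t"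
proof -
  have cv: "continuous_on S v" using Ck_on_imp_continuous[OF v] .
  have cl: "continuous_on S (laplacian v)"
    using continuous_on_laplacian[OF S(1)] v by blast
  have "spherical_mean v x t = spherical_mean v x 0 + radial_potential DIM('a) (spherical_mean (laplacian v) x) t"
  proof (rule radial_green[OF spherical_mean_continuous_radius[OF cv S(2)]
        spherical_mean_continuous_radius[OF cl S(2)] DIM_positive _ t])
    fix \<delta> assume d: "\<delta> \<in> {0<..<R}"
    have sub: "cball x \<delta> \<subseteq> S" using S(2) d by force
    note pol = integral_cball_polar[OF continuous_on_translate[OF _ sub]]
    have k: "continuous_on {0..\<delta>} (\<lambda>s. (\<delta>\<^sup>2 - s\<^sup>2) ^ 3)"
      "continuous_on {0..\<delta>} (\<lambda>s. 24 * s\<^sup>2 * (\<delta>\<^sup>2 - s\<^sup>2) - 6 * real DIM('a) * (\<delta>\<^sup>2 - s\<^sup>2)\<^sup>2)"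
      by (intro continuous_intros)+
    have d0: "\<delta> \<ge> 0" "\<delta> > 0" using d by auto
    from integral_bump_laplacian[OF v S(1) sub d0(2)]
    show "integral {0..\<delta>} (\<lambda>s. (\<delta>\<^sup>2 - s\<^sup>2) ^ 3 * s ^ (DIM('a) - 1) * spherical_mean (laplacian v) x s) =
      integral {0..\<delta>} (\<lambda>s. (24 * s\<^sup>2 * (\<delta>\<^sup>2 - s\<^sup>2) - 6 * real DIM('a) * (\<delta>\<^sup>2 - s\<^sup>2)\<^sup>2) * s ^ (DIM('a) - 1) * spherical_mean v x s)"
      using sphere_area_pos[where 'a='a]
      unfolding pol[OF cl k(1) d0(1)] pol[OF cv k(2) d0(1)]
        spherical_mean_translate[of v x] spherical_mean_translate[of "laplacian v" x] by simp
  qed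
  then show ?thesis by (simp add: spherical_mean_0)
qed

text \<open>
  The analogue of \<open>bounded_functional\<close> for functions of the radius. Applied to the spherical means of a function
  around the origin, such a functional becomes a bounded functional on functions on the ball.
\<close>

definition profile_functional :: "real \<Rightarrow> real \<Rightarrow> ((real \<Rightarrow> real) \<Rightarrow> real) \<Rightarrow> bool" where
  "profile_functional R C \<Lambda> \<longleftrightarrow>
    (\<forall>g h a c. continuous_on {0..R} g \<longrightarrow> continuous_on {0..R} h \<longrightarrow>
       \<Lambda> (\<lambda>t. a * g t + c * h t) = a * \<Lambda> g + c * \<Lambda> h) \<and>
    (\<forall>g B. continuous_on {0..R} g \<longrightarrow> (\<forall>t\<in>{0..R}. \<bar>g t\<bar> \<le> B) \<longrightarrow> \<bar>\<Lambda> g\<bar> \<le> C * B)"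

lemma profile_functionalD:
  assumes "profile_functional R C \<Lambda>" "continuous_on {0..R} g"
  shows "continuous_on {0..R} h \<Longrightarrow> \<Lambda> (\<lambda>t. a * g t + c * h t) = a * \<Lambda> g + c * \<Lambda> h"
    and "(\<And>t. t \<in> {0..R} \<Longrightarrow> \<bar>g t\<bar> \<le> B) \<Longrightarrow> \<bar>\<Lambda> g\<bar> \<le> C * B"
  using assms unfolding profile_functional_def by blast+

lemma profile_functional_cong:
  assumes L: "profile_functional R C \<Lambda>" and g: "continuous_on {0..R} g" and eq: "\<And>t. t \<in> {0..R} \<Longrightarrow> g t = h t"
  shows "\<Lambda> g = \<Lambda> h"
proof -
  have h: "continuous_on {0..R} h" using g by (rule continuous_on_eq) (use eq in auto)
  have "\<bar>\<Lambda> (\<lambda>t. 1 * g t + (-1) * h t)\<bar> \<le> C * 0"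
    by (rule profile_functionalD(2)[OF L]) (use g h eq in \<open>auto intro!: continuous_intros\<close>)
  then show ?thesis using profile_functionalD(1)[OF L g h, of 1 "-1"] by simp
qed

lemma profile_functional_lin:
  assumes "profile_functional R C \<Lambda>" "profile_functional R C' \<Lambda>'"
  shows "profile_functional R (\<bar>a\<bar> * C + \<bar>c\<bar> * C') (\<lambda>g. a * \<Lambda> g + c * \<Lambda>' g)"
  unfolding profile_functional_def
proof (intro conjI allI impI)
  fix g h :: "real \<Rightarrow> real" and a' c' assume gh: "continuous_on {0..R} g" "continuous_on {0..R} h"
  show "a * \<Lambda> (\<lambda>t. a' * g t + c' * h t) + c * \<Lambda>' (\<lambda>t. a' * g t + c' * h t) =
    a' * (a * \<Lambda> g + c * \<Lambda>' g) + c' * (a * \<Lambda> h + c * \<Lambda>' h)"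
    using profile_functionalD(1)[OF assms(1) gh, of a' c'] profile_functionalD(1)[OF assms(2) gh, of a' c']
    by (simp add: algebra_simps)
next
  fix g :: "real \<Rightarrow> real" and B assume g: "continuous_on {0..R} g" "\<forall>t\<in>{0..R}. \<bar>g t\<bar> \<le> B"
  have "\<bar>a * \<Lambda> g + c * \<Lambda>' g\<bar> \<le> \<bar>a\<bar> * \<bar>\<Lambda> g\<bar> + \<bar>c\<bar> * \<bar>\<Lambda>' g\<bar>"
    by (metis abs_mult abs_triangle_ineq)
  also have "\<dots> \<le> \<bar>a\<bar> * (C * B) + \<bar>c\<bar> * (C' * B)"
    using profile_functionalD(2)[OF assms(1) g(1), of B] profile_functionalD(2)[OF assms(2) g(1), of B] g(2)
    by (intro add_mono mult_left_mono) auto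
  finally show "\<bar>a * \<Lambda> g + c * \<Lambda>' g\<bar> \<le> (\<bar>a\<bar> * C + \<bar>c\<bar> * C') * B" by (simp add: algebra_simps)
qed

lemma profile_functional_eval_0: "R \<ge> 0 \<Longrightarrow> profile_functional R 1 (\<lambda>g. g 0)"
  unfolding profile_functional_def by auto

lemma profile_functional_integral:
  assumes w: "continuous_on {0..R} w" and R: "R \<ge> 0"
  shows "profile_functional R (integral {0..R} (\<lambda>t. \<bar>w t\<bar>)) (\<lambda>g. integral {0..R} (\<lambda>t. w t * g t))"
  unfolding profile_functional_def
proof (intro conjI allI impI)
  fix g h :: "real \<Rightarrow> real" and a c assume gh: "continuous_on {0..R} g" "continuous_on {0..R} h"
  have i: "(\<lambda>t. w t * g t) integrable_on {0..R}" "(\<lambda>t. w t * h t) integrable_on {0..R}"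
    by (intro integrable_continuous_interval continuous_intros w gh)+
  have "integral {0..R} (\<lambda>t. w t * (a * g t + c * h t)) = integral {0..R} (\<lambda>t. a * (w t * g t) + c * (w t * h t))"
    by (simp add: algebra_simps)
  then show "integral {0..R} (\<lambda>t. w t * (a * g t + c * h t)) = a * integral {0..R} (\<lambda>t. w t * g t) + c * integral {0..R} (\<lambda>t. w t * h t)"
    by (simp only: integral_add[OF integrable_on_mult_right[OF i(1)] integrable_on_mult_right[OF i(2)]] integral_mult_right)
next
  fix g :: "real \<Rightarrow> real" and B assume g: "continuous_on {0..R} g" "\<forall>t\<in>{0..R}. \<bar>g t\<bar> \<le> B"
  have "norm (integral {0..R} (\<lambda>t. w t * g t)) \<le> integral {0..R} (\<lambda>t. \<bar>w t\<bar> * B)"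
    by (rule integral_norm_bound_integral)
       (use g w in \<open>auto intro!: integrable_continuous_interval continuous_intros mult_left_mono simp: abs_mult\<close>)
  then show "\<bar>integral {0..R} (\<lambda>t. w t * g t)\<bar> \<le> integral {0..R} (\<lambda>t. \<bar>w t\<bar>) * B" by simp
qed

lemma profile_functional_potential:
  assumes L: "profile_functional R C \<Lambda>" and R: "R \<ge> 0"
  shows "profile_functional R (C * R\<^sup>2) (\<lambda>g. \<Lambda> (radial_potential n g))"
  unfolding profile_functional_def
proof (intro conjI allI impI)
  fix g h :: "real \<Rightarrow> real" and a c assume gh: "continuous_on {0..R} g" "continuous_on {0..R} h"
  have "\<Lambda> (\<lambda>t. a * radial_potential n g t + c * radial_potential n h t) = \<Lambda> (radial_potential n (\<lambda>t. a * g t + c * h t))"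
    by (rule profile_functional_cong[OF L])
       (use radial_potential_lin[OF gh] radial_potential_continuous[OF gh(1)] radial_potential_continuous[OF gh(2)]
        in \<open>auto intro!: continuous_intros\<close>)
  then show "\<Lambda> (radial_potential n (\<lambda>t. a * g t + c * h t)) = a * \<Lambda> (radial_potential n g) + c * \<Lambda> (radial_potential n h)"
    using profile_functionalD(1)[OF L radial_potential_continuous[OF gh(1)] radial_potential_continuous[OF gh(2)]] by simp
next
  fix g :: "real \<Rightarrow> real" and B assume g: "continuous_on {0..R} g" "\<forall>t\<in>{0..R}. \<bar>g t\<bar> \<le> B"
  have B: "B \<ge> 0" using g(2) R by fastforce
  have "\<bar>\<Lambda> (radial_potential n g)\<bar> \<le> C * (B * R\<^sup>2)"
  proof (rule profile_functionalD(2)[OF L radial_potential_continuous[OF g(1)]])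
    fix t assume t: "t \<in> {0..R}"
    have "\<bar>radial_potential n g t\<bar> \<le> B * t ^ (0 + 2)"
      by (rule radial_potential_bound[OF g(1) t]) (use g(2) B in auto)
    also have "\<dots> \<le> B * R ^ (0 + 2)" using t B by (intro mult_left_mono power_mono) auto
    also have "\<dots> = B * R\<^sup>2" by (simp add: power2_eq_square)
    finally show "\<bar>radial_potential n g t\<bar> \<le> B * R\<^sup>2" .
  qed
  then show "\<bar>\<Lambda> (radial_potential n g)\<bar> \<le> C * R\<^sup>2 * B" by (simp add: mult_ac)
qed

lemma bounded_functional_of_profile:
  assumes L: "profile_functional R C \<Lambda>"
  shows "bounded_functional R C (\<lambda>u::'a::euclidean_space \<Rightarrow> real. \<Lambda> (spherical_mean u 0))"
  unfolding bounded_functional_def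
proof (intro conjI allI impI)
  fix u v :: "'a \<Rightarrow> real" and a c assume uv: "continuous_on (cball 0 R) u" "continuous_on (cball 0 R) v"
  note cu = spherical_mean_continuous[OF uv(1)] and cv = spherical_mean_continuous[OF uv(2)]
  have "\<Lambda> (\<lambda>t. a * spherical_mean u 0 t + c * spherical_mean v 0 t) = \<Lambda> (spherical_mean (\<lambda>z. a * u z + c * v z) 0)"
    by (rule profile_functional_cong[OF L])
       (use spherical_mean_lin[OF uv] cu cv in \<open>auto intro!: continuous_intros\<close>)
  then show "\<Lambda> (spherical_mean (\<lambda>z. a * u z + c * v z) 0) = a * \<Lambda> (spherical_mean u 0) + c * \<Lambda> (spherical_mean v 0)"
    using profile_functionalD(1)[OF L cu cv] by simp
next
  fix u :: "'a \<Rightarrow> real" and B assume u: "continuous_on (cball 0 R) u" "\<forall>z\<in>cball 0 R. \<bar>u z\<bar> \<le> B"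
  show "\<bar>\<Lambda> (spherical_mean u 0)\<bar> \<le> C * B"
    by (rule profile_functionalD(2)[OF L spherical_mean_continuous[OF u(1)]], rule spherical_mean_bound[OF u(1)])
       (use u(2) in auto)
qed

text \<open>
  The conclusion of Green's formula taken as a definition of \<open>\<Delta>U = v\<close>. It mentions no derivative of \<open>U\<close> and is
  therefore stable under uniform limits.
\<close>

definition weak_laplacian :: "'a::euclidean_space set \<Rightarrow> ('a \<Rightarrow> real) \<Rightarrow> ('a \<Rightarrow> real) \<Rightarrow> bool" where
  "weak_laplacian D U v \<longleftrightarrow> (\<forall>x t. t \<ge> 0 \<longrightarrow> cball x t \<subseteq> D \<longrightarrow>
     spherical_mean U x t = U x + radial_potential DIM('a) (spherical_mean v x) t)"

lemma weak_laplacian_of_C2: "open D \<Longrightarrow> Ck_on 2 D U \<Longrightarrow> weak_laplacian D U (laplacian U)"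
  unfolding weak_laplacian_def using spherical_mean_green[of D U] by (metis atLeastAtMost_iff order_refl)

lemma spherical_mean_diff_le_at:
  fixes u :: "'a::euclidean_space \<Rightarrow> real"
  assumes "continuous_on S u" "continuous_on S v" "cball x t \<subseteq> S" "t \<ge> 0" "\<And>z. z \<in> S \<Longrightarrow> \<bar>u z - v z\<bar> \<le> B"
  shows "\<bar>spherical_mean u x t - spherical_mean v x t\<bar> \<le> B"
  unfolding spherical_mean_translate[of u x] spherical_mean_translate[of v x]
proof (rule spherical_mean_diff_le[OF continuous_on_translate[OF assms(1,3)] continuous_on_translate[OF assms(2,3)]])
  fix z :: 'a assume "norm z = t"
  then have "x + z \<in> cball x t" by (simp add: dist_norm)
  then show "\<bar>u (x + z) - v (x + z)\<bar> \<le> B" using assms(3,5) by blast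
qed (use assms(4) in auto)

lemma weak_laplacian_limit:
  fixes U :: "'a::euclidean_space \<Rightarrow> real"
  assumes U: "continuous_on D U" and v: "continuous_on D v"
    and lim: "\<And>\<epsilon>. \<epsilon> > 0 \<Longrightarrow> \<exists>U' v'. weak_laplacian D U' v' \<and> continuous_on D U' \<and> continuous_on D v' \<and>
      (\<forall>x\<in>D. \<bar>U x - U' x\<bar> \<le> \<epsilon>) \<and> (\<forall>x\<in>D. \<bar>v x - v' x\<bar> \<le> \<epsilon>)"
  shows "weak_laplacian D U v"
  unfolding weak_laplacian_def
proof (intro allI impI)
  fix x t assume t: "(t::real) \<ge> 0" and sub: "cball x t \<subseteq> D"
  let ?P = "radial_potential DIM('a)"
  have x: "x \<in> D" using t sub by auto
  have est: "\<bar>spherical_mean U x t - (U x + ?P (spherical_mean v x) t)\<bar> \<le> (2 + t\<^sup>2) * \<epsilon>" if e: "\<epsilon> > 0" for \<epsilon>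
  proof -
    obtain U' v' where *: "weak_laplacian D U' v'" "continuous_on D U'" "continuous_on D v'"
      "\<And>x. x \<in> D \<Longrightarrow> \<bar>U x - U' x\<bar> \<le> \<epsilon>" "\<And>x. x \<in> D \<Longrightarrow> \<bar>v x - v' x\<bar> \<le> \<epsilon>"
      using lim[OF e] by blast
    have 1: "spherical_mean U' x t = U' x + ?P (spherical_mean v' x) t"
      using *(1) t sub unfolding weak_laplacian_def by blast
    have 2: "\<bar>spherical_mean U x t - spherical_mean U' x t\<bar> \<le> \<epsilon>"
      by (rule spherical_mean_diff_le_at[OF U *(2) sub t *(4)])
    have 3: "\<bar>U x - U' x\<bar> \<le> \<epsilon>" using *(4) x .
    have cv: "continuous_on {0..t} (spherical_mean v x)" "continuous_on {0..t} (spherical_mean v' x)"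
      using spherical_mean_continuous_radius[OF v sub] spherical_mean_continuous_radius[OF *(3) sub] .
    have tt: "t \<in> {0..t}" using t by simp
    have "\<bar>?P (\<lambda>s. 1 * spherical_mean v x s + (-1) * spherical_mean v' x s) t\<bar> \<le> \<epsilon> * t ^ (0 + 2)"
    proof (rule radial_potential_bound[OF _ tt])
      show "continuous_on {0..t} (\<lambda>s. 1 * spherical_mean v x s + (-1) * spherical_mean v' x s)"
        using cv by (intro continuous_intros)
      fix s assume s: "s \<in> {0..t}"
      have "cball x s \<subseteq> D" using s sub by force
      then have "\<bar>spherical_mean v x s - spherical_mean v' x s\<bar> \<le> \<epsilon>"
        by (rule spherical_mean_diff_le_at[OF v *(3)]) (use s *(5) in auto)
      then show "\<bar>1 * spherical_mean v x s + (-1) * spherical_mean v' x s\<bar> \<le> \<epsilon> * s ^ 0" by simp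
    qed (use e in simp)
    then have "\<bar>?P (spherical_mean v x) t - ?P (spherical_mean v' x) t\<bar> \<le> \<epsilon> * t\<^sup>2"
      using radial_potential_lin[OF cv tt, of "DIM('a)" 1 "-1"] by (simp add: power2_eq_square)
    then show ?thesis using 1 2 3 by (simp add: algebra_simps abs_le_iff)
  qed
  show "spherical_mean U x t = U x + ?P (spherical_mean v x) t"
  proof (rule ccontr)
    assume ne: "\<not> ?thesis"
    define c where "c = \<bar>spherical_mean U x t - (U x + ?P (spherical_mean v x) t)\<bar>"
    have c: "c > 0" using ne unfolding c_def by simp
    have t2: "2 + t\<^sup>2 > 0" using zero_le_power2[of t] by linarith
    define e where "e = c / (2 * (2 + t\<^sup>2))"
    have "e > 0" unfolding e_def using c t2 by simp
    from est[OF this] have "c \<le> (2 + t\<^sup>2) * e" unfolding c_def .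
    also have "\<dots> = c / 2" unfolding e_def using t2 by (simp add: field_simps)
    finally show False using c by simp
  qed
qed

section \<open>Regularity of weak solutions\<close>

lemma has_partial_shift: "has_partial b (\<lambda>z. g (x + z)) z d \<longleftrightarrow> has_partial b g (x + z) d"
  unfolding has_partial_def by (simp add: add.assoc)

lemma Ck_on_translate:
  fixes g :: "'a::euclidean_space \<Rightarrow> real"
  assumes "open S" "Ck_on k S g"
  shows "Ck_on k {z. x + z \<in> S} (\<lambda>z. g (x + z))"
  using assms(2)
proof (induction k arbitrary: g)
  have tr: "continuous_on {z. x + z \<in> S} (\<lambda>z. g (x + z))" if "continuous_on S g" for g :: "'a \<Rightarrow> real"
    by (rule continuous_on_compose2[OF that]) (auto intro!: continuous_intros)
  {
    case 0
    then show ?case using tr by simp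
  next
    case (Suc k)
    show ?case
    proof (rule Ck_on_SucI[where g = "\<lambda>b z. partial b g (x + z)"])
      have "open ((\<lambda>z. x + z) -` S)" by (intro open_vimage assms continuous_intros)
      then show "open {z. x + z \<in> S}" by (simp add: vimage_def)
    qed (use Suc tr in \<open>auto simp: has_partial_shift intro: has_partialI\<close>)
  }
qed

lemma integral_lborel_reflect:
  fixes f :: "'a::euclidean_space \<Rightarrow> real"
  assumes [measurable]: "f \<in> borel_measurable borel"
  shows "(LINT z|lborel. f (- z)) = (LINT z|lborel. f z)"
proof -
  have "(lborel :: 'a measure) = distr lborel borel uminus"
    using lborel_affine[of "-1" "0::'a"] by (simp add: density_1)
  then have "(LINT z|lborel. f z) = (LINT z|distr lborel borel uminus. f z)" by simp
  also have "\<dots> = (LINT z|lborel. f (- z))" by (subst integral_distr) auto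
  finally show ?thesis ..
qed

text \<open>
  Near \<open>x0\<close> the average is a fixed functional, given by the values of \<open>U\<close> on a larger ball, applied to the translates
  of the bump; the derivatives fall on the bump.
\<close>

lemma bump_convolution_Ck_on:
  fixes U :: "'a::euclidean_space \<Rightarrow> real"
  assumes U: "continuous_on (cball x0 (2 * \<delta>)) U" and d: "\<delta> > 0"
  shows "Ck_on N (ball x0 \<delta>) (\<lambda>x. LINT z:cball 0 \<delta>|lborel. bump \<delta> (N + 1) z * U (x + z))"
proof -
  let ?q = "bump \<delta> (N + 1) :: 'a \<Rightarrow> real"
  define L where "L u = (LINT z:cball 0 (2 * \<delta>)|lborel. U (x0 - z) * u z)" for u
  have cU: "continuous_on (cball 0 (2 * \<delta>)) (\<lambda>z. U (x0 - z))"
    by (rule continuous_on_compose2[OF U]) (auto intro!: continuous_intros simp: dist_norm)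
  have L: "bounded_functional (2 * \<delta>) (LINT z:cball 0 (2 * \<delta>)|lborel. \<bar>U (x0 - z)\<bar>) L"
    unfolding L_def by (rule bounded_functional_integral[OF cU])
  have "Ck_on N UNIV (\<lambda>y. ?q (- x0 + y))"
    using Ck_on_translate[OF open_UNIV Ck_on_bump[of N \<delta>], of "- x0"] by simp
  then have "Ck_on N UNIV (\<lambda>x. L (\<lambda>z. ?q (- x0 + (x + z))))"
    using bounded_functional_Ck_on[OF L _ open_UNIV, of N "\<lambda>y. ?q (- x0 + y)"] d by simp
  then have C: "Ck_on N (ball x0 \<delta>) (\<lambda>x. L (\<lambda>z. ?q (- x0 + (x + z))))"
    by (rule Ck_on_subset) simp
  have eq: "(LINT z:cball 0 \<delta>|lborel. ?q z * U (x + z)) = L (\<lambda>z. ?q (- x0 + (x + z)))" if x: "x \<in> ball x0 \<delta>" for x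
  proof -
    define H where "H y = indicator (cball x \<delta>) y *\<^sub>R (?q (y - x) * U y)" for y
    have sub: "cball x \<delta> \<subseteq> cball x0 (2 * \<delta>)"
    proof
      fix y assume "y \<in> cball x \<delta>"
      then show "y \<in> cball x0 (2 * \<delta>)" using x dist_triangle[of x0 y x] by auto
    qed
    have "continuous_on (cball x \<delta>) (\<lambda>y. ?q (y - x) * U y)"
      by (intro continuous_intros continuous_on_subset[OF U sub] continuous_on_compose2[OF continuous_on_bump[of UNIV]]) auto
    then have Hm [measurable]: "H \<in> borel_measurable borel"
      unfolding H_def by (intro borel_measurable_continuous_on_indicator) auto
    have "(LINT z:cball 0 \<delta>|lborel. ?q z * U (x + z)) = (LINT z|lborel. H (x + z))"
      unfolding set_lebesgue_integral_def H_def
      by (rule Bochner_Integration.integral_cong) (auto simp: indicator_def dist_norm)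
    also have "\<dots> = (LINT z|lborel. H (x0 + z))"
      using integral_translation_lborel[OF Hm] by simp
    also have "\<dots> = (LINT z|lborel. H (x0 - z))"
      using integral_lborel_reflect[of "\<lambda>z. H (x0 + z)"] by simp
    also have "\<dots> = L (\<lambda>z. ?q (- x0 + (x + z)))"
      unfolding L_def set_lebesgue_integral_def
    proof (rule Bochner_Integration.integral_cong)
      fix z :: 'a
      have sym: "?q (x0 - z - x) = ?q (- x0 + (x + z))"
        using bump_uminus[of \<delta> "N + 1" "x0 - z - x"] by (simp add: algebra_simps)
      show "H (x0 - z) = indicator (cball 0 (2 * \<delta>)) z *\<^sub>R (U (x0 - z) * ?q (- x0 + (x + z)))"
      proof (cases "x0 - z \<in> cball x \<delta>")
        case True
        then have "x0 - z \<in> cball x0 (2 * \<delta>)" using sub by blast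
        then have "z \<in> cball 0 (2 * \<delta>)" by (simp add: dist_norm)
        then show ?thesis using True sym by (simp add: H_def mult.commute)
      next
        case False
        then have "norm (x0 - z - x) \<ge> \<delta>" by (simp add: dist_norm norm_minus_commute)
        then have "?q (x0 - z - x) = 0" using d by (intro bump_eq_0) auto
        then show ?thesis using False sym by (simp add: H_def)
      qed
    qed simp
    finally show ?thesis .
  qed
  show ?thesis
    using C by (rule Ck_on_cong[OF open_ball, THEN iffD1, rotated]) (use eq in auto)
qed

lemma integral_radial_bump_pos:
  fixes \<delta> :: real
  assumes d: "\<delta> > 0"
  shows "integral {0..\<delta>} (\<lambda>s. (\<delta>\<^sup>2 - s\<^sup>2) ^ N * s ^ m) > 0"
proof -
  let ?f = "\<lambda>s. (\<delta>\<^sup>2 - s\<^sup>2) ^ N * s ^ m"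
  have c: "continuous_on {0..\<delta>} ?f" by (intro continuous_intros)
  have nn: "?f s \<ge> 0" if "s \<in> {0..\<delta>}" for s using that by (auto intro!: mult_nonneg_nonneg power_mono)
  have "integral {0..\<delta>} ?f \<noteq> 0"
  proof
    assume "integral {0..\<delta>} ?f = 0"
    then have "\<forall>s\<in>{0..\<delta>}. ?f s = 0"
      using integral_eq_0_iff[OF c d nn] by blast
    moreover have "\<delta> / 2 \<in> {0..\<delta>}" using d by simp
    ultimately have "?f (\<delta> / 2) = 0" by blast
    moreover have "(\<delta> / 2)\<^sup>2 < \<delta>\<^sup>2" using d by (intro power_strict_mono) auto
    ultimately show False using d by auto
  qed
  moreover have "integral {0..\<delta>} ?f \<ge> 0" by (rule integral_nonneg) (use c nn in \<open>auto intro: integrable_continuous_interval\<close>)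
  ultimately show ?thesis by linarith
qed

text \<open>
  Averaging the weak equation over the radii up to \<open>\<delta>\<close> with a bump as weight expresses \<open>U\<close> as its convolution with
  the bump minus a bounded functional of the translates of \<open>v\<close>. The first is as smooth as the
  bump, the second as smooth as \<open>v\<close>.
\<close>

lemma weak_laplacian_regularity:
  fixes U :: "'a::euclidean_space \<Rightarrow> real"
  assumes D: "open D" and U: "continuous_on D U" and v: "Ck_on k D v" and w: "weak_laplacian D U v"
  shows "Ck_on k D U"
proof (rule Ck_on_local[OF D])
  fix x0 assume "x0 \<in> D"
  then obtain e where e: "e > 0" "cball x0 e \<subseteq> D" using D open_contains_cball by blast
  define \<delta> where "\<delta> = e / 2"
  have d: "\<delta> > 0" "cball x0 (2 * \<delta>) \<subseteq> D" using e unfolding \<delta>_def by auto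
  let ?n = "DIM('a)"
  let ?A = "sphere_area TYPE('a)"
  let ?k = "\<lambda>s. (\<delta>\<^sup>2 - s\<^sup>2) ^ (k + 1) :: real"
  define c where "c = integral {0..\<delta>} (\<lambda>s. ?k s * s ^ (?n - 1))"
  have c: "c > 0" unfolding c_def by (rule integral_radial_bump_pos[OF d(1)])
  define \<Lambda> where "\<Lambda> g = integral {0..\<delta>} (\<lambda>s. (?k s * s ^ (?n - 1)) * g s)" for g
  have L1: "profile_functional \<delta> (integral {0..\<delta>} (\<lambda>t. \<bar>?k t * t ^ (?n - 1)\<bar>)) \<Lambda>"
    unfolding \<Lambda>_def by (rule profile_functional_integral) (use d in \<open>auto intro!: continuous_intros\<close>)
  have d0: "\<delta> \<ge> 0" using d by simp
  note L2 = bounded_functional_of_profile[OF profile_functional_potential[OF L1 d0, of ?n], where 'a = 'a]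
  let ?S = "{x. cball x \<delta> \<subseteq> D}"
  have sub: "ball x0 \<delta> \<subseteq> ?S"
  proof
    fix x assume "x \<in> ball x0 \<delta>"
    then have "cball x \<delta> \<subseteq> cball x0 (2 * \<delta>)"
      using cball_translate_subset[of x0 x \<delta> \<delta> "cball x0 (2 * \<delta>)"] by auto
    then show "x \<in> ?S" using d(2) by blast
  qed
  have C2: "Ck_on k (ball x0 \<delta>) (\<lambda>x. \<Lambda> (radial_potential ?n (spherical_mean (\<lambda>z. v (x + z)) 0)))"
    using bounded_functional_Ck_on[OF L2 d0 D v] sub by (rule Ck_on_subset)
  have C1: "Ck_on k (ball x0 \<delta>) (\<lambda>x. LINT z:cball 0 \<delta>|lborel. bump \<delta> (k + 1) z * U (x + z))"
    by (rule bump_convolution_Ck_on[OF continuous_on_subset[OF U d(2)] d(1)])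
  have C: "Ck_on k (ball x0 \<delta>) (\<lambda>x. (1 / (c * ?A)) * (LINT z:cball 0 \<delta>|lborel. bump \<delta> (k + 1) z * U (x + z))
      + (- 1 / c) * \<Lambda> (radial_potential ?n (spherical_mean (\<lambda>z. v (x + z)) 0)))"
    by (rule Ck_on_lin[OF open_ball C1 C2])
  have "U x = (1 / (c * ?A)) * (LINT z:cball 0 \<delta>|lborel. bump \<delta> (k + 1) z * U (x + z))
      + (- 1 / c) * \<Lambda> (radial_potential ?n (spherical_mean (\<lambda>z. v (x + z)) 0))" if x: "x \<in> ball x0 \<delta>" for x
  proof -
    have xD: "cball x \<delta> \<subseteq> D" using sub x by blast
    let ?P = "radial_potential ?n (spherical_mean v x)"
    have cP: "continuous_on {0..\<delta>} ?P"
      by (intro radial_potential_continuous spherical_mean_continuous_radius[OF Ck_on_imp_continuous[OF v] xD])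
    have "(LINT z:cball 0 \<delta>|lborel. bump \<delta> (k + 1) z * U (x + z)) = (LINT z:cball 0 \<delta>|lborel. ?k (norm z) * U (x + z))"
      by (rule set_lebesgue_integral_cong) (auto simp: bump_eq)
    also have "\<dots> = ?A * integral {0..\<delta>} (\<lambda>s. ?k s * s ^ (?n - 1) * spherical_mean (\<lambda>z. U (x + z)) 0 s)"
      by (rule integral_cball_polar[OF continuous_on_translate[OF U xD] _ d0]) (intro continuous_intros)
    also have "integral {0..\<delta>} (\<lambda>s. ?k s * s ^ (?n - 1) * spherical_mean (\<lambda>z. U (x + z)) 0 s) = \<Lambda> (spherical_mean U x)"
      unfolding \<Lambda>_def spherical_mean_translate[of U x, symmetric] ..
    also have "\<Lambda> (spherical_mean U x) = \<Lambda> (\<lambda>s. U x * 1 + 1 * ?P s)"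
    proof (rule profile_functional_cong[OF L1 spherical_mean_continuous_radius[OF U xD]])
      fix t assume t: "t \<in> {0..\<delta>}"
      then have "cball x t \<subseteq> D" using xD by force
      then show "spherical_mean U x t = U x * 1 + 1 * ?P t" using w t unfolding weak_laplacian_def by auto
    qed
    also have "\<dots> = U x * \<Lambda> (\<lambda>_. 1) + 1 * \<Lambda> ?P"
      by (rule profile_functionalD(1)[OF L1 continuous_on_const cP])
    also have "\<Lambda> (\<lambda>_. 1) = c" unfolding \<Lambda>_def c_def by simp
    finally have e1: "(LINT z:cball 0 \<delta>|lborel. bump \<delta> (k + 1) z * U (x + z)) = ?A * (U x * c + \<Lambda> ?P)" by simp
    have "?P = radial_potential ?n (spherical_mean (\<lambda>z. v (x + z)) 0)"
      using spherical_mean_translate[of v x] by presburger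
    then show ?thesis unfolding e1 using c sphere_area_pos[where 'a='a] by (simp add: field_simps)
  qed
  then have "Ck_on k (ball x0 \<delta>) U"
    using Ck_on_cong[OF open_ball, THEN iffD2, OF _ C] by blast
  then show "\<exists>S. open S \<and> x0 \<in> S \<and> Ck_on k S U" using d(1) by (intro exI[of _ "ball x0 \<delta>"]) auto
qed

lemma radial_potential_mono:
  assumes "continuous_on {0..R} g" "continuous_on {0..R} h" "t \<in> {0..R}" "\<And>s. s \<in> {0..R} \<Longrightarrow> g s \<le> h s"
  shows "radial_potential n g t \<le> radial_potential n h t"
  unfolding radial_potential_def
proof (rule integral_le)
  fix s assume s: "s \<in> {0..t}"
  have "radial_moment (n - 1) g s \<le> radial_moment (n - 1) h s"
    unfolding radial_moment_def
    by (rule integral_le)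
       (use s assms radial_moment_integrable[OF assms(1)] radial_moment_integrable[OF assms(2)]
        in \<open>auto intro!: mult_left_mono\<close>)
  then show "radial_moment (n - 1) g s / s ^ (n - 1) \<le> radial_moment (n - 1) h s / s ^ (n - 1)"
    using s by (auto intro: divide_right_mono)
qed (use assms in \<open>auto intro!: integrable_continuous_interval
        continuous_on_subset[OF radial_potential_integrand_continuous[OF assms(1)]]
        continuous_on_subset[OF radial_potential_integrand_continuous[OF assms(2)]]\<close>)

text \<open>
  If \<open>v x > v' x\<close>, the spherical means of \<open>v\<close> around \<open>x\<close> exceed those of \<open>v'\<close> by a fixed amount for all small
  radii, and so do their potentials, while both potentials are equal to \<open>S\<^sub>t U - U\<close>.
\<close>

lemma weak_laplacian_unique_le:
  fixes U :: "'a::euclidean_space \<Rightarrow> real"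
  assumes D: "open D" and c: "continuous_on D v" "continuous_on D v'"
    and w: "weak_laplacian D U v" "weak_laplacian D U v'" and x: "x \<in> D"
  shows "v x \<le> v' x"
proof (rule ccontr)
  assume "\<not> ?thesis"
  then have gt: "v x > v' x" by simp
  define a where "a = v x - v' x"
  have a: "a > 0" using gt unfolding a_def by simp
  obtain e where e: "e > 0" "cball x e \<subseteq> D" using D x open_contains_cball by blast
  define g h where "g = spherical_mean v x" and "h = spherical_mean v' x"
  have cg: "continuous_on {0..e} g" "continuous_on {0..e} h"
    unfolding g_def h_def using spherical_mean_continuous_radius e(2) c by blast+
  have "continuous_on {0..e} (\<lambda>s. g s - h s)" using cg by (intro continuous_intros)
  then obtain r where r: "r > 0" "\<And>s. s \<in> {0..e} \<Longrightarrow> dist s 0 < r \<Longrightarrow> dist (g s - h s) (g 0 - h 0) < a / 2"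
    using e(1) a unfolding continuous_on_iff by (metis atLeastAtMost_iff half_gt_zero less_eq_real_def)
  define t where "t = min e (r / 2)"
  have t: "t > 0" "t \<le> e" "t < r" using e(1) r(1) unfolding t_def by auto
  have gh: "h s + a / 2 \<le> g s" if "s \<in> {0..t}" for s
  proof -
    have "dist (g s - h s) (g 0 - h 0) < a / 2" using that t by (intro r(2)) auto
    moreover have "g 0 - h 0 = a" unfolding g_def h_def a_def by (simp add: spherical_mean_0)
    ultimately show ?thesis by (simp add: dist_real_def abs_less_iff) argo
  qed
  have cg': "continuous_on {0..t} g" "continuous_on {0..t} h"
    using cg t(2) by (auto intro: continuous_on_subset)
  have tt: "t \<in> {0..t}" using t by auto
  let ?P = "radial_potential DIM('a)"
  have sub: "cball x t \<subseteq> D" using e(2) t(2) by force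
  have "?P (\<lambda>s. 1 * h s + 1 * (a / 2)) t \<le> ?P g t"
    by (rule radial_potential_mono[OF _ cg'(1) tt]) (use gh cg' in \<open>auto intro!: continuous_intros\<close>)
  moreover have "?P (\<lambda>s. 1 * h s + 1 * (a / 2)) t = ?P h t + ?P (\<lambda>_. a / 2) t"
    using radial_potential_lin[OF cg'(2) continuous_on_const tt, of "DIM('a)" 1 1 "a / 2"] by simp
  moreover have "?P (\<lambda>_. a / 2) t > 0" using radial_potential_const[of "DIM('a)" t "a / 2"] a t by simp
  moreover have "?P g t = ?P h t"
    using w sub t(1) unfolding weak_laplacian_def g_def h_def by (metis add_left_cancel less_imp_le)
  ultimately show False by linarith
qed

lemma weak_laplacian_classical:
  fixes U :: "'a::euclidean_space \<Rightarrow> real"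
  assumes D: "open D" and U: "Ck_on 2 D U" and v: "continuous_on D v"
    and w: "weak_laplacian D U v" and x: "x \<in> D"
  shows "laplacian U x = v x"
proof -
  have c: "continuous_on D (laplacian U)"
    using continuous_on_laplacian[OF D] U by blast
  show ?thesis
    using weak_laplacian_unique_le[OF D c v weak_laplacian_of_C2[OF D U] w x]
      weak_laplacian_unique_le[OF D v c w weak_laplacian_of_C2[OF D U] x] by simp
qed

section \<open>Radial kernels and their defects\<close>

locale radial_kernel =
  fixes R :: real and n :: nat and k :: "real \<Rightarrow> real"
  assumes R: "R > 0" and n: "n > 0"
    and k_continuous: "continuous_on {0..R} k"
    and k_nonneg: "\<And>s. s \<in> {0..R} \<Longrightarrow> k s \<ge> 0"
    and k_mass: "integral {0..R} (\<lambda>s. k s * s ^ (n - 1)) > 0"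
begin

definition kmean :: "(real \<Rightarrow> real) \<Rightarrow> real" where
  "kmean g = integral {0..R} (\<lambda>s. k s * s ^ (n - 1) * g s) / integral {0..R} (\<lambda>s. k s * s ^ (n - 1))"

text \<open>
  The defect of order \<open>0\<close> compares the value at the centre with the average. Composition with the potential
  passes from \<open>w\<close> to \<open>\<Delta>w\<close>; the subtracted multiple of the average restores the property that constants are
  annihilated, which makes the next passage possible and gives the gain in \<open>defect_bound\<close>.
\<close>

primrec defect :: "nat \<Rightarrow> (real \<Rightarrow> real) \<Rightarrow> real" where
  "defect 0 g = g 0 - kmean g"
| "defect (Suc j) g = defect j (radial_potential n g) - defect j (radial_potential n (\<lambda>_. 1)) * kmean g"

lemma weight_continuous: "continuous_on {0..R} (\<lambda>s. k s * s ^ (n - 1))"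
  by (intro continuous_intros k_continuous)

lemma kmean_functional: "profile_functional R 1 kmean"
proof -
  let ?w = "\<lambda>s. k s * s ^ (n - 1)"
  have R0: "R \<ge> 0" using R by simp
  have F: "profile_functional R (integral {0..R} (\<lambda>t. \<bar>?w t\<bar>)) (\<lambda>g. integral {0..R} (\<lambda>t. ?w t * g t))"
    by (rule profile_functional_integral[OF weight_continuous R0])
  have "integral {0..R} (\<lambda>t. \<bar>?w t\<bar>) = integral {0..R} ?w"
    by (rule integral_cong) (use k_nonneg in \<open>auto simp: abs_mult\<close>)
  then show ?thesis
    using profile_functional_lin[OF F F, of "1 / integral {0..R} ?w" 0] k_mass
    unfolding kmean_def[abs_def] by (simp add: abs_divide)
qed

lemma kmean_const: "kmean (\<lambda>_. c) = c"
  unfolding kmean_def using k_mass by simp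

lemma kmean_bound:
  assumes g: "continuous_on {0..R} g" and B: "\<And>t. t \<in> {0..R} \<Longrightarrow> \<bar>g t\<bar> \<le> M * h t" and h: "continuous_on {0..R} h"
  shows "\<bar>kmean g\<bar> \<le> M * kmean h"
proof -
  let ?w = "\<lambda>s. k s * s ^ (n - 1)"
  have "norm (integral {0..R} (\<lambda>s. ?w s * g s)) \<le> integral {0..R} (\<lambda>s. M * (?w s * h s))"
  proof (rule integral_norm_bound_integral)
    show "(\<lambda>s. ?w s * g s) integrable_on {0..R}" "(\<lambda>s. M * (?w s * h s)) integrable_on {0..R}"
      by (intro integrable_continuous_interval continuous_intros k_continuous g h)+
    fix s assume s: "s \<in> {0..R}"
    have "?w s * \<bar>g s\<bar> \<le> ?w s * (M * h s)" using s k_nonneg by (intro mult_left_mono B) auto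
    then show "norm (?w s * g s) \<le> M * (?w s * h s)" using s k_nonneg by (simp add: abs_mult mult_ac)
  qed
  then have "\<bar>integral {0..R} (\<lambda>s. ?w s * g s)\<bar> \<le> M * integral {0..R} (\<lambda>s. ?w s * h s)" by simp
  then show ?thesis unfolding kmean_def using k_mass by (simp add: abs_divide divide_right_mono)
qed

lemma defect_functional: "\<exists>C. profile_functional R C (defect j)"
proof (induction j)
  case 0
  have "profile_functional R (\<bar>1\<bar> * 1 + \<bar>-1\<bar> * 1) (\<lambda>g. 1 * g 0 + (-1) * kmean g)"
    by (rule profile_functional_lin[OF profile_functional_eval_0 kmean_functional]) (use R in simp)
  then show ?case by (auto simp: fun_eq_iff intro!: exI)
next
  case (Suc j)
  then obtain C where C: "profile_functional R C (defect j)" by blast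
  let ?a = "defect j (radial_potential n (\<lambda>_. 1))"
  have "profile_functional R (\<bar>1\<bar> * (C * R\<^sup>2) + \<bar>- ?a\<bar> * 1) (\<lambda>g. 1 * defect j (radial_potential n g) + (- ?a) * kmean g)"
    by (rule profile_functional_lin[OF profile_functional_potential[OF C] kmean_functional]) (use R in simp)
  then show ?case by (auto intro!: exI)
qed

lemma defect_const: "defect j (\<lambda>_. c) = 0"
proof (cases j)
  case 0
  then show ?thesis by (simp add: kmean_const)
next
  case (Suc i)
  obtain C where C: "profile_functional R C (defect i)" using defect_functional by blast
  let ?P = "radial_potential n (\<lambda>_. 1)"
  have cP: "continuous_on {0..R} ?P" by (intro radial_potential_continuous continuous_on_const)
  have "defect i (\<lambda>t. c * ?P t + 0 * ?P t) = defect i (radial_potential n (\<lambda>_. c))"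
    by (rule profile_functional_cong[OF C])
       (use cP n in \<open>auto intro!: continuous_intros simp: radial_potential_const\<close>)
  then show ?thesis using Suc profile_functionalD(1)[OF C cP cP, of c 0] by (simp add: kmean_const)
qed

text \<open>
  Constants are annihilated, so only the potential of \<open>h\<close> contributes; by definition its defect of order \<open>j\<close> is
  the defect of order \<open>j + 1\<close> of \<open>h\<close> plus a multiple of the average of \<open>h\<close>.
\<close>

lemma defect_expand:
  assumes h: "continuous_on {0..R} h" and f: "\<And>t. t \<in> {0..R} \<Longrightarrow> f t = c + radial_potential n h t"
  shows "defect j f = defect j (radial_potential n h)"
    and "defect j f = defect (Suc j) h + defect j (radial_potential n (\<lambda>_. 1)) * kmean h"
proof -
  obtain C where C: "profile_functional R C (defect j)" using defect_functional by blast
  have cP: "continuous_on {0..R} (radial_potential n h)" by (rule radial_potential_continuous[OF h])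
  have "defect j (\<lambda>t. c * 1 + 1 * radial_potential n h t) = defect j f"
    by (rule profile_functional_cong[OF C]) (use cP f in \<open>auto intro!: continuous_intros\<close>)
  then show "defect j f = defect j (radial_potential n h)"
    using profile_functionalD(1)[OF C continuous_on_const cP, of c 1 1] defect_const by simp
  then show "defect j f = defect (Suc j) h + defect j (radial_potential n (\<lambda>_. 1)) * kmean h" by simp
qed

text \<open>
  Here \<open>\<theta>\<close> stands for the square of the concentration radius of the kernel. A bound by \<open>t\<^bsup>2i\<^esup>\<close> is worth \<open>\<theta>\<^sup>i\<close> under the
  average, and each step of the recursion turns \<open>t\<^bsup>2i\<^esup>\<close> into \<open>t\<^bsup>2i+2\<^esup>\<close> or multiplies by a coefficient that
  has the corresponding size itself.
\<close>

lemma defect_bound: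
  assumes moments: "\<And>i. i \<le> J \<Longrightarrow> kmean (\<lambda>t. t ^ (2 * i)) \<le> A * \<theta> ^ i" and A: "A \<ge> 0" and \<theta>: "\<theta> \<ge> 0"
    and g: "continuous_on {0..R} g" and M: "M \<ge> 0" "\<And>t. t \<in> {0..R} \<Longrightarrow> \<bar>g t\<bar> \<le> M * t ^ (2 * i)"
    and ij: "i + j \<le> J"
  shows "\<bar>defect j g\<bar> \<le> (1 + A) ^ (j + 1) * M * \<theta> ^ (i + j)"
  using g M ij
proof (induction j arbitrary: g M i)
  case (0 g M i)
  have "\<bar>kmean g\<bar> \<le> M * kmean (\<lambda>t. t ^ (2 * i))"
    by (rule kmean_bound) (use 0 in \<open>auto intro!: continuous_intros\<close>)
  also have "\<dots> \<le> M * (A * \<theta> ^ i)" using 0 by (intro mult_left_mono moments) auto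
  finally have K: "\<bar>kmean g\<bar> \<le> M * (A * \<theta> ^ i)" .
  have "\<bar>g 0\<bar> \<le> M * 0 ^ (2 * i)" using 0(3)[of 0] R by simp
  also have "\<dots> \<le> M * \<theta> ^ i" using 0(2) \<theta> by (cases i) auto
  finally show ?case using K by (simp add: algebra_simps)
next
  case (Suc j g M i)
  have cP: "continuous_on {0..R} (radial_potential n g)" by (rule radial_potential_continuous[OF Suc.prems(1)])
  have "\<bar>radial_potential n g t\<bar> \<le> M * t ^ (2 * Suc i)" if "t \<in> {0..R}" for t
    using radial_potential_bound[OF Suc.prems(1) that Suc.prems(3,2), of n] by simp
  then have 1: "\<bar>defect j (radial_potential n g)\<bar> \<le> (1 + A) ^ (j + 1) * M * \<theta> ^ (Suc i + j)"
    by (intro Suc.IH cP) (use Suc.prems in auto)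
  have "\<bar>radial_potential n (\<lambda>_. 1) t\<bar> \<le> 1 * t ^ (2 * 1)" if "t \<in> {0..R}" for t
    using radial_potential_bound[OF continuous_on_const[of _ "1::real"] that, of 1 0 n] by (simp add: power2_eq_square)
  then have 2: "\<bar>defect j (radial_potential n (\<lambda>_. 1))\<bar> \<le> (1 + A) ^ (j + 1) * 1 * \<theta> ^ (1 + j)"
    by (intro Suc.IH radial_potential_continuous continuous_on_const) (use Suc.prems in auto)
  have "\<bar>kmean g\<bar> \<le> M * kmean (\<lambda>t. t ^ (2 * i))"
    by (rule kmean_bound) (use Suc.prems in \<open>auto intro!: continuous_intros\<close>)
  also have "\<dots> \<le> M * (A * \<theta> ^ i)" using Suc.prems by (intro mult_left_mono moments) auto
  finally have 3: "\<bar>kmean g\<bar> \<le> M * (A * \<theta> ^ i)" .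
  have "\<bar>defect (Suc j) g\<bar> \<le> \<bar>defect j (radial_potential n g)\<bar> + \<bar>defect j (radial_potential n (\<lambda>_. 1))\<bar> * \<bar>kmean g\<bar>"
    by (simp only: defect.simps abs_mult[symmetric])
  also have "\<dots> \<le> (1 + A) ^ (j + 1) * M * \<theta> ^ (Suc i + j) + ((1 + A) ^ (j + 1) * 1 * \<theta> ^ (1 + j)) * (M * (A * \<theta> ^ i))"
    by (intro add_mono 1 mult_mono 2 3) (use A \<theta> in auto)
  also have "\<dots> = (1 + A) ^ (Suc j + 1) * M * \<theta> ^ (i + Suc j)"
    by (simp add: algebra_simps power_add)
  finally show ?case .
qed

end

text \<open>
  The Dirichlet kernel \<open>sin ((2M + 1) x) / sin x\<close> as a polynomial in \<open>sin\<^sup>2 x\<close>. The recursion is the addition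
  theorem for \<open>sin ((2M + 3) x) + sin ((2M - 1) x)\<close>.
\<close>

fun dirichlet_poly :: "nat \<Rightarrow> real poly" where
  "dirichlet_poly 0 = 1"
| "dirichlet_poly (Suc 0) = [:3, -4:]"
| "dirichlet_poly (Suc (Suc M)) = [:2, -4:] * dirichlet_poly (Suc M) - dirichlet_poly M"

lemma degree_dirichlet_poly: "degree (dirichlet_poly M) \<le> M"
proof (induction M rule: dirichlet_poly.induct)
  case (3 M)
  have "degree ([:2, -4:] * dirichlet_poly (Suc M)) \<le> 1 + Suc M"
    using degree_mult_le[of "[:2, -4::real:]" "dirichlet_poly (Suc M)"] 3(1) by simp
  then show ?case using 3(2) by (auto intro: degree_diff_le)
qed auto

lemma dirichlet_poly_sin: "poly (dirichlet_poly M) ((sin x)\<^sup>2) * sin x = sin (real (2 * M + 1) * x)"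
proof (induction M rule: dirichlet_poly.induct)
  case 1 then show ?case by simp
next
  case 2
  have "sin (3 * x) = sin (x + 2 * x)" by (simp add: algebra_simps)
  also have "\<dots> = (3 - 4 * (sin x)\<^sup>2) * sin x"
    unfolding sin_add sin_double cos_double by (simp add: algebra_simps power2_eq_square cos_squared_eq)
       (use sin_cos_squared_add[of x] in algebra)
  finally show ?case by (simp add: mult.commute)
next
  case (3 M)
  have "sin (real (2 * Suc (Suc M) + 1) * x) + sin (real (2 * M + 1) * x)
     = 2 * sin (real (2 * Suc M + 1) * x) * cos (2 * x)"
  proof -
    have a: "real (2 * Suc (Suc M) + 1) * x = real (2 * Suc M + 1) * x + 2 * x"
      "real (2 * M + 1) * x = real (2 * Suc M + 1) * x - 2 * x" by (simp_all add: algebra_simps)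
    show ?thesis unfolding a sin_add sin_diff by simp
  qed
  then have "sin (real (2 * Suc (Suc M) + 1) * x) = 2 * sin (real (2 * Suc M + 1) * x) * (1 - 2 * (sin x)\<^sup>2) - sin (real (2 * M + 1) * x)"
    unfolding cos_double_sin by (simp only: eq_diff_eq)
  also have "\<dots> = (2 - 4 * (sin x)\<^sup>2) * sin (real (2 * Suc M + 1) * x) - sin (real (2 * M + 1) * x)"
    by (simp only: algebra_simps)
  finally have "sin (real (2 * Suc (Suc M) + 1) * x) = (2 - 4 * (sin x)\<^sup>2) * sin (real (2 * Suc M + 1) * x) - sin (real (2 * M + 1) * x)" .
  moreover have "poly (dirichlet_poly (Suc (Suc M))) ((sin x)\<^sup>2) * sin x
      = (2 - 4 * (sin x)\<^sup>2) * (poly (dirichlet_poly (Suc M)) ((sin x)\<^sup>2) * sin x) - poly (dirichlet_poly M) ((sin x)\<^sup>2) * sin x"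
    by (simp add: algebra_simps)
  ultimately show ?case unfolding 3 by simp
qed

lemma dirichlet_poly_0: "poly (dirichlet_poly M) 0 = real (2 * M + 1)"
  by (induction M rule: dirichlet_poly.induct) auto

lemma abs_sin_mult_le: "\<bar>sin (real m * x)\<bar> \<le> real m * \<bar>sin x\<bar>"
proof (induction m)
  case (Suc m)
  have "sin (real (Suc m) * x) = sin (real m * x) * cos x + cos (real m * x) * sin x"
    by (simp add: algebra_simps sin_add)
  then have "\<bar>sin (real (Suc m) * x)\<bar> \<le> \<bar>sin (real m * x)\<bar> * \<bar>cos x\<bar> + \<bar>cos (real m * x)\<bar> * \<bar>sin x\<bar>"
    by (metis abs_mult abs_triangle_ineq)
  also have "\<dots> \<le> \<bar>sin (real m * x)\<bar> * 1 + 1 * \<bar>sin x\<bar>"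
    by (intro add_mono mult_left_mono mult_right_mono) auto
  also have "\<dots> \<le> real (Suc m) * \<bar>sin x\<bar>" using Suc by (simp add: algebra_simps)
  finally show ?case .
qed simp

lemma sin_ge_half: "0 \<le> y \<Longrightarrow> y \<le> 1 \<Longrightarrow> y / 2 \<le> sin (y::real)"
proof -
  assume y: "0 \<le> y" "y \<le> 1"
  have "sin 0 - 0 / 2 \<le> sin y - y / 2"
  proof (rule DERIV_nonneg_imp_nondecreasing[OF y(1)])
    fix x assume x: "0 \<le> x" "x \<le> y"
    have "cos (pi / 3) \<le> cos x" using x y pi_gt3 by (intro cos_monotone_0_pi_le) auto
    then have "0 \<le> cos x - 1 / 2" by (simp add: cos_60)
    moreover have "((\<lambda>x. sin x - x / 2) has_real_derivative cos x - 1 / 2) (at x)"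
      by (auto intro!: derivative_eq_intros)
    ultimately show "\<exists>d. ((\<lambda>x. sin x - x / 2) has_real_derivative d) (at x) \<and> 0 \<le> d" by blast
  qed
  then show ?thesis by simp
qed

text \<open>
  With \<open>s = sin x\<close> these are the elementary bounds of the Dirichlet kernel: at most \<open>1/s\<close> and at most
  \<open>N = 2M + 1\<close> everywhere, and comparable to \<open>N\<close> for \<open>s\<close> up to \<open>1/(2N)\<close>.
\<close>

lemma dirichlet_poly_bounds:
  assumes s: "0 \<le> s" "s \<le> 1"
  shows "\<bar>poly (dirichlet_poly M) (s\<^sup>2)\<bar> * s \<le> 1"
    and "\<bar>poly (dirichlet_poly M) (s\<^sup>2)\<bar> \<le> real (2 * M + 1)"
    and "s * (2 * real (2 * M + 1)) \<le> 1 \<Longrightarrow> real (2 * M + 1) / 2 \<le> poly (dirichlet_poly M) (s\<^sup>2)"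
proof -
  define x where "x = arcsin s"
  define N where "N = 2 * M + 1"
  have sx: "sin x = s" unfolding x_def using s by (simp add: sin_arcsin)
  have x0: "0 \<le> x" unfolding x_def using s arcsin_le_arcsin[of 0 s] by simp
  have *: "poly (dirichlet_poly M) (s\<^sup>2) * s = sin (real N * x)"
    using dirichlet_poly_sin[of M x] unfolding sx N_def .
  have "\<bar>poly (dirichlet_poly M) (s\<^sup>2)\<bar> * s = \<bar>sin (real N * x)\<bar>"
    using * s by (metis abs_mult abs_of_nonneg)
  then show "\<bar>poly (dirichlet_poly M) (s\<^sup>2)\<bar> * s \<le> 1" by simp
  show "\<bar>poly (dirichlet_poly M) (s\<^sup>2)\<bar> \<le> real (2 * M + 1)"
  proof (cases "s = 0")
    case True then show ?thesis by (simp add: dirichlet_poly_0)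
  next
    case False
    have "\<bar>poly (dirichlet_poly M) (s\<^sup>2)\<bar> * s \<le> real N * s"
      using abs_sin_mult_le[of N x] * s by (metis abs_mult abs_of_nonneg sx)
    then show ?thesis using False s N_def by simp
  qed
  assume small: "s * (2 * real (2 * M + 1)) \<le> 1"
  show "real (2 * M + 1) / 2 \<le> poly (dirichlet_poly M) (s\<^sup>2)"
  proof (cases "s = 0")
    case True then show ?thesis by (simp add: dirichlet_poly_0)
  next
    case False
    then have s0: "s > 0" using s by simp
    have N1: "real N \<ge> 1" unfolding N_def by simp
    have sN: "s * (2 * real N) \<le> 1" using small unfolding N_def .
    have "s * 2 \<le> s * (2 * real N)" using s0 N1 by simp
    then have "s \<le> 1 / 2" using sN by simp
    then have "x \<le> arcsin (1 / 2)" unfolding x_def using s by (intro arcsin_le_arcsin) auto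
    also have "arcsin (1 / 2) = pi / 6" using arcsin_sin[of "pi / 6"] by (simp add: sin_30)
    also have "\<dots> \<le> 1" using pi_less_4 by simp
    finally have x1: "x \<le> 1" .
    have xs: "x \<le> 2 * s" using sin_ge_half[OF x0 x1] sx by simp
    have "real N * x \<le> real N * (2 * s)" using xs by (intro mult_left_mono) auto
    then have "real N * x \<le> 1" using sN by (simp add: mult_ac)
    then have "real N * x / 2 \<le> sin (real N * x)" using x0 by (intro sin_ge_half) auto
    moreover have "s \<le> x" using sx sin_x_le_x[OF x0] by simp
    then have "real N * s / 2 \<le> real N * x / 2" by (intro divide_right_mono mult_left_mono) auto
    ultimately have "real N / 2 * s \<le> poly (dirichlet_poly M) (s\<^sup>2) * s" unfolding * by simp
    then show ?thesis using s0 N_def by (simp only: mult_le_cancel_right)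
  qed
qed

lemma jackson_kernel_mass:
  fixes R :: real
  assumes R: "R > 0" and n: "n > 0"
  defines "w \<equiv> \<lambda>M s. poly (dirichlet_poly M) ((s / R)\<^sup>2)"
  shows "integral {0..R} (\<lambda>s. w M s ^ (2 * q) * s ^ (n - 1)) \<ge> (real (2 * M + 1) / 2) ^ (2 * q) * (R / (2 * real (2 * M + 1))) ^ n / real n"
proof -
  define N where "N = real (2 * M + 1)"
  have N: "N \<ge> 1" unfolding N_def by simp
  define b where "b = R / (2 * N)"
  have b: "0 \<le> b" "b \<le> R" unfolding b_def using R N by (auto simp: field_simps)
  have wc: "continuous_on S (w M)" for S unfolding w_def using R by (intro continuous_intros) auto
  let ?f = "\<lambda>s. w M s ^ (2 * q) * s ^ (n - 1)"
  have i: "?f integrable_on {0..R}" "?f integrable_on {0..b}" "(\<lambda>s. (N / 2) ^ (2 * q) * s ^ (n - 1)) integrable_on {0..b}"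
    by (intro integrable_continuous_interval continuous_intros wc)+
  have "((\<lambda>s. (N / 2) ^ (2 * q) * s ^ (n - 1)) has_integral ((N / 2) ^ (2 * q) * b ^ n / real n - (N / 2) ^ (2 * q) * 0 ^ n / real n)) {0..b}"
    by (rule fundamental_theorem_of_calculus[OF b(1)])
       (use n in \<open>auto intro!: derivative_eq_intros simp: has_real_derivative_iff_has_vector_derivative[symmetric]\<close>)
  then have "((\<lambda>s. (N / 2) ^ (2 * q) * s ^ (n - 1)) has_integral ((N / 2) ^ (2 * q) * b ^ n / real n)) {0..b}"
    using n by (simp add: power_0_left)
  then have "(N / 2) ^ (2 * q) * b ^ n / real n = integral {0..b} (\<lambda>s. (N / 2) ^ (2 * q) * s ^ (n - 1))"
    by (rule integral_unique[symmetric])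
  also have "\<dots> \<le> integral {0..b} ?f"
  proof (rule integral_le[OF i(3,2)])
    fix s assume s: "s \<in> {0..b}"
    have "s / R * (2 * N) \<le> b / R * (2 * N)" using s R N by (intro mult_right_mono divide_right_mono) auto
    also have "\<dots> = 1" unfolding b_def using R N by simp
    finally have "N / 2 \<le> w M s"
      unfolding w_def N_def using s b R by (intro dirichlet_poly_bounds(3)) auto
    then show "(N / 2) ^ (2 * q) * s ^ (n - 1) \<le> ?f s"
      using s N by (intro mult_right_mono power_mono) auto
  qed
  also have "\<dots> \<le> integral {0..R} ?f"
    by (rule integral_subset_le) (use b i in \<open>auto simp: power_mult\<close>)
  finally show ?thesis unfolding b_def N_def .
qed

text \<open>
  The two upper bounds combine to \<open>|W| \<le> 2N / (1 + N s/R)\<close>. The factor \<open>s\<^bsup>2i\<^esup>\<close> is absorbed by \<open>2i\<close> of the powers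
  of \<open>W\<close>; enough powers remain for \<open>(1 + N s/R)\<^bsup>-2\<^esup>\<close>, whose integral is elementary.
\<close>

lemma jackson_kernel_moment:
  fixes R :: real
  assumes R: "R > 0" and n: "n > 0" and i: "n + 1 + 2 * i \<le> 2 * q"
  defines "w \<equiv> \<lambda>M s. poly (dirichlet_poly M) ((s / R)\<^sup>2)"
  shows "integral {0..R} (\<lambda>s. w M s ^ (2 * q) * s ^ (n - 1) * s ^ (2 * i))
    \<le> R ^ (2 * i) * ((2 * real (2 * M + 1)) ^ (2 * q - 2 * i) * (R / real (2 * M + 1)) ^ n)"
proof -
  define N where "N = real (2 * M + 1)"
  have N: "N \<ge> 1" unfolding N_def by simp
  define a where "a = 2 * q - 2 * i"
  have a: "2 * q = 2 * i + a" "n + 1 \<le> a" using i unfolding a_def by auto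
  have wc: "continuous_on S (w M)" for S unfolding w_def using R by (intro continuous_intros) auto
  define C where "C = R ^ (2 * i) * ((2 * N) ^ a * (R / N) ^ (n - 1))"
  have C: "C \<ge> 0" unfolding C_def using R N by simp
  let ?d = "\<lambda>s. 1 + N * s / R"
  have d1: "?d s \<ge> 1" if "s \<in> {0..R}" for s using that N R by simp
  have HI: "((\<lambda>s. C * (1 / (?d s)\<^sup>2)) has_integral (C * (R / ?d R) - C * (0 / ?d 0))) {0..R}"
  proof (rule fundamental_theorem_of_calculus, use R in simp, unfold has_real_derivative_iff_has_vector_derivative[symmetric])
    fix s assume s: "s \<in> {0..R}"
    have nz: "?d s \<noteq> 0" using d1[OF s] by linarith
    have R0: "R \<noteq> 0" using R by simp
    have "((\<lambda>s. C * (s / ?d s)) has_real_derivative C * ((1 * ?d s - s * (N / R)) / (?d s * ?d s))) (at s within {0..R})"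
      by (rule derivative_eq_intros refl R0 nz | simp add: R0)+
    moreover have "(1 * ?d s - s * (N / R)) / (?d s * ?d s) = 1 / (?d s)\<^sup>2"
      by (simp add: power2_eq_square)
    ultimately show "((\<lambda>s. C * (s / ?d s)) has_real_derivative C * (1 / (?d s)\<^sup>2)) (at s within {0..R})" by simp
  qed
  have "integral {0..R} (\<lambda>s. w M s ^ (2 * q) * s ^ (n - 1) * s ^ (2 * i)) \<le> integral {0..R} (\<lambda>s. C * (1 / (?d s)\<^sup>2))"
  proof (rule integral_le)
    show "(\<lambda>s. w M s ^ (2 * q) * s ^ (n - 1) * s ^ (2 * i)) integrable_on {0..R}"
      by (intro integrable_continuous_interval continuous_intros wc)
    show "(\<lambda>s. C * (1 / (?d s)\<^sup>2)) integrable_on {0..R}" using HI by blast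
    fix s assume s: "s \<in> {0..R}"
    define W where "W = \<bar>w M s\<bar>"
    have sR: "0 \<le> s / R" "s / R \<le> 1" using s R by auto
    have W1: "W * (s / R) \<le> 1" and W2: "W \<le> N" and W0: "W \<ge> 0"
      using dirichlet_poly_bounds(1,2)[OF sR, of M] unfolding W_def w_def N_def by auto
    have "W * ?d s = W + N * (W * (s / R))" by (simp add: algebra_simps)
    also have "\<dots> \<le> N + N * 1" using W1 W2 N by (intro add_mono mult_left_mono) auto
    finally have W3: "W \<le> 2 * N / ?d s" using d1[OF s] by (simp add: field_simps)
    have e1: "W ^ (2 * i) * s ^ (2 * i) \<le> R ^ (2 * i)"
    proof -
      have "W * s \<le> R" using W1 R by (simp add: field_simps)
      then have "(W * s) ^ (2 * i) \<le> R ^ (2 * i)" using W0 s by (intro power_mono) auto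
      then show ?thesis by (simp add: power_mult_distrib)
    qed
    have e2: "W ^ a \<le> (2 * N / ?d s) ^ a" using W3 W0 by (intro power_mono) auto
    have "s \<le> R / N * ?d s" using R N by (simp add: field_simps)
    then have e3: "s ^ (n - 1) \<le> (R / N * ?d s) ^ (n - 1)" using s by (intro power_mono) auto
    have ds: "?d s > 0" using d1[OF s] by linarith
    have e4: "(1 / ?d s) ^ a * ?d s ^ (n - 1) \<le> 1 / (?d s)\<^sup>2"
    proof -
      have "?d s ^ (n - 1) * (?d s)\<^sup>2 = ?d s ^ (n + 1)" using n by (simp add: power_add[symmetric])
      also have "\<dots> \<le> ?d s ^ a" using d1[OF s] a(2) by (intro power_increasing) auto
      finally have "?d s ^ (n - 1) \<le> ?d s ^ a / (?d s)\<^sup>2" using ds by (simp add: pos_le_divide_eq)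
      then have "?d s ^ (n - 1) / ?d s ^ a \<le> (?d s ^ a / (?d s)\<^sup>2) / ?d s ^ a" using ds by (intro divide_right_mono) auto
      then show ?thesis using ds by (simp add: power_divide)
    qed
    have "w M s ^ (2 * q) * s ^ (n - 1) * s ^ (2 * i) = (W ^ (2 * i) * s ^ (2 * i)) * (W ^ a * s ^ (n - 1))"
    proof -
      have "w M s ^ (2 * q) = W ^ (2 * q)" unfolding W_def by (simp add: power_mult)
      then show ?thesis unfolding a(1) power_add by (simp add: mult_ac)
    qed
    also have "\<dots> \<le> R ^ (2 * i) * ((2 * N / ?d s) ^ a * (R / N * ?d s) ^ (n - 1))"
      by (intro mult_mono e1 e2 e3) (use W0 s R N ds in auto)
    also have "\<dots> = C * ((1 / ?d s) ^ a * ?d s ^ (n - 1))"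
      unfolding C_def by (simp add: power_mult_distrib power_divide mult_ac)
    also have "\<dots> \<le> C * (1 / (?d s)\<^sup>2)" by (rule mult_left_mono[OF e4 C])
    finally show "w M s ^ (2 * q) * s ^ (n - 1) * s ^ (2 * i) \<le> C * (1 / (?d s)\<^sup>2)" .
  qed
  also have "\<dots> = C * (R / (1 + N))" using integral_unique[OF HI] R by simp
  also have "\<dots> \<le> C * (R / N)" using C R N by (intro mult_left_mono divide_left_mono) auto
  also have "\<dots> = R ^ (2 * i) * ((2 * N) ^ a * (R / N) ^ n)"
    unfolding C_def using n by (cases n) (auto simp: mult_ac)
  finally show ?thesis unfolding N_def a_def .
qed

text \<open>
  A high even power of the Dirichlet kernel, in the variable \<open>s/R\<close>, is a nonnegative polynomial in \<open>s\<^sup>2\<close>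
  concentrated at the scale \<open>R/N\<close> with \<open>N\<close> proportional to \<open>d + 1\<close>. Powers of
  \<open>1 - s\<^sup>2\<close> would only give a multiple of the square root of \<open>d\<close>, and with it the error factor \<open>p\<^bsup>-r\<^esup>\<close> instead of \<open>p\<^bsup>-2r\<^esup>\<close>.
\<close>

lemma jackson_kernel:
  fixes R :: real and n J :: nat
  assumes R: "R > 0" and n: "n > 0"
  obtains A B where "A \<ge> 0" "B > 0"
    "\<And>d. \<exists>k c \<theta>. radial_kernel R n k \<and> (\<forall>s. k s = (\<Sum>i\<le>d. c i * s ^ (2 * i))) \<and>
      (\<forall>i\<le>J. radial_kernel.kmean R n k (\<lambda>t. t ^ (2 * i)) \<le> A * \<theta> ^ i) \<and> 0 \<le> \<theta> \<and> \<theta> \<le> B / (real (d + 1))\<^sup>2"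
proof -
  \<comment> \<open>This choice gives \<open>n + 1 + 2 i \<le> 2 q\<close> for all \<open>i \<le> J\<close>, as the moment estimate requires.\<close>
  define q where "q = J + n"
  have q: "q > 0" using n unfolding q_def by simp
  define A where "A = max 1 R ^ (2 * J) * (2 ^ (4 * q + n) * real n)"
  define B where "B = (real (2 * q))\<^sup>2"
  show ?thesis
  proof (rule that[of A B])
    show "A \<ge> 0" unfolding A_def by simp
    show "B > 0" unfolding B_def using q by simp
    fix d :: nat
    define M where "M = d div (2 * q)"
    define N where "N = real (2 * M + 1)"
    have N: "N \<ge> 1" unfolding N_def by simp
    define w where "w s = poly (dirichlet_poly M) ((s / R)\<^sup>2)" for s
    define k where "k s = w s ^ (2 * q)" for s
    define \<theta> where "\<theta> = 1 / N\<^sup>2"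
    define p where "p = dirichlet_poly M ^ (2 * q)"
    define c where "c i = coeff p i / R ^ (2 * i)" for i
    have "degree p \<le> degree (dirichlet_poly M) * (2 * q)" unfolding p_def by (rule degree_power_le)
    also have "\<dots> \<le> M * (2 * q)" by (intro mult_right_mono degree_dirichlet_poly) simp
    also have "\<dots> \<le> d" unfolding M_def by (rule div_times_less_eq_dividend)
    finally have dp: "degree p \<le> d" .
    have kc: "k s = (\<Sum>i\<le>d. c i * s ^ (2 * i))" for s
    proof -
      have "k s = poly p ((s / R)\<^sup>2)" unfolding k_def w_def p_def by simp
      also have "\<dots> = (\<Sum>i\<le>d. coeff p i * ((s / R)\<^sup>2) ^ i)"
        unfolding poly_altdef by (rule sum.mono_neutral_left) (use dp in \<open>auto simp: coeff_eq_0\<close>)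
      also have "\<dots> = (\<Sum>i\<le>d. c i * s ^ (2 * i))"
        unfolding c_def by (intro sum.cong refl) (simp add: power_divide power_mult[symmetric])
      finally show ?thesis .
    qed
    have den: "integral {0..R} (\<lambda>s. k s * s ^ (n - 1)) \<ge> (N / 2) ^ (2 * q) * (R / (2 * N)) ^ n / real n"
      using jackson_kernel_mass[OF R n, of M q] unfolding k_def w_def N_def .
    have den0: "(N / 2) ^ (2 * q) * (R / (2 * N)) ^ n / real n > 0" using N R n by simp
    have K: "radial_kernel R n k"
    proof
      show "continuous_on {0..R} k" unfolding kc[abs_def] by (intro continuous_intros)
      show "k s \<ge> 0" for s unfolding k_def by (simp add: power_mult)
      show "integral {0..R} (\<lambda>s. k s * s ^ (n - 1)) > 0" using den den0 by linarith
    qed (use R n in auto)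
    have mom: "radial_kernel.kmean R n k (\<lambda>t. t ^ (2 * i)) \<le> A * \<theta> ^ i" if i: "i \<le> J" for i
    proof -
      define a where "a = 2 * q - 2 * i"
      have qi: "n + 1 + 2 * i \<le> 2 * q" using i n unfolding q_def by simp
      have a: "2 * q = a + 2 * i" using qi unfolding a_def by simp
      let ?num = "R ^ (2 * i) * ((2 * N) ^ a * (R / N) ^ n)"
      let ?den = "(N / 2) ^ (2 * q) * (R / (2 * N)) ^ n / real n"
      have num: "integral {0..R} (\<lambda>s. k s * s ^ (n - 1) * s ^ (2 * i)) \<le> ?num"
        using jackson_kernel_moment[OF R n qi, of M] unfolding k_def w_def N_def a_def .
      have num0: "?num \<ge> 0" using R N by simp
      have "radial_kernel.kmean R n k (\<lambda>t. t ^ (2 * i)) \<le> ?num / integral {0..R} (\<lambda>s. k s * s ^ (n - 1))"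
        unfolding radial_kernel.kmean_def[OF K] using num den den0 by (intro divide_right_mono) auto
      also have "\<dots> \<le> ?num / ?den"
        using num0 den den0 by (intro divide_left_mono mult_pos_pos) auto
      also have "\<dots> = R ^ (2 * i) * (2 ^ (a + 2 * q + n) * real n) * \<theta> ^ i"
      proof -
        have N0: "N \<noteq> 0" and R0: "R \<noteq> 0" using N R by auto
        have "?num = R ^ (2 * i) * (2 ^ a * N ^ a * (R ^ n / N ^ n))"
          by (simp add: power_mult_distrib power_divide)
        moreover have "?den = N ^ a * N ^ (2 * i) / 2 ^ (2 * q) * (R ^ n / (2 ^ n * N ^ n)) / real n"
          by (simp only: power_divide power_mult_distrib power_add[symmetric] a[symmetric])
        moreover have "\<theta> ^ i = 1 / N ^ (2 * i)" unfolding \<theta>_def by (simp add: power_divide power_mult)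
        ultimately show ?thesis using N0 R0 n by (simp add: power_add field_simps)
      qed
      also have "\<dots> \<le> A * \<theta> ^ i"
        unfolding A_def
      proof (intro mult_right_mono mult_mono)
        have "R ^ (2 * i) \<le> max 1 R ^ (2 * i)" using R by (intro power_mono) auto
        also have "\<dots> \<le> max 1 R ^ (2 * J)" using i by (intro power_increasing) auto
        finally show "R ^ (2 * i) \<le> max 1 R ^ (2 * J)" .
        show "(2::real) ^ (a + 2 * q + n) \<le> 2 ^ (4 * q + n)" using a by (intro power_increasing) auto
      qed (use R in \<open>auto simp: \<theta>_def\<close>)
      finally show ?thesis .
    qed
    have "\<theta> \<le> B / (real (d + 1))\<^sup>2"
    proof -
      have "d < 2 * q * (M + 1)" unfolding M_def using q
        by (metis Suc_eq_plus1 dividend_less_times_div mult.commute mult_Suc_right mult_pos_pos zero_less_numeral)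
      then have "d + 1 \<le> 2 * q * (2 * M + 1)"
        by (smt (verit) Suc_eq_plus1 Suc_leI le_trans mult_le_mono2 add_le_mono1 mult_2 le_add1)
      then have "real (d + 1) \<le> real (2 * q) * N" unfolding N_def by (metis of_nat_le_iff of_nat_mult)
      then have "(real (d + 1))\<^sup>2 \<le> (real (2 * q) * N)\<^sup>2" by (intro power_mono) auto
      then show ?thesis unfolding \<theta>_def B_def using N by (simp add: field_simps)
    qed
    then show "\<exists>k c \<theta>. radial_kernel R n k \<and> (\<forall>s. k s = (\<Sum>i\<le>d. c i * s ^ (2 * i))) \<and>
      (\<forall>i\<le>J. radial_kernel.kmean R n k (\<lambda>t. t ^ (2 * i)) \<le> A * \<theta> ^ i) \<and> 0 \<le> \<theta> \<and> \<theta> \<le> B / (real (d + 1))\<^sup>2"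
      using K kc mom by (intro exI[of _ k] exI[of _ c] exI[of _ \<theta>]) (auto simp: \<theta>_def)
  qed
qed

section \<open>Maximum principles\<close>

text \<open>
  A positive second derivative would make the first derivative positive, hence the function increasing, on one side
  of the maximum.
\<close>

lemma second_partial_nonpos_at_max:
  fixes w :: "'a::euclidean_space \<Rightarrow> real"
  assumes D: "open D" "x \<in> D" and ex: "laplacian_exists_on D w" and b: "b \<in> Basis"
    and max: "\<And>y. y \<in> D \<Longrightarrow> w y \<le> w x"
  shows "partial b (partial b w) x \<le> 0"
proof (rule ccontr)
  assume "\<not> ?thesis"
  then have pos: "partial b (partial b w) x > 0" by simp
  obtain e where e: "e > 0" "ball x e \<subseteq> D" using D open_contains_ball by blast
  have inD: "x + s *\<^sub>R b \<in> D" if "\<bar>s\<bar> < e" for s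
    using e(2) that b by (auto simp: dist_norm)
  let ?g = "\<lambda>s. w (x + s *\<^sub>R b)" and ?g' = "\<lambda>s. partial b w (x + s *\<^sub>R b)"
  have der: "(?g has_real_derivative ?g' s) (at s)" if "\<bar>s\<bar> < e" for s
    by (rule has_partial_along) (use ex inD[OF that] b in \<open>auto simp: laplacian_exists_on_def\<close>)
  have der2: "(?g' has_real_derivative partial b (partial b w) x) (at 0)"
    using has_partial_along[of b "partial b w" x 0] ex D(2) b by (auto simp: laplacian_exists_on_def)
  have "?g' 0 = 0"
    using DERIV_local_max[OF der[of 0] e(1)] max inD e(1) by simp
  obtain d where d: "d > 0" "\<And>h. h > 0 \<Longrightarrow> h < d \<Longrightarrow> ?g' 0 < ?g' (0 + h)"
    using DERIV_pos_inc_right[OF der2 pos] by blast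
  define h where "h = min d e / 2"
  have h: "h > 0" "h < d" "h < e" using d(1) e(1) unfolding h_def by auto
  obtain z where z: "0 < z" "z < h" "?g h - ?g 0 = (h - 0) * ?g' z"
    using MVT2[OF h(1), of ?g ?g'] der h(3) by auto
  have "?g' z > 0" using d(2)[of z] z h \<open>?g' 0 = 0\<close> by simp
  then have "?g h > ?g 0" using z(3) h(1) by (simp add: algebra_simps)
  moreover have "?g h \<le> w x" using max inD[of h] h by simp
  ultimately show False by simp
qed

lemma maximum_principle_strict:
  fixes w :: "'a::euclidean_space \<Rightarrow> real"
  assumes D: "open D" "bounded D" and w: "continuous_on (closure D) w"
    and ex: "laplacian_exists_on D w" and pos: "\<And>x. x \<in> D \<Longrightarrow> laplacian w x > 0"
    and bd: "\<And>x. x \<in> frontier D \<Longrightarrow> w x \<le> B" and y: "y \<in> closure D"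
  shows "w y \<le> B"
proof -
  have "compact (closure D)" using D(2) by (simp add: compact_closure)
  then obtain x where x: "x \<in> closure D" "\<And>y. y \<in> closure D \<Longrightarrow> w y \<le> w x"
    using continuous_attains_sup[OF _ _ w] y by (metis empty_iff)
  have "x \<notin> D"
  proof
    assume xD: "x \<in> D"
    have "partial b (partial b w) x \<le> 0" if "b \<in> Basis" for b
      by (rule second_partial_nonpos_at_max[OF D(1) xD ex that]) (use x(2) closure_subset in blast)
    then have "laplacian w x \<le> 0" unfolding laplacian_def by (rule sum_nonpos)
    then show False using pos[OF xD] by simp
  qed
  then have "x \<in> frontier D" using x(1) D(1) by (simp add: frontier_def interior_open)
  then show ?thesis using bd x(2)[OF y] by fastforce
qed

text \<open>
  Adding \<open>a |x|\<^sup>2\<close> with \<open>a\<close> slightly larger than \<open>M\<close> makes the Laplacian positive, which excludes interior maxima.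
\<close>

lemma maximum_principle_upper:
  fixes w :: "'a::euclidean_space \<Rightarrow> real"
  assumes D: "open D" "D \<subseteq> ball 0 \<rho>" and w: "continuous_on (closure D) w"
    and ex: "laplacian_exists_on D w" and lap: "\<And>x. x \<in> D \<Longrightarrow> laplacian w x \<ge> - M" and M: "M \<ge> 0"
    and bd: "\<And>x. x \<in> frontier D \<Longrightarrow> w x \<le> B" and y: "y \<in> closure D"
  shows "w y \<le> B + M * \<rho>\<^sup>2"
proof (rule field_le_epsilon)
  fix e :: real assume e: "e > 0"
  have bD: "bounded D" using D(2) bounded_ball bounded_subset by blast
  have cl: "closure D \<subseteq> cball 0 \<rho>" by (rule closure_minimal[OF order_trans[OF D(2) ball_subset_cball] closed_cball])
  define a where "a = M + e / (1 + \<rho>\<^sup>2)"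
  have p1: "1 + \<rho>\<^sup>2 > 0" using zero_le_power2[of \<rho>] by linarith
  have a: "a > M" unfolding a_def using e p1 by simp
  have sq: "(norm x)\<^sup>2 \<le> \<rho>\<^sup>2" if "x \<in> closure D" for x
    using cl that by (intro power_mono) auto
  have C2: "laplacian_exists_on D (\<lambda>x::'a. (norm x)\<^sup>2)"
    by (rule Ck_on_2_laplacian_exists[OF Ck_on_norm_sq[OF D(1)]])
  let ?v = "\<lambda>x. 1 * w x + a * (norm x)\<^sup>2"
  have "?v y \<le> B + a * \<rho>\<^sup>2"
  proof (rule maximum_principle_strict[OF D(1) bD _ _ _ _ y])
    show "continuous_on (closure D) ?v" by (intro continuous_intros w)
    show "laplacian_exists_on D ?v" by (rule laplacian_lin(1)[OF D(1) ex C2])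
    fix x assume x: "x \<in> D"
    have "Suc 0 \<le> DIM('a)" using DIM_positive[where 'a='a] by (rule Suc_leI)
    then have "1 \<le> 2 * real DIM('a)" by linarith
    then have "a * 1 \<le> a * (2 * real DIM('a))"
      by (rule mult_left_mono) (use a M in auto)
    then show "laplacian ?v x > 0"
      using laplacian_lin(2)[OF D(1) ex C2 x, of 1 a] lap[OF x] a laplacian_norm_sq[of x] by simp
  next
    fix x assume x: "x \<in> frontier D"
    then have "x \<in> closure D" by (simp add: frontier_def)
    then show "?v x \<le> B + a * \<rho>\<^sup>2"
      using bd[OF x] sq a M by (intro add_mono mult_left_mono) auto
  qed
  moreover have "a * (norm y)\<^sup>2 \<ge> 0" using a M by simp
  ultimately have "w y \<le> B + a * \<rho>\<^sup>2" by simp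
  also have "a * \<rho>\<^sup>2 = M * \<rho>\<^sup>2 + e * (\<rho>\<^sup>2 / (1 + \<rho>\<^sup>2))" unfolding a_def by (simp add: algebra_simps)
  also have "\<dots> \<le> M * \<rho>\<^sup>2 + e * 1" using e p1 M by (intro add_mono mult_left_mono) (auto simp: field_simps)
  finally show "w y \<le> B + M * \<rho>\<^sup>2 + e" by simp
qed

lemma maximum_principle:
  fixes w :: "'a::euclidean_space \<Rightarrow> real"
  assumes D: "open D" "D \<subseteq> ball 0 \<rho>" and w: "continuous_on (closure D) w"
    and ex: "laplacian_exists_on D w" and lap: "\<And>x. x \<in> D \<Longrightarrow> \<bar>laplacian w x\<bar> \<le> M" and M: "M \<ge> 0"
    and bd: "\<And>x. x \<in> frontier D \<Longrightarrow> w x = 0" and y: "y \<in> closure D"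
  shows "\<bar>w y\<bar> \<le> \<rho>\<^sup>2 * M"
proof -
  have "w y \<le> 0 + M * \<rho>\<^sup>2"
  proof (rule maximum_principle_upper[OF D w ex _ M _ y])
    show "laplacian w x \<ge> - M" if "x \<in> D" for x using lap[OF that] by linarith
  qed (use bd in auto)
  moreover have "(\<lambda>x. (-1) * w x + 0 * w x) y \<le> 0 + M * \<rho>\<^sup>2"
  proof (rule maximum_principle_upper[OF D _ _ _ M _ y])
    show "continuous_on (closure D) (\<lambda>x. (-1) * w x + 0 * w x)" by (intro continuous_intros w)
    show "laplacian_exists_on D (\<lambda>x. (-1) * w x + 0 * w x)" by (rule laplacian_lin(1)[OF D(1) ex ex])
    show "laplacian (\<lambda>x. (-1) * w x + 0 * w x) x \<ge> - M" if "x \<in> D" for x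
      using laplacian_lin(2)[OF D(1) ex ex that, of "-1" 0] lap[OF that] by simp
  qed (use bd in auto)
  ultimately show ?thesis by (simp add: abs_le_iff mult.commute)
qed

text \<open>
  A function is controlled by its \<open>s\<close>-th iterated Laplacian if all lower iterates vanish on the boundary.
  With \<open>M = 0\<close> this is uniqueness for the polyharmonic boundary value problem.
\<close>

lemma laplacian_chain_bound:
  fixes d :: "nat \<Rightarrow> 'a::euclidean_space \<Rightarrow> real"
  assumes D: "open D" "D \<subseteq> ball 0 \<rho>"
    and c: "\<And>j. j < s \<Longrightarrow> continuous_on (closure D) (d j)"
    and ex: "\<And>j. j < s \<Longrightarrow> laplacian_exists_on D (d j)"
    and lap: "\<And>j x. j < s \<Longrightarrow> x \<in> D \<Longrightarrow> laplacian (d j) x = d (Suc j) x"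
    and bd: "\<And>j x. j < s \<Longrightarrow> x \<in> frontier D \<Longrightarrow> d j x = 0"
    and M: "M \<ge> 0" "\<And>x. x \<in> closure D \<Longrightarrow> \<bar>d s x\<bar> \<le> M" and y: "y \<in> closure D"
  shows "\<bar>d 0 y\<bar> \<le> (\<rho>\<^sup>2) ^ s * M"
proof -
  have "\<forall>x\<in>closure D. \<bar>d (s - i) x\<bar> \<le> (\<rho>\<^sup>2) ^ i * M" if "i \<le> s" for i
    using that
  proof (induction i)
    case 0 then show ?case using M by simp
  next
    case (Suc i)
    then have j: "s - Suc i < s" "Suc (s - Suc i) = s - i" by auto
    show ?case
    proof
      fix x assume x: "x \<in> closure D"
      have "\<bar>d (s - Suc i) x\<bar> \<le> \<rho>\<^sup>2 * ((\<rho>\<^sup>2) ^ i * M)"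
      proof (rule maximum_principle[OF D c[OF j(1)] ex[OF j(1)] _ _ bd[OF j(1)] x])
        fix z assume z: "z \<in> D"
        then have "z \<in> closure D" using closure_subset by blast
        then show "\<bar>laplacian (d (s - Suc i)) z\<bar> \<le> (\<rho>\<^sup>2) ^ i * M"
          using Suc lap[OF j(1) z] j(2) by auto
      qed (use M in auto)
      then show "\<bar>d (s - Suc i) x\<bar> \<le> (\<rho>\<^sup>2) ^ Suc i * M" by (simp add: mult_ac)
    qed
  qed
  from this[of s] y show ?thesis by simp
qed

text \<open>
  The index \<open>N\<close> is the number of derivatives that the result has.
\<close>

definition mollify :: "nat \<Rightarrow> real \<Rightarrow> ('a::euclidean_space \<Rightarrow> real) \<Rightarrow> 'a \<Rightarrow> real" where
  "mollify N \<delta> v x = (LINT z:cball 0 \<delta>|lborel. bump \<delta> (N + 1) z * v (x + z)) / (LINT z:cball (0::'a) \<delta>|lborel. bump \<delta> (N + 1) z)"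

lemma bump_mass:
  assumes d: "\<delta> > 0"
  shows "(LINT z:cball (0::'a::euclidean_space) \<delta>|lborel. bump \<delta> N z) =
    sphere_area TYPE('a) * integral {0..\<delta>} (\<lambda>s. (\<delta>\<^sup>2 - s\<^sup>2) ^ N * s ^ (DIM('a) - 1))"
proof -
  have d0: "\<delta> \<ge> 0" using d by simp
  have "(LINT z:cball (0::'a) \<delta>|lborel. bump \<delta> N z) = (LINT z:cball (0::'a) \<delta>|lborel. (\<delta>\<^sup>2 - (norm z)\<^sup>2) ^ N * 1)"
    by (rule set_lebesgue_integral_cong) (auto simp: bump_eq)
  also have "\<dots> = sphere_area TYPE('a) * integral {0..\<delta>} (\<lambda>s. (\<delta>\<^sup>2 - s\<^sup>2) ^ N * s ^ (DIM('a) - 1) * spherical_mean (\<lambda>_::'a. 1) 0 s)"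
    by (rule integral_cball_polar[OF continuous_on_const _ d0]) (intro continuous_intros)
  finally show ?thesis by (simp add: spherical_mean_const)
qed

lemma bump_mass_pos:
  assumes d: "\<delta> > 0"
  shows "(LINT z:cball (0::'a::euclidean_space) \<delta>|lborel. bump \<delta> N z) > 0"
  using bump_mass[OF d, of N, where 'a='a] integral_radial_bump_pos[OF d, of N "DIM('a) - 1"] sphere_area_pos[where 'a='a]
  by simp

lemma mollify_Ck_on:
  fixes v :: "'a::euclidean_space \<Rightarrow> real"
  assumes v: "continuous_on UNIV v" and d: "\<delta> > 0"
  shows "Ck_on N UNIV (mollify N \<delta> v)"
proof (rule Ck_on_local[OF open_UNIV])
  fix x0 :: 'a
  have "Ck_on N (ball x0 \<delta>) (\<lambda>x. LINT z:cball 0 \<delta>|lborel. bump \<delta> (N + 1) z * v (x + z))"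
    by (rule bump_convolution_Ck_on[OF continuous_on_subset[OF v] d]) simp
  from Ck_on_cmult[OF open_ball this, of "1 / (LINT z:cball (0::'a) \<delta>|lborel. bump \<delta> (N + 1) z)"]
  have "Ck_on N (ball x0 \<delta>) (mollify N \<delta> v)" unfolding mollify_def[abs_def] by simp
  then show "\<exists>S. open S \<and> x0 \<in> S \<and> Ck_on N S (mollify N \<delta> v)"
    using d by (intro exI[of _ "ball x0 \<delta>"]) auto
qed

lemma mollify_close:
  fixes v :: "'a::euclidean_space \<Rightarrow> real"
  assumes v: "continuous_on UNIV v" and d: "\<delta> > 0" and e: "\<And>z. norm z \<le> \<delta> \<Longrightarrow> \<bar>v (x + z) - v x\<bar> \<le> \<epsilon>"
  shows "\<bar>mollify N \<delta> v x - v x\<bar> \<le> \<epsilon>"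
proof -
  let ?q = "bump \<delta> (N + 1) :: 'a \<Rightarrow> real"
  define m where "m = (LINT z:cball 0 \<delta>|lborel. ?q z)"
  have m: "m > 0" unfolding m_def by (rule bump_mass_pos[OF d])
  have L: "bounded_functional \<delta> (LINT z:cball 0 \<delta>|lborel. \<bar>?q z\<bar>) (\<lambda>u. LINT z:cball 0 \<delta>|lborel. ?q z * u z)"
    by (rule bounded_functional_integral[OF continuous_on_bump])
  have mm: "(LINT z:cball 0 \<delta>|lborel. \<bar>?q z\<bar>) = m" unfolding m_def by (simp add: bump_nonneg)
  have cv: "continuous_on (cball 0 \<delta>) (\<lambda>z. v (x + z))"
    by (rule continuous_on_translate[OF v]) simp
  have "\<bar>(LINT z:cball 0 \<delta>|lborel. ?q z * v (x + z)) - (LINT z:cball 0 \<delta>|lborel. ?q z * v x)\<bar> \<le> m * \<epsilon>"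
    using bounded_functional_diff_le[OF L cv continuous_on_const, of "v x" \<epsilon>] e unfolding mm by auto
  moreover have "(LINT z:cball 0 \<delta>|lborel. ?q z * v x) = m * v x" unfolding m_def by (rule set_integral_mult_left)
  moreover have "(LINT z:cball 0 \<delta>|lborel. ?q z * v (x + z)) = m * mollify N \<delta> v x"
    using m unfolding mollify_def m_def by simp
  ultimately have "\<bar>m * mollify N \<delta> v x - m * v x\<bar> \<le> m * \<epsilon>" by (simp only:)
  then have "m * \<bar>mollify N \<delta> v x - v x\<bar> \<le> m * \<epsilon>" using m by (simp add: right_diff_distrib[symmetric] abs_mult)
  then show ?thesis using m by simp
qed

lemma mollify_support:
  fixes v :: "'a::euclidean_space \<Rightarrow> real"
  assumes "\<And>y. norm y \<ge> \<rho> \<Longrightarrow> v y = 0" "norm x \<ge> \<rho> + \<delta>"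
  shows "mollify N \<delta> v x = 0"
proof -
  have "(LINT z:cball 0 \<delta>|lborel. bump \<delta> (N + 1) z * v (x + z)) = (LINT z:cball (0::'a) \<delta>|lborel. 0)"
  proof (rule set_lebesgue_integral_cong)
    show "\<forall>z. z \<in> cball 0 \<delta> \<longrightarrow> bump \<delta> (N + 1) z * v (x + z) = 0"
    proof (intro allI impI)
      fix z :: 'a assume "z \<in> cball 0 \<delta>"
      then have "norm (x + z) \<ge> \<rho>" using assms(2) norm_triangle_ineq2[of x "- z"] by simp
      then show "bump \<delta> (N + 1) z * v (x + z) = 0" using assms(1) by simp
    qed
  qed simp
  then show ?thesis unfolding mollify_def by simp
qed

lemma compact_support_uniformly_continuous:
  fixes v :: "'a::euclidean_space \<Rightarrow> real"
  assumes v: "continuous_on UNIV v" and supp: "\<And>y. norm y \<ge> \<rho> \<Longrightarrow> v y = 0" and e: "\<epsilon> > 0"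
  obtains d where "d > 0" "d \<le> 1" "\<And>x z. norm z \<le> d \<Longrightarrow> \<bar>v (x + z) - v x\<bar> \<le> \<epsilon>"
proof -
  have "uniformly_continuous_on (cball 0 (\<rho> + 1)) v"
    by (intro compact_uniformly_continuous continuous_on_subset[OF v] compact_cball) simp
  then obtain d where d: "d > 0" "\<And>y y'. y \<in> cball 0 (\<rho> + 1) \<Longrightarrow> y' \<in> cball 0 (\<rho> + 1) \<Longrightarrow> dist y' y < d \<Longrightarrow> dist (v y') (v y) < \<epsilon>"
    using e unfolding uniformly_continuous_on_def by metis
  define d' where "d' = min 1 (d / 2)"
  show ?thesis
  proof (rule that[of d'])
    show "d' > 0" "d' \<le> 1" unfolding d'_def using d(1) by auto
    fix x z :: 'a assume z: "norm z \<le> d'"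
    have z1: "norm z \<le> 1" "norm z < d" using z d(1) unfolding d'_def by auto
    have t: "norm (x + z) \<le> norm x + norm z" "norm x \<le> norm (x + z) + norm z"
      using norm_triangle_ineq[of x z] norm_triangle_ineq4[of "x + z" z] by auto
    show "\<bar>v (x + z) - v x\<bar> \<le> \<epsilon>"
    proof (cases "norm x \<le> \<rho> + 1 \<and> norm (x + z) \<le> \<rho> + 1")
      case True
      then have "x \<in> cball 0 (\<rho> + 1)" "x + z \<in> cball 0 (\<rho> + 1)" by (simp_all only: mem_cball_0)
      from d(2)[OF this] z1 show ?thesis by (simp add: dist_norm)
    next
      case False
      then have "norm x \<ge> \<rho>" "norm (x + z) \<ge> \<rho>" using t z1 by auto
      then show ?thesis using supp e by simp
    qed
  qed
qed

lemma mollify_approx: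
  fixes v :: "'a::euclidean_space \<Rightarrow> real"
  assumes v: "continuous_on UNIV v" and supp: "\<And>y. norm y \<ge> \<rho> \<Longrightarrow> v y = 0" and e: "\<epsilon> > 0"
  obtains v' where "Ck_on N UNIV v'" "\<And>y. norm y \<ge> \<rho> + 1 \<Longrightarrow> v' y = 0" "\<And>x. \<bar>v x - v' x\<bar> \<le> \<epsilon>"
proof -
  obtain d where d: "d > 0" "d \<le> 1" "\<And>x z. norm z \<le> d \<Longrightarrow> \<bar>v (x + z) - v x\<bar> \<le> \<epsilon>"
    using compact_support_uniformly_continuous[OF v supp e] by blast
  show ?thesis
  proof (rule that[of "mollify N d v"])
    show "Ck_on N UNIV (mollify N d v)" by (rule mollify_Ck_on[OF v d(1)])
    show "mollify N d v y = 0" if "norm y \<ge> \<rho> + 1" for y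
      by (rule mollify_support[OF supp]) (use that d(2) in auto)
    show "\<bar>v x - mollify N d v x\<bar> \<le> \<epsilon>" for x
      using mollify_close[OF v d(1), of x \<epsilon> N] d(3) by (simp add: abs_minus_commute)
  qed
qed

section \<open>Potentials of continuous functions\<close>

lemma weak_laplacian_add:
  fixes U :: "'a::euclidean_space \<Rightarrow> real"
  assumes c: "continuous_on D U" "continuous_on D U'" "continuous_on D v" "continuous_on D v'"
    and w: "weak_laplacian D U v" "weak_laplacian D U' v'"
  shows "weak_laplacian D (\<lambda>x. U x + U' x) (\<lambda>x. v x + v' x)"
  unfolding weak_laplacian_def
proof (intro allI impI)
  fix x t assume t: "(t::real) \<ge> 0" and sub: "cball x t \<subseteq> D"
  have lin: "spherical_mean (\<lambda>x. f x + g x) x s = spherical_mean f x s + spherical_mean g x s"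
    if "continuous_on D f" "continuous_on D g" "s \<in> {0..t}" for f g s
  proof -
    have "cball x s \<subseteq> D" using sub that(3) by force
    then have "continuous_on (cball 0 s) (\<lambda>z. f (x + z))" "continuous_on (cball 0 s) (\<lambda>z. g (x + z))"
      using that continuous_on_translate by blast+
    from spherical_mean_lin[OF this, where t = s and a = 1 and c = 1] that(3) show ?thesis
      unfolding spherical_mean_translate[of _ x] by simp
  qed
  have tt: "t \<in> {0..t}" using t by simp
  have cs: "continuous_on {0..t} (spherical_mean v x)" "continuous_on {0..t} (spherical_mean v' x)"
    using spherical_mean_continuous_radius[OF c(3) sub] spherical_mean_continuous_radius[OF c(4) sub] .
  let ?P = "radial_potential DIM('a)"
  have "?P (spherical_mean (\<lambda>x. v x + v' x) x) t = ?P (\<lambda>s. 1 * spherical_mean v x s + 1 * spherical_mean v' x s) t"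
  proof (rule profile_functional_cong[where R = t and \<Lambda> = "\<lambda>g. ?P g t" and C = "t\<^sup>2"])
    show "continuous_on {0..t} (spherical_mean (\<lambda>x. v x + v' x) x)"
      by (intro spherical_mean_continuous_radius[OF _ sub] continuous_intros c)
    show "profile_functional t (t\<^sup>2) (\<lambda>g. ?P g t)"
      unfolding profile_functional_def
    proof (intro conjI allI impI)
      fix g :: "real \<Rightarrow> real" and B assume g: "continuous_on {0..t} g" "\<forall>s\<in>{0..t}. \<bar>g s\<bar> \<le> B"
      have "\<bar>?P g t\<bar> \<le> B * t ^ (0 + 2)"
        by (rule radial_potential_bound[OF g(1) tt]) (use g(2) t in \<open>auto intro: order_trans[OF abs_ge_zero]\<close>)
      then show "\<bar>?P g t\<bar> \<le> t\<^sup>2 * B" by (simp add: power2_eq_square mult.commute)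
    qed (rule radial_potential_lin[OF _ _ tt])
  qed (use lin c in auto)
  also have "\<dots> = ?P (spherical_mean v x) t + ?P (spherical_mean v' x) t"
    using radial_potential_lin[OF cs tt, of "DIM('a)" 1 1] by simp
  finally show "spherical_mean (\<lambda>x. U x + U' x) x t = U x + U' x + ?P (spherical_mean (\<lambda>x. v x + v' x) x) t"
    using lin[OF c(1,2) tt] w t sub unfolding weak_laplacian_def by simp
qed

lemma weak_laplacian_harmonic:
  fixes U :: "'a::euclidean_space \<Rightarrow> real"
  assumes D: "open D" and h: "harmonic_on D U"
  shows "weak_laplacian D U (\<lambda>_. 0)"
proof -
  have h': "Ck_on 2 D U" "\<And>x. x \<in> D \<Longrightarrow> laplacian U x = 0"
    using h unfolding harmonic_on_def polyharmonic_on_def by auto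
  show ?thesis
  proof (rule weak_laplacian_limit)
    show "\<exists>U' v'. weak_laplacian D U' v' \<and> continuous_on D U' \<and> continuous_on D v' \<and>
      (\<forall>x\<in>D. \<bar>U x - U' x\<bar> \<le> \<epsilon>) \<and> (\<forall>x\<in>D. \<bar>0 - v' x\<bar> \<le> \<epsilon>)" if "\<epsilon> > 0" for \<epsilon> :: real
      using weak_laplacian_of_C2[OF D h'(1)] Ck_on_imp_continuous[OF h'(1)] Ck_on_laplacian[OF D, of 0 U] h' that
      by (intro exI[of _ U] exI[of _ "laplacian U"]) (auto simp del: Ck_on.simps(2) simp: Ck_on_imp_continuous)
  qed (use Ck_on_imp_continuous[OF h'(1)] in auto)
qed

text \<open>
  The radius \<open>R\<close> is so large that the ball around \<open>x\<close> contains the support of \<open>v\<close>. The truncation of the kernel at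
  radius \<open>R\<close> is then invisible, and if \<open>k\<close> is an even polynomial
  the result is a polynomial in \<open>x\<close>.
\<close>

lemma kmean_eq_integral:
  fixes v :: "'a::euclidean_space \<Rightarrow> real"
  assumes K: "radial_kernel R DIM('a) k" and v: "continuous_on UNIV v"
    and supp: "\<And>y. norm y \<ge> \<rho> \<Longrightarrow> v y = 0" and x: "norm x + \<rho> \<le> R"
  shows "radial_kernel.kmean R DIM('a) k (spherical_mean v x) =
    (LINT y:cball 0 \<rho>|lborel. k (norm (x - y)) * v y) / (sphere_area TYPE('a) * integral {0..R} (\<lambda>s. k s * s ^ (DIM('a) - 1)))"
proof -
  interpret radial_kernel R "DIM('a)" k by (rule K)
  have R0: "R \<ge> 0" using R by simp
  have cxv: "continuous_on (cball 0 R) (\<lambda>z. v (x + z))" by (rule continuous_on_translate[OF v]) simp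
  have 1: "(LINT z:cball 0 R|lborel. k (norm z) * v (x + z)) =
    sphere_area TYPE('a) * integral {0..R} (\<lambda>s. k s * s ^ (DIM('a) - 1) * spherical_mean v x s)"
    using integral_cball_polar[OF cxv k_continuous R0] unfolding spherical_mean_translate[of v x, symmetric] .
  define H where "H y = indicator (cball x R) y *\<^sub>R (k (norm (y - x)) * v y)" for y
  have "continuous_on (cball x R) (\<lambda>y. k (norm (y - x)) * v y)"
    by (intro continuous_intros continuous_on_subset[OF v] continuous_on_compose2[OF k_continuous])
       (auto simp: dist_norm norm_minus_commute)
  then have Hm: "H \<in> borel_measurable borel"
    unfolding H_def by (intro borel_measurable_continuous_on_indicator) auto
  have "(LINT z:cball 0 R|lborel. k (norm z) * v (x + z)) = (LINT z|lborel. H (x + z))"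
    unfolding set_lebesgue_integral_def H_def
    by (rule Bochner_Integration.integral_cong) (auto simp: indicator_def dist_norm)
  also have "\<dots> = (LINT y|lborel. H y)" by (rule integral_translation_lborel[OF Hm])
  also have "\<dots> = (LINT y:cball 0 \<rho>|lborel. k (norm (x - y)) * v y)"
    unfolding set_lebesgue_integral_def
  proof (rule Bochner_Integration.integral_cong)
    fix y :: 'a
    show "H y = indicator (cball 0 \<rho>) y *\<^sub>R (k (norm (x - y)) * v y)"
    proof (cases "norm y \<le> \<rho>")
      case True
      then have "dist x y \<le> R" using x norm_triangle_ineq4[of x y] by (simp add: dist_norm)
      then show ?thesis using True unfolding H_def by (simp add: norm_minus_commute)
    next
      case False
      then show ?thesis using supp unfolding H_def by simp
    qed
  qed simp
  finally have 2: "sphere_area TYPE('a) * integral {0..R} (\<lambda>s. k s * s ^ (DIM('a) - 1) * spherical_mean v x s)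
     = (LINT y:cball 0 \<rho>|lborel. k (norm (x - y)) * v y)" using 1 by simp
  show ?thesis unfolding kmean_def 2[symmetric] using sphere_area_pos[where 'a='a] by simp
qed

lemma radial_kernel_one: "R > 0 \<Longrightarrow> n > 0 \<Longrightarrow> radial_kernel R n (\<lambda>_. 1)"
proof
  assume R: "R > 0" and n: "n > 0"
  show "integral {0..R} (\<lambda>s. 1 * s ^ (n - 1)) > 0"
    using jackson_kernel_mass[OF R n, of 0 0] R n
    by (simp) (metis divide_pos_pos less_le_trans of_nat_0_less_iff zero_less_power zero_less_divide_iff zero_less_numeral)
qed auto

text \<open>
  For the kernel \<open>k = 1\<close> the average of a function supported in the ball is the same constant at all points of a
  smaller ball. Hence Green's formula, averaged over the radius, says that \<open>- K(\<P>(S v))\<close> has Laplacian \<open>v\<close>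
  minus this constant, which a multiple of \<open>|x|\<^sup>2\<close> compensates. This holds classically for smooth \<open>v\<close>, and by
  uniform approximation weakly for continuous \<open>v\<close>.
\<close>

lemma weak_particular_solution:
  fixes v :: "'a::euclidean_space \<Rightarrow> real"
  assumes v: "continuous_on UNIV v" and supp: "\<And>y. norm y \<ge> \<rho> \<Longrightarrow> v y = 0" and \<rho>: "\<rho> > 0"
  obtains Q where "continuous_on UNIV Q" "weak_laplacian (ball 0 \<rho>) Q v"
proof -
  define R where "R = 2 * \<rho> + 1"
  have R: "R > 0" "R \<ge> 0" using \<rho> unfolding R_def by auto
  interpret K: radial_kernel R "DIM('a)" "\<lambda>_. 1" by (rule radial_kernel_one[OF R(1) DIM_positive])
  let ?n = "real DIM('a)"
  let ?P = "radial_potential DIM('a)"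
  define m where "m = sphere_area TYPE('a) * integral {0..R} (\<lambda>s. 1 * s ^ (DIM('a) - 1))"
  define c where "c u = (LINT y:cball 0 (\<rho> + 1)|lborel. 1 * u y) / m" for u :: "'a \<Rightarrow> real"
  define Q where "Q u x = (-1) * K.kmean (?P (spherical_mean (\<lambda>z. u (x + z)) 0)) + (c u / (2 * ?n)) * (norm x)\<^sup>2" for u :: "'a \<Rightarrow> real" and x
  note L = bounded_functional_of_profile[OF profile_functional_potential[OF K.kmean_functional R(2), of "DIM('a)"], where 'a = 'a]
  have smooth: "Ck_on 2 UNIV (Q u) \<and> weak_laplacian (ball 0 \<rho>) (Q u) u"
    if u: "Ck_on 2 UNIV u" and us: "\<And>y. norm y \<ge> \<rho> + 1 \<Longrightarrow> u y = 0" for u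
  proof -
    have cu: "continuous_on UNIV u" by (rule Ck_on_imp_continuous[OF u])
    have cl: "continuous_on UNIV (laplacian u)"
      using continuous_on_laplacian[OF open_UNIV] u by blast
    have Lu: "Ck_on 2 UNIV (\<lambda>x. K.kmean (?P (spherical_mean (\<lambda>z. u (x + z)) 0)))"
      using bounded_functional_Ck_on[OF L R(2) open_UNIV u] by simp
    have CQ: "Ck_on 2 UNIV (Q u)"
      unfolding Q_def[abs_def] by (rule Ck_on_lin[OF open_UNIV Lu Ck_on_norm_sq[OF open_UNIV]])
    have lap: "laplacian (Q u) x = u x" if x: "x \<in> ball 0 \<rho>" for x
    proof -
      have "laplacian (Q u) x = (-1) * laplacian (\<lambda>x. K.kmean (?P (spherical_mean (\<lambda>z. u (x + z)) 0))) x
         + (c u / (2 * ?n)) * laplacian (\<lambda>x. (norm x)\<^sup>2) x"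
        unfolding Q_def[abs_def]
        by (rule laplacian_lin(2)[OF open_UNIV Ck_on_2_laplacian_exists[OF Lu]
              Ck_on_2_laplacian_exists[OF Ck_on_norm_sq[OF open_UNIV]]]) simp
      also have "laplacian (\<lambda>x. K.kmean (?P (spherical_mean (\<lambda>z. u (x + z)) 0))) x
        = K.kmean (?P (spherical_mean (\<lambda>z. laplacian u (x + z)) 0))"
        by (rule bounded_functional_laplacian[OF L R(2) open_UNIV u]) simp
      also have "spherical_mean (\<lambda>z. laplacian u (x + z)) 0 = spherical_mean (laplacian u) x"
        using spherical_mean_translate[of "laplacian u" x] by presburger
      also have "K.kmean (?P (spherical_mean (laplacian u) x)) = K.kmean (spherical_mean u x) - u x"
      proof -
        have cs: "continuous_on {0..R} (spherical_mean (laplacian u) x)" "continuous_on {0..R} (spherical_mean u x)"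
          using spherical_mean_continuous_radius[OF cl] spherical_mean_continuous_radius[OF cu] by blast+
        have cP: "continuous_on {0..R} (?P (spherical_mean (laplacian u) x))" by (rule radial_potential_continuous[OF cs(1)])
        have "K.kmean (spherical_mean u x) = K.kmean (\<lambda>t. u x * 1 + 1 * ?P (spherical_mean (laplacian u) x) t)"
          by (rule profile_functional_cong[OF K.kmean_functional cs(2)])
             (use spherical_mean_green[OF u open_UNIV, of x R] in auto)
        also have "\<dots> = u x * K.kmean (\<lambda>_. 1) + 1 * K.kmean (?P (spherical_mean (laplacian u) x))"
          by (rule profile_functionalD(1)[OF K.kmean_functional continuous_on_const cP])
        finally show ?thesis by (simp add: K.kmean_const)
      qed
      also have "K.kmean (spherical_mean u x) = c u"
        unfolding c_def m_def
        by (rule kmean_eq_integral[OF K.radial_kernel_axioms cu us]) (use x in \<open>auto simp: R_def\<close>)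
      finally show ?thesis using laplacian_norm_sq[of x] by simp
    qed
    have "weak_laplacian (ball 0 \<rho>) (Q u) u"
    proof (rule weak_laplacian_limit)
      show "continuous_on (ball 0 \<rho>) (Q u)" "continuous_on (ball 0 \<rho>) u"
        using Ck_on_imp_continuous[OF CQ] cu by (auto intro: continuous_on_subset)
      show "\<exists>U' v'. weak_laplacian (ball 0 \<rho>) U' v' \<and> continuous_on (ball 0 \<rho>) U' \<and> continuous_on (ball 0 \<rho>) v' \<and>
        (\<forall>x\<in>ball 0 \<rho>. \<bar>Q u x - U' x\<bar> \<le> \<epsilon>) \<and> (\<forall>x\<in>ball 0 \<rho>. \<bar>u x - v' x\<bar> \<le> \<epsilon>)" if "\<epsilon> > 0" for \<epsilon> :: real
      proof (intro exI conjI ballI)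
        have CQ': "Ck_on 2 (ball 0 \<rho>) (Q u)" using CQ by (rule Ck_on_subset) simp
        show "weak_laplacian (ball 0 \<rho>) (Q u) (laplacian (Q u))" by (rule weak_laplacian_of_C2[OF open_ball CQ'])
        show "continuous_on (ball 0 \<rho>) (Q u)" by (rule Ck_on_imp_continuous[OF CQ'])
        show "continuous_on (ball 0 \<rho>) (laplacian (Q u))"
          using continuous_on_laplacian[OF open_ball] CQ' by blast
      qed (use that lap in auto)
    qed
    with CQ show ?thesis by blast
  qed
  have cQ: "continuous_on UNIV (Q u)" if u: "continuous_on UNIV u" for u
    unfolding Q_def[abs_def]
    using bounded_functional_continuous[OF L R(2) open_UNIV u] by (auto intro!: continuous_intros)
  have m0: "m > 0" unfolding m_def using sphere_area_pos[where 'a='a] K.k_mass by simp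
  define V :: real where "V = (LINT y:cball (0::'a) (\<rho> + 1)|lborel. \<bar>1\<bar>)"
  have LI: "bounded_functional (\<rho> + 1) V (\<lambda>u::'a \<Rightarrow> real. LINT y:cball 0 (\<rho> + 1)|lborel. 1 * u y)"
    unfolding V_def by (rule bounded_functional_integral[OF continuous_on_const])
  have V0: "V \<ge> 0" using bounded_functional_nonneg[OF LI] .
  have diff: "\<bar>Q u x - Q u' x\<bar> \<le> (R\<^sup>2 + V / m * \<rho>\<^sup>2) * \<epsilon>"
    if u: "continuous_on UNIV u" "continuous_on UNIV u'" and e: "\<And>y. \<bar>u y - u' y\<bar> \<le> \<epsilon>" and x: "x \<in> ball 0 \<rho>" for u u' x \<epsilon>
  proof -
    have e0: "\<epsilon> \<ge> 0" using e[of 0] by linarith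
    have 1: "\<bar>K.kmean (?P (spherical_mean (\<lambda>z. u (x + z)) 0)) - K.kmean (?P (spherical_mean (\<lambda>z. u' (x + z)) 0))\<bar> \<le> 1 * R\<^sup>2 * \<epsilon>"
      by (rule bounded_functional_diff_le[OF L continuous_on_translate[OF u(1)] continuous_on_translate[OF u(2)]]) (use e in auto)
    have "\<bar>(LINT y:cball 0 (\<rho> + 1)|lborel. 1 * u y) - (LINT y:cball 0 (\<rho> + 1)|lborel. 1 * u' y)\<bar> \<le> V * \<epsilon>"
      by (rule bounded_functional_diff_le[OF LI]) (use u e in \<open>auto intro: continuous_on_subset\<close>)
    then have "\<bar>c u - c u'\<bar> \<le> V / m * \<epsilon>" unfolding c_def using m0
      by (simp add: diff_divide_distrib[symmetric] abs_divide divide_right_mono)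
    then have "\<bar>c u - c u'\<bar> / (2 * ?n) \<le> V / m * \<epsilon> / (2 * ?n)" by (intro divide_right_mono) auto
    also have "\<dots> \<le> V / m * \<epsilon> / 1"
    proof (rule divide_left_mono)
      have "Suc 0 \<le> DIM('a)" using DIM_positive[where 'a='a] by (rule Suc_leI)
      then show "1 \<le> 2 * ?n" by linarith
    qed (use V0 m0 e0 in auto)
    finally have "\<bar>c u - c u'\<bar> / (2 * ?n) \<le> V / m * \<epsilon>" by simp
    then have "\<bar>c u - c u'\<bar> / (2 * ?n) * (norm x)\<^sup>2 \<le> (V / m * \<epsilon>) * \<rho>\<^sup>2"
      using x V0 m0 e0 by (intro mult_mono power_mono) auto
    then have 2: "\<bar>(c u / (2 * ?n)) * (norm x)\<^sup>2 - (c u' / (2 * ?n)) * (norm x)\<^sup>2\<bar> \<le> V / m * \<rho>\<^sup>2 * \<epsilon>"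
      by (simp add: left_diff_distrib[symmetric] diff_divide_distrib[symmetric] abs_mult abs_divide mult_ac)
    show ?thesis using 1 2 unfolding Q_def by (simp add: algebra_simps abs_le_iff)
  qed
  define C where "C = R\<^sup>2 + V / m * \<rho>\<^sup>2"
  have C: "C \<ge> 0" unfolding C_def using V0 m0 by simp
  have "weak_laplacian (ball 0 \<rho>) (Q v) v"
  proof (rule weak_laplacian_limit)
    show "continuous_on (ball 0 \<rho>) (Q v)" "continuous_on (ball 0 \<rho>) v"
      using cQ[OF v] v by (auto intro: continuous_on_subset)
    fix \<epsilon> :: real assume e: "\<epsilon> > 0"
    define \<eta> where "\<eta> = \<epsilon> / (1 + C)"
    have eta: "\<eta> > 0" "\<eta> \<le> \<epsilon>" "C * \<eta> \<le> \<epsilon>"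
    proof -
      have "C * \<epsilon> \<ge> 0" using C e by simp
      then show "\<eta> > 0" "\<eta> \<le> \<epsilon>" "C * \<eta> \<le> \<epsilon>"
        unfolding \<eta>_def using e C by (simp_all add: field_simps)
    qed
    obtain v' where v': "Ck_on 2 UNIV v'" "\<And>y. norm y \<ge> \<rho> + 1 \<Longrightarrow> v' y = 0" "\<And>x. \<bar>v x - v' x\<bar> \<le> \<eta>"
      using supp by (rule mollify_approx[where N = 2 and \<rho> = \<rho>, OF v _ eta(1)]) blast+
    have "Ck_on 2 UNIV (Q v')" "weak_laplacian (ball 0 \<rho>) (Q v') v'"
      using smooth[OF v'(1,2)] by auto
    moreover have "\<bar>Q v x - Q v' x\<bar> \<le> \<epsilon>" if "x \<in> ball 0 \<rho>" for x
      using diff[OF v Ck_on_imp_continuous[OF v'(1)] v'(3) that] eta(3) unfolding C_def[symmetric] by linarith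
    moreover have "\<bar>v x - v' x\<bar> \<le> \<epsilon>" for x using v'(3)[of x] eta(2) by linarith
    moreover have "continuous_on (ball 0 \<rho>) (Q v')" "continuous_on (ball 0 \<rho>) v'"
      using Ck_on_imp_continuous[OF v'(1)] Ck_on_imp_continuous[OF \<open>Ck_on 2 UNIV (Q v')\<close>]
      by (auto intro: continuous_on_subset)
    ultimately show "\<exists>U' v'. weak_laplacian (ball 0 \<rho>) U' v' \<and> continuous_on (ball 0 \<rho>) U' \<and> continuous_on (ball 0 \<rho>) v' \<and>
        (\<forall>x\<in>ball 0 \<rho>. \<bar>Q v x - U' x\<bar> \<le> \<epsilon>) \<and> (\<forall>x\<in>ball 0 \<rho>. \<bar>v x - v' x\<bar> \<le> \<epsilon>)"
      by (intro exI[of _ "Q v'"] exI[of _ v'] conjI ballI)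
  qed
  with cQ[OF v] show ?thesis using that by blast
qed

section \<open>Polyharmonic boundary value problems\<close>

lemma continuous_compact_extension:
  fixes v :: "'a::euclidean_space \<Rightarrow> real"
  assumes v: "continuous_on K v" and K: "compact K" "K \<subseteq> ball 0 \<rho>"
  obtains v' where "continuous_on UNIV v'" "\<And>x. x \<in> K \<Longrightarrow> v' x = v x" "\<And>y. norm y \<ge> \<rho> \<Longrightarrow> v' y = 0"
proof -
  have cl: "closed K" "closed (- ball 0 \<rho>)" using K(1) by (auto intro: compact_imp_closed)
  have "continuous_on (K \<union> - ball 0 \<rho>) (\<lambda>x. if x \<in> K then v x else 0)"
    by (rule continuous_on_cases[OF cl v continuous_on_const]) (use K(2) in auto)
  moreover have "closedin (top_of_set UNIV) (K \<union> - ball 0 \<rho>)" using closed_Un[OF cl] by (simp only: subtopology_UNIV closed_closedin)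
  ultimately obtain v' where v': "continuous_on UNIV v'" "\<And>x. x \<in> K \<union> - ball 0 \<rho> \<Longrightarrow> v' x = (if x \<in> K then v x else 0)"
    by (rule Tietze_unbounded) blast
  show ?thesis
  proof (rule that[OF v'(1)])
    show "v' x = v x" if "x \<in> K" for x using v'(2)[of x] that by simp
    show "v' y = 0" if "norm y \<ge> \<rho>" for y
    proof -
      have "y \<in> - ball 0 \<rho>" using that by simp
      then show ?thesis using v'(2)[of y] K(2) by auto
    qed
  qed
qed

text \<open>
  The right-hand side is smooth inside \<open>D\<close> but only continuous up to the boundary, so its extension to the
  space has a potential in the weak sense only. Regularity is local and needs \<open>v\<close> only inside \<open>D\<close>.
\<close>

lemma dirichlet_poisson:
  fixes D :: "'a::euclidean_space set"
  assumes D: "open D" "bounded D" "dirichlet_regular D"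
    and v: "continuous_on (closure D) v" "\<And>k. Ck_on k D v" and \<phi>: "continuous_on (frontier D) \<phi>"
  obtains U where "continuous_on (closure D) U" "\<And>k. Ck_on k D U"
    "\<And>x. x \<in> D \<Longrightarrow> laplacian U x = v x" "\<And>x. x \<in> frontier D \<Longrightarrow> U x = \<phi> x"
proof -
  have "bounded (closure D)" by (rule bounded_closure[OF D(2)])
  then obtain \<rho> where \<rho>: "\<rho> > 0" "closure D \<subseteq> ball 0 \<rho>"
    using bounded_subset_ballD[of "closure D" 0] by auto
  obtain v' where v': "continuous_on UNIV v'" "\<And>x. x \<in> closure D \<Longrightarrow> v' x = v x" "\<And>y. norm y \<ge> \<rho> \<Longrightarrow> v' y = 0"
    using continuous_compact_extension[OF v(1) _ \<rho>(2)] D(2) by (auto simp: compact_closure)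
  obtain Q where Q: "continuous_on UNIV Q" "weak_laplacian (ball 0 \<rho>) Q v'"
    using weak_particular_solution[OF v'(1,3) \<rho>(1)] by blast
  have sub: "D \<subseteq> closure D" "D \<subseteq> ball 0 \<rho>" using closure_subset[of D] \<rho>(2) by auto
  have "continuous_on (frontier D) (\<lambda>x. \<phi> x - Q x)"
    by (intro continuous_intros \<phi> continuous_on_subset[OF Q(1)]) simp
  from D(3)[unfolded dirichlet_regular_def, rule_format, OF this]
  obtain w where w: "continuous_on (closure D) w" "harmonic_on D w" "\<And>x. x \<in> frontier D \<Longrightarrow> w x = \<phi> x - Q x"
    by blast
  define U where "U x = Q x + w x" for x
  have cU: "continuous_on (closure D) U"
    unfolding U_def by (intro continuous_intros w(1) continuous_on_subset[OF Q(1)]) simp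
  have cv: "continuous_on D v" using v(1) sub(1) by (rule continuous_on_subset)
  have cv': "continuous_on D v'" using v'(1) by (rule continuous_on_subset) simp
  have "weak_laplacian D Q v'" using Q(2) sub(2) unfolding weak_laplacian_def by blast
  then have "weak_laplacian D (\<lambda>x. Q x + w x) (\<lambda>x. v' x + 0)"
    using cv' Q(1) w(1) sub(1)
    by (intro weak_laplacian_add weak_laplacian_harmonic D(1) w(2)) (auto intro: continuous_on_subset)
  then have "weak_laplacian D U v'" unfolding U_def by simp
  then have W: "weak_laplacian D U v"
  proof (intro weak_laplacian_limit)
    show "\<exists>U' v''. weak_laplacian D U' v'' \<and> continuous_on D U' \<and> continuous_on D v'' \<and>
      (\<forall>x\<in>D. \<bar>U x - U' x\<bar> \<le> \<epsilon>) \<and> (\<forall>x\<in>D. \<bar>v x - v'' x\<bar> \<le> \<epsilon>)" if "weak_laplacian D U v'" "\<epsilon> > 0" for \<epsilon> :: real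
      using that cv' cU sub(1) v'(2)
      by (intro exI[of _ U] exI[of _ v']) (auto intro: continuous_on_subset)
  qed (use cU cv sub in \<open>auto intro: continuous_on_subset\<close>)
  have CU: "Ck_on k D U" for k
    by (rule weak_laplacian_regularity[OF D(1) _ v(2) W]) (use cU sub in \<open>auto intro: continuous_on_subset\<close>)
  show ?thesis
  proof (rule that[of U])
    show "laplacian U x = v x" if "x \<in> D" for x
      by (rule weak_laplacian_classical[OF D(1) CU cv W that])
    show "U x = \<phi> x" if "x \<in> frontier D" for x using w(3)[OF that] unfolding U_def by simp
  qed (use cU CU in auto)
qed

lemma polyharmonic_chain_exists:
  fixes D :: "'a::euclidean_space set"
  assumes D: "open D" "bounded D" "dirichlet_regular D"
    and \<phi>: "\<And>j. j < r \<Longrightarrow> continuous_on (frontier D) (\<phi> j)"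
  shows "\<exists>h. (\<forall>j. continuous_on (closure D) (h j)) \<and> (\<forall>j k. Ck_on k D (h j)) \<and>
    (\<forall>j. \<forall>x\<in>D. laplacian (h j) x = h (Suc j) x) \<and> (\<forall>j<r. \<forall>x\<in>frontier D. h j x = \<phi> j x) \<and>
    (\<forall>j\<ge>r. \<forall>x. h j x = 0)"
  using \<phi>
proof (induction r arbitrary: \<phi>)
  case 0
  show ?case by (rule exI[of _ "\<lambda>_ _. 0"]) (use Ck_on_const[OF D(1)] in \<open>auto simp: laplacian_const\<close>)
next
  case (Suc r)
  obtain h where h: "\<And>j. continuous_on (closure D) (h j)" "\<And>j k. Ck_on k D (h j)"
    "\<And>j x. x \<in> D \<Longrightarrow> laplacian (h j) x = h (Suc j) x" "\<And>j x. j < r \<Longrightarrow> x \<in> frontier D \<Longrightarrow> h j x = \<phi> (Suc j) x"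
    "\<And>j x. j \<ge> r \<Longrightarrow> h j x = 0"
    using Suc.IH[of "\<lambda>j. \<phi> (Suc j)"] Suc.prems by (metis Suc_less_eq)
  obtain U where U: "continuous_on (closure D) U" "\<And>k. Ck_on k D U"
    "\<And>x. x \<in> D \<Longrightarrow> laplacian U x = h 0 x" "\<And>x. x \<in> frontier D \<Longrightarrow> U x = \<phi> 0 x"
    using dirichlet_poisson[OF D h(1,2) Suc.prems[of 0]] by blast
  define h' where "h' j = (case j of 0 \<Rightarrow> U | Suc i \<Rightarrow> h i)" for j
  show ?case
  proof (rule exI[of _ h'], intro conjI allI ballI impI)
    show "continuous_on (closure D) (h' j)" "Ck_on k D (h' j)" for j k
      unfolding h'_def using h U by (auto split: nat.split)
    show "laplacian (h' j) x = h' (Suc j) x" if "x \<in> D" for j x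
      unfolding h'_def using h(3) U(3) that by (auto split: nat.split)
    show "h' j x = \<phi> j x" if "j < Suc r" "x \<in> frontier D" for j x
      unfolding h'_def using h(4) U(4) that by (auto split: nat.split)
    show "h' j x = 0" if "Suc r \<le> j" for j x
      unfolding h'_def using h(5) that by (auto split: nat.split)
  qed
qed

lemma laplacian_funpow_chain:
  assumes D: "open D" and lap: "\<And>j x. x \<in> D \<Longrightarrow> laplacian (h j) x = h (Suc j) x" and x: "x \<in> D"
  shows "(laplacian ^^ i) (h j) x = h (j + i) x"
  using x
proof (induction i arbitrary: x)
  case (Suc i)
  have "laplacian ((laplacian ^^ i) (h j)) x = laplacian (h (j + i)) x"
    by (rule laplacian_cong[OF D Suc.prems]) (use Suc.IH in auto)
  then show ?case using lap[OF Suc.prems] by simp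
qed simp

text \<open>
  A point of the closure outside the open set \<open>D\<close> is a limit point of \<open>D\<close>, so the limit that defines the boundary
  value of the iterated Laplacian is the value of its continuous extension.
\<close>

lemma laplacian_cl_eq:
  fixes D :: "'a::euclidean_space set"
  assumes D: "open D" and u: "continuous_on (closure D) u" and eq: "\<And>x. x \<in> D \<Longrightarrow> (laplacian ^^ j) f x = u x"
    and j: "j > 0" and x: "x \<in> closure D"
  shows "laplacian_cl D j f x = u x"
proof (cases "x \<in> D")
  case True
  then show ?thesis using eq by (simp add: laplacian_cl_def)
next
  case False
  have "x islimpt D" using False x by (simp add: closure_def)
  then have nb: "at x within D \<noteq> bot" by (simp add: trivial_limit_within)
  have "(u \<longlongrightarrow> u x) (at x within closure D)" using u x by (auto simp: continuous_on_def)
  then have "(u \<longlongrightarrow> u x) (at x within D)" by (rule tendsto_within_subset) (rule closure_subset)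
  then have "((laplacian ^^ j) f \<longlongrightarrow> u x) (at x within D)"
    by (rule Lim_transform_eventually) (auto simp: eventually_at_filter eq)
  then have "Lim (at x within D) ((laplacian ^^ j) f) = u x" by (rule tendsto_Lim[OF nb])
  then show ?thesis using False j by (simp add: laplacian_cl_def)
qed

lemma laplacian_cl_chain:
  fixes D :: "'a::euclidean_space set"
  assumes D: "open D" and c: "continuous_on (closure D) (h j)"
    and lap: "\<And>j x. x \<in> D \<Longrightarrow> laplacian (h j) x = h (Suc j) x" and x: "x \<in> closure D"
  shows "laplacian_cl D j (h 0) x = h j x"
proof (cases "j = 0")
  case True then show ?thesis by (simp add: laplacian_cl_def)
next
  case False
  show ?thesis
  proof (rule laplacian_cl_eq[OF D c _ _ x])
    show "(laplacian ^^ j) (h 0) y = h j y" if "y \<in> D" for y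
      using laplacian_funpow_chain[where h = h and j = 0, OF D lap that] by simp
  qed (use False in simp)
qed

lemma laplacian_cl_in: "x \<in> D \<Longrightarrow> laplacian_cl D j f x = (laplacian ^^ j) f x"
  by (simp add: laplacian_cl_def)

lemma laplacian_of_laplacian_cl:
  assumes D: "open D" and ex: "laplacian_exists_on D ((laplacian ^^ j) f)"
  shows "laplacian_exists_on D (laplacian_cl D j f)"
    and "x \<in> D \<Longrightarrow> laplacian (laplacian_cl D j f) x = laplacian_cl D (Suc j) f x"
proof -
  have e: "\<forall>y\<in>D. (laplacian ^^ j) f y = laplacian_cl D j f y" by (simp add: laplacian_cl_def)
  show "laplacian_exists_on D (laplacian_cl D j f)" by (rule laplacian_exists_on_cong[OF D e ex])
  show "laplacian (laplacian_cl D j f) x = laplacian_cl D (Suc j) f x" if "x \<in> D"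
    using laplacian_cong[OF D that e] laplacian_cl_in[OF that, of "Suc j" f] by simp
qed

text \<open>
  The solution chosen in the definition agrees on the closure with the one constructed here, by uniqueness. The
  construction adds that all iterates are smooth of every order, which the definition only states up
  to order \<open>2r + 2\<close>.
\<close>

lemma bvp_solution_eq_chain:
  fixes D :: "'a::euclidean_space set"
  assumes D: "open D" "bounded D" "dirichlet_regular D" and f: "f \<in> HC r D"
  obtains h where "\<And>j. continuous_on (closure D) (h j)" "\<And>j k. Ck_on k D (h j)"
    "\<And>j x. x \<in> D \<Longrightarrow> laplacian (h j) x = h (Suc j) x"
    "\<And>j x. j \<le> r \<Longrightarrow> x \<in> frontier D \<Longrightarrow> h j x = laplacian_cl D j f x"
    "\<And>j x. j > r \<Longrightarrow> h j x = 0"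
    "\<And>j x. j \<le> r \<Longrightarrow> x \<in> closure D \<Longrightarrow> laplacian_cl D j (bvp_solution r D f) x = h j x"
proof -
  have fr: "frontier D \<subseteq> closure D" by (simp add: frontier_def)
  have "continuous_on (frontier D) (laplacian_cl D j f)" if "j < Suc r" for j
    using f that fr continuous_on_subset unfolding HC_def less_Suc_eq_le by blast
  from polyharmonic_chain_exists[where r = "Suc r" and \<phi> = "\<lambda>j. laplacian_cl D j f", OF D this]
  obtain h where h': "\<forall>j. continuous_on (closure D) (h j)" "\<forall>j k. Ck_on k D (h j)"
    "\<forall>j. \<forall>x\<in>D. laplacian (h j) x = h (Suc j) x"
    "\<forall>j<Suc r. \<forall>x\<in>frontier D. h j x = laplacian_cl D j f x" "\<forall>j\<ge>Suc r. \<forall>x. h j x = 0"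
    by blast
  note h = h'[rule_format]
  have clh: "laplacian_cl D j (h 0) x = h j x" if "x \<in> closure D" for j x
    by (rule laplacian_cl_chain[where h = h, OF D(1) h(1) h(3) that])
  have "polyharmonic_bvp r D f (h 0)"
    unfolding polyharmonic_bvp_def polyharmonic_on_def
  proof (intro conjI allI impI ballI)
    show "(laplacian ^^ (r + 1)) (h 0) x = 0" if "x \<in> D" for x
      using laplacian_funpow_chain[where h = h and j = 0 and i = "r + 1", OF D(1) h(3) that] h(5) by simp
    show "continuous_on (closure D) (laplacian_cl D j (h 0))" for j
      using h(1)[of j] by (rule continuous_on_eq) (use clh in auto)
    show "laplacian_cl D j (h 0) x = laplacian_cl D j f x" if "j \<le> r" "x \<in> frontier D" for j x
      using clh[of x j] h(4)[of j x] that fr by auto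
  qed (use h(2) in auto)
  then have bvp: "polyharmonic_bvp r D f (bvp_solution r D f)"
    unfolding bvp_solution_def by (rule someI[where P = "polyharmonic_bvp r D f"])
  define b where "b = bvp_solution r D f"
  have b: "Ck_on (2 * (r + 1)) D b" "\<And>x. x \<in> D \<Longrightarrow> (laplacian ^^ (r + 1)) b x = 0"
    "\<And>j. j \<le> r \<Longrightarrow> continuous_on (closure D) (laplacian_cl D j b)"
    "\<And>j x. j \<le> r \<Longrightarrow> x \<in> frontier D \<Longrightarrow> laplacian_cl D j b x = laplacian_cl D j f x"
    using bvp unfolding polyharmonic_bvp_def polyharmonic_on_def b_def by auto
  have bd: "bounded (closure D)" by (rule bounded_closure[OF D(2)])
  then obtain \<rho> where \<rho>: "\<rho> > 0" "closure D \<subseteq> ball 0 \<rho>"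
    using bounded_subset_ballD[of "closure D" 0] by auto
  then have D\<rho>: "D \<subseteq> ball 0 \<rho>" using closure_subset by blast
  have eq: "laplacian_cl D i b y = h i y" if i: "i \<le> r" and y: "y \<in> closure D" for i y
  proof -
    define d where "d j x = (if j + i \<le> r then 1 * laplacian_cl D (j + i) b x + (-1) * h (j + i) x else 0)" for j x
    have exb: "laplacian_exists_on D ((laplacian ^^ j) b)" if "j \<le> r" for j
    proof -
      have "Ck_on (2 + 2 * j) D b" by (rule Ck_on_mono[OF b(1)]) (use that in simp)
      then have "Ck_on 2 D ((laplacian ^^ j) b)" by (rule Ck_on_laplacian_funpow[OF D(1)])
      then show ?thesis by (rule Ck_on_2_laplacian_exists)
    qed
    note exc = laplacian_of_laplacian_cl[OF D(1) exb]
    have exh: "laplacian_exists_on D (h j)" for j by (rule Ck_on_2_laplacian_exists[OF h(2)])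
    have "\<bar>d 0 y\<bar> \<le> (\<rho>\<^sup>2) ^ (Suc r - i) * 0"
    proof (rule laplacian_chain_bound[OF D(1) D\<rho>])
      fix j assume j: "j < Suc r - i"
      then have ji: "j + i \<le> r" by simp
      then have dj: "d j = (\<lambda>x. 1 * laplacian_cl D (j + i) b x + (-1) * h (j + i) x)"
        unfolding d_def by auto
      show "continuous_on (closure D) (d j)" unfolding dj by (intro continuous_intros b(3) ji h(1))
      show "laplacian_exists_on D (d j)" unfolding dj by (rule laplacian_lin(1)[OF D(1) exc(1)[OF ji] exh])
      show "d j x = 0" if "x \<in> frontier D" for x
        unfolding dj using b(4)[OF ji that] h(4)[of "j + i" x] ji that by simp
      show "laplacian (d j) x = d (Suc j) x" if x: "x \<in> D" for x
      proof -
        have l: "laplacian (d j) x = 1 * laplacian_cl D (Suc (j + i)) b x + (-1) * h (Suc (j + i)) x"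
          unfolding dj using laplacian_lin(2)[OF D(1) exc(1)[OF ji] exh x, of 1 "-1"] exc(2)[OF ji x] h(3)[OF x] by simp
        show ?thesis
        proof (cases "Suc (j + i) \<le> r")
          case True
          then show ?thesis using l unfolding d_def by simp
        next
          case False
          then have "Suc (j + i) = r + 1" using ji by simp
          then show ?thesis using l b(2)[OF x] h(5)[of "r + 1" x] False unfolding d_def laplacian_cl_in[OF x] by simp
        qed
      qed
    qed (use y i in \<open>auto simp: d_def\<close>)
    then show ?thesis using i unfolding d_def by simp
  qed
  show ?thesis
    by (rule that[of h]) (use h eq b_def in auto)
qed

section \<open>Polynomial potentials\<close>

text \<open>
  The product of the factors that turn \<open>|x|\<^bsup>2i\<^esup>\<close> into a constant under \<open>\<Delta>\<^sup>i\<close>.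
\<close>

primrec almansi_factor :: "nat \<Rightarrow> nat \<Rightarrow> real" where
  "almansi_factor n 0 = 1"
| "almansi_factor n (Suc i) = (2 * real i + 2) * (2 * real i + real n) * almansi_factor n i"

lemma almansi_factor_pos: "n > 0 \<Longrightarrow> almansi_factor n i > 0"
  by (induction i) auto

text \<open>
  Dividing the convolutions of \<open>G\<close> with even powers of the norm by these factors yields a
  sequence in which the Laplacian lowers the index by one.
\<close>

lemma norm_power_potentials:
  fixes G :: "'a::euclidean_space \<Rightarrow> real"
  assumes G: "continuous_on UNIV G"
  obtains N :: "nat \<Rightarrow> 'a \<Rightarrow> real" where "\<And>i k. Ck_on k UNIV (N i)" "\<And>i x. laplacian (N (Suc i)) x = N i x" "\<And>x. laplacian (N 0) x = 0"
    "\<And>i x. (LINT y:cball 0 \<rho>|lborel. norm (x - y) ^ (2 * i) * G y) = almansi_factor DIM('a) i * N i x"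
proof (cases "\<rho> \<ge> 0")
  case False
  then have "cball (0::'a) \<rho> = {}" by simp
  then show ?thesis
    by (intro that[of "\<lambda>_ _. 0"]) (auto simp: laplacian_const Ck_on_const set_lebesgue_integral_def)
next
  case \<rho>: True
  let ?n = "DIM('a)"
  define L where "L u = (LINT z:cball 0 \<rho>|lborel. G (- z) * u z)" for u :: "'a \<Rightarrow> real"
  have cG: "continuous_on S (\<lambda>z. G (- z))" for S
    by (rule continuous_on_compose2[OF G]) (auto intro!: continuous_intros)
  have L: "bounded_functional \<rho> (LINT z:cball 0 \<rho>|lborel. \<bar>G (- z)\<bar>) L"
    unfolding L_def by (rule bounded_functional_integral[OF cG])
  \<comment> \<open>The reflection in \<open>L\<close> turns translates \<open>x + z\<close> into differences \<open>x - y\<close>.\<close>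
  define w where "w i y = norm y ^ (2 * i)" for i and y :: 'a
  have Cw: "Ck_on k UNIV (w i)" for i k unfolding w_def by (intro Ck_on_norm_power) simp
  define M where "M i x = L (\<lambda>z. w i (x + z))" for i x
  have CM: "Ck_on k UNIV (M i)" for i k
    using bounded_functional_Ck_on[OF L \<rho> open_UNIV Cw] unfolding M_def by simp
  have LM: "laplacian (M i) x = L (\<lambda>z. laplacian (w i) (x + z))" for i x
    unfolding M_def by (rule bounded_functional_laplacian[OF L \<rho> open_UNIV Cw]) simp
  have cw: "continuous_on (cball 0 \<rho>) (\<lambda>z. w i (x + z))" for i x
    by (rule continuous_on_translate[OF Ck_on_imp_continuous[OF Cw]]) simp
  have LS: "laplacian (M (Suc i)) x = (2 * real i + 2) * (2 * real i + real ?n) * M i x" for i x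
    unfolding LM using bounded_functionalD(1)[OF L cw cw, of "(2 * real i + 2) * (2 * real i + real ?n)" i x 0 i x]
    unfolding M_def w_def laplacian_norm_power by simp
  have L0: "laplacian (M 0) x = 0" for x
    unfolding LM w_def using bounded_functionalD(1)[OF L cw cw, of 0 0 x 0 0 x] by (simp add: laplacian_const)
  have int: "(LINT y:cball 0 \<rho>|lborel. norm (x - y) ^ (2 * i) * G y) = M i x" for i x
  proof -
    define f where "f y = indicator (cball 0 \<rho>) y *\<^sub>R (norm (x - y) ^ (2 * i) * G y)" for y
    have "continuous_on (cball 0 \<rho>) (\<lambda>y. norm (x - y) ^ (2 * i) * G y)"
      by (intro continuous_intros continuous_on_subset[OF G]) simp
    then have fm: "f \<in> borel_measurable borel"
      unfolding f_def by (intro borel_measurable_continuous_on_indicator) auto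
    have "(LINT y:cball 0 \<rho>|lborel. norm (x - y) ^ (2 * i) * G y) = (LINT y|lborel. f y)"
      unfolding set_lebesgue_integral_def f_def ..
    also have "\<dots> = (LINT y|lborel. f (- y))" by (rule integral_lborel_reflect[OF fm, symmetric])
    also have "\<dots> = M i x"
      unfolding M_def L_def w_def set_lebesgue_integral_def f_def
      by (rule Bochner_Integration.integral_cong) (auto simp: indicator_def mult.commute)
    finally show ?thesis .
  qed
  have pos: "almansi_factor ?n i > 0" for i by (rule almansi_factor_pos) simp
  define N where "N i x = (1 / almansi_factor ?n i) * M i x + 0 * M i x" for i x
  have LN: "laplacian (N i) x = (1 / almansi_factor ?n i) * laplacian (M i) x" for i x
    unfolding N_def using laplacian_lin_C2[OF open_UNIV CM CM, of x "1 / almansi_factor ?n i" i 0 i] by simp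
  show ?thesis
  proof (rule that[of N])
    show "Ck_on k UNIV (N i)" for i k unfolding N_def by (intro Ck_on_lin CM) simp
    show "laplacian (N (Suc i)) x = N i x" for i x
    proof -
      have "real ?n > 0" by simp
      then have "2 * real i + real ?n > 0" by linarith
      then have "(2 * real i + 2) * (2 * real i + real ?n) \<noteq> 0" by simp
      then show ?thesis unfolding LN LS N_def by simp
    qed
    show "laplacian (N 0) x = 0" for x unfolding LN L0 by simp
    show "(LINT y:cball 0 \<rho>|lborel. norm (x - y) ^ (2 * i) * G y) = almansi_factor ?n i * N i x" for i x
      using pos[of i] unfolding int N_def by simp
  qed
qed

definition bump_constant :: "nat \<Rightarrow> real" where
  "bump_constant n = (24 + 6 * real n) * (real n * 2 ^ n * (4 / 3) ^ 3)"

lemma bump_constant_nonneg: "bump_constant n \<ge> 0"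
  unfolding bump_constant_def by simp

text \<open>
  The average of \<open>v\<close> with weight \<open>(\<delta>\<^sup>2 - |z|\<^sup>2)\<^sup>3\<close> differs from \<open>v\<close> by an average of the differences \<open>S\<^sub>s v - v\<close>. By Green's identity
  its Laplacian is an integral of \<open>v\<close> against the Laplacian of the weight. That Laplacian is radial and has integral
  zero, so this too is an integral of the differences \<open>S\<^sub>s v - v\<close>, and scaling supplies the factor \<open>\<delta>\<^bsup>-2\<^esup>\<close>.
\<close>

lemma regularisation_at_scale:
  fixes v :: "'a::euclidean_space \<Rightarrow> real"
  assumes v: "Ck_on 2 UNIV v" and d: "\<delta> > 0"
    and W: "\<And>s x. 0 < s \<Longrightarrow> s \<le> \<delta> \<Longrightarrow> \<bar>spherical_mean v x s - v x\<bar> \<le> W"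
  obtains g where "Ck_on 2 UNIV g" "\<And>x. \<bar>v x - g x\<bar> \<le> W" "\<And>x. \<bar>laplacian g x\<bar> \<le> bump_constant DIM('a) / \<delta>\<^sup>2 * W"
    "\<And>\<rho>. \<forall>y. norm y \<ge> \<rho> \<longrightarrow> v y = 0 \<Longrightarrow> \<forall>y. norm y \<ge> \<rho> + \<delta> \<longrightarrow> g y = 0"
proof -
  let ?n = "DIM('a)"
  let ?A = "sphere_area TYPE('a)"
  have A: "?A > 0" by (rule sphere_area_pos)
  have d0: "\<delta> \<ge> 0" using d by simp
  let ?q = "\<lambda>s. (\<delta>\<^sup>2 - s\<^sup>2) ^ 3 :: real"
  let ?k = "\<lambda>s. 24 * s\<^sup>2 * (\<delta>\<^sup>2 - s\<^sup>2) - 6 * real ?n * (\<delta>\<^sup>2 - s\<^sup>2)\<^sup>2 :: real"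
  have cv: "continuous_on UNIV v" by (rule Ck_on_imp_continuous[OF v])
  have W0: "W \<ge> 0" using W[OF d order_refl, of 0] by linarith
  define m where "m = integral {0..\<delta>} (\<lambda>s. ?q s * s ^ (?n - 1))"
  have m: "m > 0" unfolding m_def by (rule integral_radial_bump_pos[OF d])
  define g where "g x = (1 / (?A * m)) * (LINT z:cball 0 \<delta>|lborel. ?q (norm z) * v (x + z))" for x
  have cq: "continuous_on (cball (0::'a) \<delta>) (\<lambda>z. ?q (norm z))" by (intro continuous_intros)
  note L = bounded_functional_integral[OF cq]
  have CL: "Ck_on 2 UNIV (\<lambda>x. LINT z:cball 0 \<delta>|lborel. ?q (norm z) * v (x + z))"
    using bounded_functional_Ck_on[OF L d0 open_UNIV v] by simp
  have Cg: "Ck_on 2 UNIV g"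
    unfolding g_def[abs_def] by (rule Ck_on_cmult[OF open_UNIV CL])
  have cvx: "continuous_on (cball 0 R) (\<lambda>z. v (x + z))" for R x by (rule continuous_on_translate[OF cv]) simp
  have cS: "continuous_on {0..\<delta>} (spherical_mean v x)" for x
    by (rule spherical_mean_continuous_radius[OF cv]) simp
  have SW: "\<bar>spherical_mean v x s - v x\<bar> \<le> W" if "s \<in> {0..\<delta>}" for x s
    using W[of s x] that W0 by (cases "s = 0") (auto simp: spherical_mean_0)
  have pol: "(LINT z:cball 0 \<delta>|lborel. k (norm z) * v (x + z)) = ?A * integral {0..\<delta>} (\<lambda>s. k s * s ^ (?n - 1) * spherical_mean v x s)"
    if "continuous_on {0..\<delta>} k" for k x
    using integral_cball_polar[OF cvx[where x = x] that d0] unfolding spherical_mean_translate[of v x, symmetric] .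
  have ck: "continuous_on {0..\<delta>} ?q" "continuous_on {0..\<delta>} ?k" by (intro continuous_intros)+
  have est: "\<bar>integral {0..\<delta>} (\<lambda>s. k s * s ^ (?n - 1) * spherical_mean v x s) - v x * integral {0..\<delta>} (\<lambda>s. k s * s ^ (?n - 1))\<bar>
     \<le> integral {0..\<delta>} (\<lambda>s. \<bar>k s\<bar> * s ^ (?n - 1)) * W" if k: "continuous_on {0..\<delta>} k" for k x
  proof -
    let ?f = "\<lambda>s. k s * s ^ (?n - 1) * spherical_mean v x s" and ?h = "\<lambda>s. v x * (k s * s ^ (?n - 1))"
    have i: "?f integrable_on {0..\<delta>}" "?h integrable_on {0..\<delta>}"
      by (intro integrable_continuous_interval continuous_intros k cS)+
    have "integral {0..\<delta>} ?f - integral {0..\<delta>} ?h = integral {0..\<delta>} (\<lambda>s. ?f s - ?h s)"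
      using i by (simp only: integral_diff)
    moreover have "norm (integral {0..\<delta>} (\<lambda>s. ?f s - ?h s)) \<le> integral {0..\<delta>} (\<lambda>s. \<bar>k s\<bar> * s ^ (?n - 1) * W)"
    proof (rule integral_norm_bound_integral)
      show "(\<lambda>s. ?f s - ?h s) integrable_on {0..\<delta>}" "(\<lambda>s. \<bar>k s\<bar> * s ^ (?n - 1) * W) integrable_on {0..\<delta>}"
        by (intro integrable_continuous_interval continuous_intros k cS)+
      fix s assume s: "s \<in> {0..\<delta>}"
      have "norm (?f s - ?h s) = \<bar>k s\<bar> * s ^ (?n - 1) * \<bar>spherical_mean v x s - v x\<bar>"
      proof -
        have "?f s - ?h s = k s * s ^ (?n - 1) * (spherical_mean v x s - v x)" by (simp add: algebra_simps)
        then show ?thesis using s by (simp add: abs_mult)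
      qed
      also have "\<dots> \<le> \<bar>k s\<bar> * s ^ (?n - 1) * W" using s SW by (intro mult_left_mono) auto
      finally show "norm (?f s - ?h s) \<le> \<bar>k s\<bar> * s ^ (?n - 1) * W" .
    qed
    ultimately show ?thesis by simp
  qed
  have close: "\<bar>v x - g x\<bar> \<le> W" for x
  proof -
    have "integral {0..\<delta>} (\<lambda>s. \<bar>?q s\<bar> * s ^ (?n - 1)) = m"
      unfolding m_def
    proof (rule integral_cong)
      fix s assume "s \<in> {0..\<delta>}"
      then have "s\<^sup>2 \<le> \<delta>\<^sup>2" by (intro power_mono) auto
      then show "\<bar>?q s\<bar> * s ^ (?n - 1) = ?q s * s ^ (?n - 1)" by simp
    qed
    then have "\<bar>integral {0..\<delta>} (\<lambda>s. ?q s * s ^ (?n - 1) * spherical_mean v x s) - v x * m\<bar> \<le> m * W"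
      using est[OF ck(1), of x] unfolding m_def by simp
    moreover have "g x = integral {0..\<delta>} (\<lambda>s. ?q s * s ^ (?n - 1) * spherical_mean v x s) / m"
      unfolding g_def pol[OF ck(1)] using A by simp
    ultimately have "\<bar>m * g x - m * v x\<bar> \<le> m * W" using m by (simp add: mult.commute)
    then have "m * \<bar>g x - v x\<bar> \<le> m * W" using m by (simp add: right_diff_distrib[symmetric] abs_mult)
    then show ?thesis using m by (simp add: abs_minus_commute)
  qed
  \<comment> \<open>Green's identity for the constant function \<open>1\<close>.\<close>
  have k0: "integral {0..\<delta>} (\<lambda>s. ?k s * s ^ (?n - 1)) = 0"
  proof -
    have "(LINT z:cball 0 \<delta>|lborel. (\<delta>\<^sup>2 - (norm z)\<^sup>2) ^ 3 * laplacian (\<lambda>_::'a. 1) (0 + z)) =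
      (LINT z:cball 0 \<delta>|lborel. ?k (norm z) * (\<lambda>_::'a. 1) (0 + z))"
      by (rule integral_bump_laplacian[OF Ck_on_const[OF open_UNIV] open_UNIV _ d]) simp
    moreover have "(LINT z:cball (0::'a) \<delta>|lborel. ?k (norm z) * 1) = ?A * integral {0..\<delta>} (\<lambda>s. ?k s * s ^ (?n - 1) * spherical_mean (\<lambda>_::'a. 1) 0 s)"
      by (rule integral_cball_polar[OF continuous_on_const ck(2) d0])
    ultimately show ?thesis using A by (simp add: laplacian_const spherical_mean_const)
  qed
  have mlow: "m \<ge> (3 / 4 * \<delta>\<^sup>2) ^ 3 * (\<delta> / 2) ^ ?n / real ?n"
  proof -
    let ?b = "\<delta> / 2"
    have b: "0 \<le> ?b" "?b \<le> \<delta>" using d by auto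
    have "((\<lambda>s. (3 / 4 * \<delta>\<^sup>2) ^ 3 * s ^ (?n - 1)) has_integral ((3 / 4 * \<delta>\<^sup>2) ^ 3 * ?b ^ ?n / real ?n - (3 / 4 * \<delta>\<^sup>2) ^ 3 * 0 ^ ?n / real ?n)) {0..?b}"
      by (rule fundamental_theorem_of_calculus[OF b(1)])
         (auto intro!: derivative_eq_intros simp: has_real_derivative_iff_has_vector_derivative[symmetric])
    then have HI: "((\<lambda>s. (3 / 4 * \<delta>\<^sup>2) ^ 3 * s ^ (?n - 1)) has_integral ((3 / 4 * \<delta>\<^sup>2) ^ 3 * ?b ^ ?n / real ?n)) {0..?b}"
      by (simp add: power_0_left)
    have "(3 / 4 * \<delta>\<^sup>2) ^ 3 * ?b ^ ?n / real ?n = integral {0..?b} (\<lambda>s. (3 / 4 * \<delta>\<^sup>2) ^ 3 * s ^ (?n - 1))"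
      by (rule integral_unique[OF HI, symmetric])
    also have "\<dots> \<le> integral {0..?b} (\<lambda>s. ?q s * s ^ (?n - 1))"
    proof (rule integral_le)
      show "(\<lambda>s. (3 / 4 * \<delta>\<^sup>2) ^ 3 * s ^ (?n - 1)) integrable_on {0..?b}" using HI by blast
      show "(\<lambda>s. ?q s * s ^ (?n - 1)) integrable_on {0..?b}"
        by (intro integrable_continuous_interval continuous_intros)
      fix s assume s: "s \<in> {0..?b}"
      have "s\<^sup>2 \<le> ?b\<^sup>2" using s by (intro power_mono) auto
      then have "3 / 4 * \<delta>\<^sup>2 \<le> \<delta>\<^sup>2 - s\<^sup>2" by (simp add: power_divide)
      then show "(3 / 4 * \<delta>\<^sup>2) ^ 3 * s ^ (?n - 1) \<le> ?q s * s ^ (?n - 1)"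
        using s by (intro mult_right_mono power_mono) auto
    qed
    also have "\<dots> \<le> m" unfolding m_def
    proof (rule integral_subset_le)
      show "(\<lambda>s. ?q s * s ^ (?n - 1)) integrable_on {0..?b}" "(\<lambda>s. ?q s * s ^ (?n - 1)) integrable_on {0..\<delta>}"
        by (intro integrable_continuous_interval continuous_intros)+
      show "\<forall>s\<in>{0..\<delta>}. 0 \<le> ?q s * s ^ (?n - 1)"
        by (auto intro!: mult_nonneg_nonneg power_mono)
    qed (use b in auto)
    finally show ?thesis .
  qed
  have kup: "integral {0..\<delta>} (\<lambda>s. \<bar>?k s\<bar> * s ^ (?n - 1)) \<le> (24 + 6 * real ?n) * \<delta> ^ (4 + ?n)"
  proof -
    have "norm (integral {0..\<delta>} (\<lambda>s. \<bar>?k s\<bar> * s ^ (?n - 1))) \<le> ((24 + 6 * real ?n) * \<delta> ^ 4 * \<delta> ^ (?n - 1)) * measure lborel {0..\<delta>}"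
    proof (rule has_integral_bound_real[OF _ _ integrable_integral])
      show "(\<lambda>s. \<bar>?k s\<bar> * s ^ (?n - 1)) integrable_on {0..\<delta>}"
        by (intro integrable_continuous_interval continuous_intros)
      show "\<And>s. s \<in> {0..\<delta>} - {} \<Longrightarrow> norm (\<bar>?k s\<bar> * s ^ (?n - 1)) \<le> (24 + 6 * real ?n) * \<delta> ^ 4 * \<delta> ^ (?n - 1)"
      proof -
        fix s assume "s \<in> {0..\<delta>} - {}"
        then have s: "0 \<le> s" "s \<le> \<delta>" by auto
        have s2: "s\<^sup>2 \<le> \<delta>\<^sup>2" "0 \<le> \<delta>\<^sup>2 - s\<^sup>2" "\<delta>\<^sup>2 - s\<^sup>2 \<le> \<delta>\<^sup>2" using s by (auto intro: power_mono)
        have e1: "24 * s\<^sup>2 * (\<delta>\<^sup>2 - s\<^sup>2) \<le> 24 * \<delta>\<^sup>2 * \<delta>\<^sup>2" using s2 by (intro mult_mono) auto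
        have e2: "6 * real ?n * (\<delta>\<^sup>2 - s\<^sup>2)\<^sup>2 \<le> 6 * real ?n * (\<delta>\<^sup>2)\<^sup>2" using s2 by (intro mult_left_mono power_mono) auto
        have "0 \<le> 24 * s\<^sup>2 * (\<delta>\<^sup>2 - s\<^sup>2)" "0 \<le> 6 * real ?n * (\<delta>\<^sup>2 - s\<^sup>2)\<^sup>2" using s2 by auto
        then have "\<bar>?k s\<bar> \<le> 24 * \<delta>\<^sup>2 * \<delta>\<^sup>2 + 6 * real ?n * (\<delta>\<^sup>2)\<^sup>2" using e1 e2 by linarith
        also have "\<dots> = (24 + 6 * real ?n) * \<delta> ^ 4" by (simp add: algebra_simps power2_eq_square eval_nat_numeral)
        finally have "\<bar>?k s\<bar> * s ^ (?n - 1) \<le> (24 + 6 * real ?n) * \<delta> ^ 4 * \<delta> ^ (?n - 1)"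
          using s d by (intro mult_mono power_mono) auto
        then show "norm (\<bar>?k s\<bar> * s ^ (?n - 1)) \<le> (24 + 6 * real ?n) * \<delta> ^ 4 * \<delta> ^ (?n - 1)" using s by (simp add: abs_mult)
      qed
    qed (use d in auto)
    also have "\<dots> = (24 + 6 * real ?n) * (\<delta> ^ 4 * (\<delta> ^ (?n - 1) * \<delta>))" using d by (simp add: mult.assoc)
    also have "\<delta> ^ (?n - 1) * \<delta> = \<delta> ^ ?n" by (rule power_minus_mult) simp
    finally show ?thesis by (simp add: power_add)
  qed
  have lap: "\<bar>laplacian g x\<bar> \<le> bump_constant ?n / \<delta>\<^sup>2 * W" for x
  proof -
    have "laplacian g x = (1 / (?A * m)) * laplacian (\<lambda>x. LINT z:cball 0 \<delta>|lborel. ?q (norm z) * v (x + z)) x"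
      unfolding g_def[abs_def] using laplacian_lin_C2[OF open_UNIV CL CL, of x "1 / (?A * m)" 0] by simp
    also have "laplacian (\<lambda>x. LINT z:cball 0 \<delta>|lborel. ?q (norm z) * v (x + z)) x = (LINT z:cball 0 \<delta>|lborel. ?q (norm z) * laplacian v (x + z))"
      by (rule bounded_functional_laplacian[OF L d0 open_UNIV v]) simp
    also have "\<dots> = (LINT z:cball 0 \<delta>|lborel. ?k (norm z) * v (x + z))"
      by (rule integral_bump_laplacian[OF v open_UNIV _ d]) simp
    also have "\<dots> = ?A * integral {0..\<delta>} (\<lambda>s. ?k s * s ^ (?n - 1) * spherical_mean v x s)" by (rule pol[OF ck(2)])
    finally have "laplacian g x = integral {0..\<delta>} (\<lambda>s. ?k s * s ^ (?n - 1) * spherical_mean v x s) / m" using A by simp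
    then have "\<bar>laplacian g x\<bar> = \<bar>integral {0..\<delta>} (\<lambda>s. ?k s * s ^ (?n - 1) * spherical_mean v x s)\<bar> / m" using m by simp
    also have "\<dots> \<le> (integral {0..\<delta>} (\<lambda>s. \<bar>?k s\<bar> * s ^ (?n - 1)) * W) / m"
      using est[OF ck(2), of x] m unfolding k0 by (intro divide_right_mono) auto
    also have "\<dots> \<le> ((24 + 6 * real ?n) * \<delta> ^ (4 + ?n) * W) / m"
      using kup W0 m by (intro divide_right_mono mult_right_mono) auto
    also have "\<dots> \<le> ((24 + 6 * real ?n) * \<delta> ^ (4 + ?n) * W) / ((3 / 4 * \<delta>\<^sup>2) ^ 3 * (\<delta> / 2) ^ ?n / real ?n)"
      using mlow m W0 d by (intro divide_left_mono mult_pos_pos divide_pos_pos) auto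
    also have "\<dots> = bump_constant ?n / \<delta>\<^sup>2 * W"
    proof -
      have "(3 / 4 * \<delta>\<^sup>2) ^ 3 = (3 / 4) ^ 3 * (\<delta> ^ 4 * \<delta>\<^sup>2)" by (simp only: power_mult_distrib) (simp add: power_add[symmetric] power_mult[symmetric])
      moreover have "(\<delta> / 2) ^ ?n = \<delta> ^ ?n / 2 ^ ?n" by (rule power_divide)
      moreover have "((4::real) / 3) ^ 3 = 1 / (3 / 4) ^ 3" by (simp add: power_divide)
      ultimately show ?thesis unfolding bump_constant_def using d by (simp add: power_add field_simps)
    qed
    finally show ?thesis .
  qed
  have supp: "\<forall>y. norm y \<ge> \<rho> + \<delta> \<longrightarrow> g y = 0" if vs: "\<forall>y. norm y \<ge> \<rho> \<longrightarrow> v y = 0" for \<rho>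
  proof (intro allI impI)
    fix y :: 'a assume y: "norm y \<ge> \<rho> + \<delta>"
    have "(LINT z:cball 0 \<delta>|lborel. ?q (norm z) * v (y + z)) = (LINT z:cball (0::'a) \<delta>|lborel. 0)"
    proof (rule set_lebesgue_integral_cong)
      show "\<forall>z. z \<in> cball 0 \<delta> \<longrightarrow> ?q (norm z) * v (y + z) = 0"
      proof (intro allI impI)
        fix z :: 'a assume "z \<in> cball 0 \<delta>"
        then have "norm (y + z) \<ge> \<rho>" using y norm_triangle_ineq2[of y "- z"] by simp
        then show "?q (norm z) * v (y + z) = 0" using vs by simp
      qed
    qed simp
    then show "g y = 0" unfolding g_def by simp
  qed
  show ?thesis by (rule that[OF Cg close lap supp])
qed

section \<open>The harmonicity modulus and the size of a defect\<close>

lemma harmonicity_modulus_upper: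
  fixes g :: "'a::euclidean_space \<Rightarrow> real"
  assumes g: "continuous_on UNIV g" and B: "\<And>x. \<bar>g x\<bar> \<le> B" and t: "0 < t" "t \<le> u"
  shows "\<bar>spherical_mean g x t - g x\<bar> \<le> harmonicity_modulus g u"
proof -
  let ?S = "{\<bar>spherical_difference t g x\<bar> | t x. 0 < t \<and> t \<le> u}"
  have "bdd_above ?S"
  proof (rule bdd_aboveI[of _ "2 * B"])
    fix y assume "y \<in> ?S"
    then obtain s z where s: "y = \<bar>spherical_difference s g z\<bar>" "0 < s" by blast
    have "\<bar>spherical_mean g z s\<bar> \<le> B"
      unfolding spherical_mean_translate[of g z]
      by (rule spherical_mean_bound[OF continuous_on_translate[OF g subset_UNIV, where x = z and R = s]]) (use s B in auto)
    then show "y \<le> 2 * B" using B[of z] s unfolding spherical_difference_def by linarith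
  qed
  moreover have "\<bar>spherical_difference t g x\<bar> \<in> ?S" using t by blast
  ultimately show ?thesis unfolding harmonicity_modulus_def spherical_difference_def[symmetric]
    by (rule cSup_upper[rotated])
qed

context radial_kernel
begin

text \<open>
  The left-hand side is \<open>w - K w\<close>. Iterating Green's formula moves \<open>j\<close> Laplacians onto \<open>w\<close> under the functional, at the
  price of averages of iterated Laplacians.
\<close>

lemma defect_telescope:
  fixes w :: "'a::euclidean_space \<Rightarrow> real"
  assumes n_dim: "n = DIM('a)" and w: "Ck_on (2 * j) UNIV w"
  shows "defect 0 (spherical_mean w x) = defect j (spherical_mean ((laplacian ^^ j) w) x)
    + (\<Sum>i<j. defect i (radial_potential n (\<lambda>_. 1)) * kmean (spherical_mean ((laplacian ^^ Suc i) w) x))"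
  using w
proof (induction j)
  case (Suc j)
  let ?w = "(laplacian ^^ j) w"
  have w2: "Ck_on 2 UNIV ?w" by (rule Ck_on_laplacian_funpow) (use Suc.prems in auto)
  have c: "continuous_on UNIV (laplacian ?w)"
    using continuous_on_laplacian[OF open_UNIV] w2 by blast
  have "defect j (spherical_mean ?w x) = defect (Suc j) (spherical_mean (laplacian ?w) x)
      + defect j (radial_potential n (\<lambda>_. 1)) * kmean (spherical_mean (laplacian ?w) x)"
    by (rule defect_expand(2)[OF spherical_mean_continuous_radius[OF c subset_UNIV]])
       (use spherical_mean_green[OF w2 open_UNIV subset_UNIV, where x = x and R = R] n_dim in auto)
  moreover have "Ck_on (2 * j) UNIV w" by (rule Ck_on_mono[OF Suc.prems]) simp
  ultimately show ?case using Suc.IH by simp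
qed simp

text \<open>
  The function is split into its regularisation at scale \<open>\<delta>\<close> and the remainder. For the regularisation,
  constants being annihilated, one may pass to the potential of its Laplacian, which gains one more factor
  \<open>\<theta>\<close> against the loss \<open>\<delta>\<^bsup>-2\<^esup>\<close>.
\<close>

lemma defect_spherical_mean_bound:
  fixes v :: "'a::euclidean_space \<Rightarrow> real"
  assumes n_dim: "n = DIM('a)" and v: "Ck_on 2 UNIV v"
    and moments: "\<And>i. i \<le> r + 1 \<Longrightarrow> kmean (\<lambda>t. t ^ (2 * i)) \<le> A * \<theta> ^ i" and A: "A \<ge> 0" and \<theta>: "\<theta> \<ge> 0"
    and d: "\<delta> > 0" and W: "\<And>s x. 0 < s \<Longrightarrow> s \<le> \<delta> \<Longrightarrow> \<bar>spherical_mean v x s - v x\<bar> \<le> W"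
  shows "\<bar>defect r (spherical_mean v x)\<bar> \<le> (1 + A) ^ (r + 1) * (1 + bump_constant n / \<delta>\<^sup>2 * \<theta>) * \<theta> ^ r * W"
proof -
  have W0: "W \<ge> 0" using W[OF d order_refl, of 0] by linarith
  obtain g where g: "Ck_on 2 UNIV g" "\<And>x. \<bar>v x - g x\<bar> \<le> W" "\<And>x. \<bar>laplacian g x\<bar> \<le> bump_constant DIM('a) / \<delta>\<^sup>2 * W"
    using W by (rule regularisation_at_scale[where W = W, OF v d]) blast+
  define b where "b = bump_constant n / \<delta>\<^sup>2"
  have b: "b \<ge> 0" unfolding b_def using bump_constant_nonneg by simp
  obtain C where C: "profile_functional R C (defect r)" using defect_functional by blast
  have cv: "continuous_on UNIV v" and cg: "continuous_on UNIV g" using v g(1) by (auto intro: Ck_on_imp_continuous)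
  have cl: "continuous_on UNIV (laplacian g)"
    using continuous_on_laplacian[OF open_UNIV] g(1) by blast
  note cS = spherical_mean_continuous_radius[OF _ subset_UNIV]
  have s: "\<bar>1 * spherical_mean v x t + (-1) * spherical_mean g x t\<bar> \<le> W * t ^ (2 * 0)" if "t \<in> {0..R}" for t
    using spherical_mean_diff_le_at[OF cv cg subset_UNIV, where t = t and B = W and x = x] g(2) that by auto
  have "\<bar>defect r (\<lambda>t. 1 * spherical_mean v x t + (-1) * spherical_mean g x t)\<bar> \<le> (1 + A) ^ (r + 1) * W * \<theta> ^ (0 + r)"
    by (rule defect_bound[OF moments A \<theta> _ W0 s]) (auto intro!: continuous_intros cS cv cg)
  then have 1: "\<bar>defect r (spherical_mean v x) - defect r (spherical_mean g x)\<bar> \<le> (1 + A) ^ (r + 1) * W * \<theta> ^ r"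
    using profile_functionalD(1)[OF C cS[OF cv, where x = x] cS[OF cg, where x = x], where a = 1 and c = "-1"] by simp
  have "defect r (spherical_mean g x) = defect r (radial_potential n (spherical_mean (laplacian g) x))"
    by (rule defect_expand(1)[OF cS[OF cl]])
       (use spherical_mean_green[OF g(1) open_UNIV subset_UNIV, where x = x and R = R] n_dim in auto)
  moreover have "\<bar>defect r (radial_potential n (spherical_mean (laplacian g) x))\<bar> \<le> (1 + A) ^ (r + 1) * (b * W) * \<theta> ^ (1 + r)"
  proof (rule defect_bound[OF moments A \<theta> radial_potential_continuous[OF cS[OF cl]]])
    fix t assume t: "t \<in> {0..R}"
    have "\<bar>radial_potential n (spherical_mean (laplacian g) x) t\<bar> \<le> (b * W) * t ^ (0 + 2)"
    proof (rule radial_potential_bound[OF cS[OF cl] t])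
      fix \<rho> assume "\<rho> \<in> {0..R}"
      then show "\<bar>spherical_mean (laplacian g) x \<rho>\<bar> \<le> b * W * \<rho> ^ 0"
        unfolding spherical_mean_translate[of "laplacian g" x]
        using spherical_mean_bound[OF continuous_on_translate[OF cl subset_UNIV, where x = x and R = \<rho>], where t = \<rho> and B = "b * W"] g(3)
        unfolding b_def n_dim by auto
    qed (use b W0 in simp)
    then show "\<bar>radial_potential n (spherical_mean (laplacian g) x) t\<bar> \<le> (b * W) * t ^ (2 * 1)" by (simp add: power2_eq_square)
  qed (use b W0 in auto)
  ultimately have 2: "\<bar>defect r (spherical_mean g x)\<bar> \<le> (1 + A) ^ (r + 1) * (b * W) * \<theta> ^ (1 + r)" by simp
  have "\<bar>defect r (spherical_mean v x)\<bar> \<le> (1 + A) ^ (r + 1) * W * \<theta> ^ r + (1 + A) ^ (r + 1) * (b * W) * \<theta> ^ (1 + r)"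
    using 1 2 by linarith
  also have "\<dots> = (1 + A) ^ (r + 1) * (1 + b * \<theta>) * \<theta> ^ r * W" by (simp add: algebra_simps)
  finally show ?thesis unfolding b_def .
qed

end

text \<open>
  A function equal to its small spherical means has a regularisation with Laplacian zero; being compactly
  supported it vanishes by the maximum principle. As \<open>g\<close> is only continuous, this is done with an
  error \<open>\<epsilon>\<close> for a smooth function near \<open>g\<close>. The lemma settles the degenerate case in which the modulus leaves no room for
  errors in the approximation theorem.
\<close>

lemma zero_of_zero_modulus:
  fixes g :: "'a::euclidean_space \<Rightarrow> real"
  assumes g: "continuous_on UNIV g" and supp: "\<And>y. norm y \<ge> \<rho> \<Longrightarrow> g y = 0" and \<rho>: "\<rho> > 0" and d: "0 < \<delta>" "\<delta> \<le> 1"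
    and mean: "\<And>s x. 0 < s \<Longrightarrow> s \<le> \<delta> \<Longrightarrow> spherical_mean g x s = g x"
  shows "g x = 0"
proof -
  let ?b = "bump_constant DIM('a) / \<delta>\<^sup>2"
  let ?\<rho> = "\<rho> + 3"
  have est: "\<bar>g x\<bar> \<le> (3 + ?\<rho>\<^sup>2 * (?b * 2)) * \<epsilon>" if e: "\<epsilon> > 0" for \<epsilon> x
  proof -
    obtain v where v: "Ck_on 2 UNIV v" "\<And>y. norm y \<ge> \<rho> + 1 \<Longrightarrow> v y = 0" "\<And>x. \<bar>g x - v x\<bar> \<le> \<epsilon>"
      using supp by (rule mollify_approx[where N = 2 and \<rho> = \<rho>, OF g _ e]) blast+
    have cv: "continuous_on UNIV v" by (rule Ck_on_imp_continuous[OF v(1)])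
    have W: "\<bar>spherical_mean v x s - v x\<bar> \<le> 2 * \<epsilon>" if s: "0 < s" "s \<le> \<delta>" for s x
    proof -
      have "\<bar>spherical_mean g x s - spherical_mean v x s\<bar> \<le> \<epsilon>"
        by (rule spherical_mean_diff_le_at[OF g cv subset_UNIV]) (use s v(3) in auto)
      then show ?thesis using mean[OF s, of x] v(3)[of x] by linarith
    qed
    obtain h where h: "Ck_on 2 UNIV h" "\<And>x. \<bar>v x - h x\<bar> \<le> 2 * \<epsilon>" "\<And>x. \<bar>laplacian h x\<bar> \<le> ?b * (2 * \<epsilon>)"
      "\<And>\<rho>. \<forall>y. norm y \<ge> \<rho> \<longrightarrow> v y = 0 \<Longrightarrow> \<forall>y. norm y \<ge> \<rho> + \<delta> \<longrightarrow> h y = 0"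
      using W by (rule regularisation_at_scale[where W = "2 * \<epsilon>", OF v(1) d(1)]) blast+
    have hs: "h y = 0" if "norm y \<ge> \<rho> + 2" for y
      using h(4)[of "\<rho> + 1"] v(2) that d(2) by auto
    have "\<bar>h x\<bar> \<le> ?\<rho>\<^sup>2 * (?b * (2 * \<epsilon>))"
    proof (cases "norm x \<ge> \<rho> + 2")
      case True
      then show ?thesis using hs e bump_constant_nonneg[of "DIM('a)"] by simp
    next
      case False
      have "\<bar>h x\<bar> \<le> ?\<rho>\<^sup>2 * (?b * (2 * \<epsilon>))"
      proof (rule maximum_principle[where w = h and y = x and \<rho> = ?\<rho>, OF open_ball order_refl])
        show "continuous_on (closure (ball 0 ?\<rho>)) h"
          using Ck_on_imp_continuous[OF h(1)] continuous_on_subset by blast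
        show "laplacian_exists_on (ball 0 ?\<rho>) h"
          by (rule Ck_on_2_laplacian_exists, rule Ck_on_subset[OF h(1)]) simp
        show "h y = 0" if "y \<in> frontier (ball 0 ?\<rho>)" for y
          using that \<rho> by (intro hs) auto
        show "x \<in> closure (ball 0 ?\<rho>)" using False \<rho> by auto
      qed (use h(3) bump_constant_nonneg[of "DIM('a)"] e in auto)
      then show ?thesis .
    qed
    then have "\<bar>g x\<bar> \<le> ?\<rho>\<^sup>2 * (?b * (2 * \<epsilon>)) + 3 * \<epsilon>" using v(3)[of x] h(2)[of x] by linarith
    then show ?thesis by (simp add: algebra_simps)
  qed
  define C where "C = 3 + ?\<rho>\<^sup>2 * (?b * 2)"
  have C: "C > 0" unfolding C_def using bump_constant_nonneg[of "DIM('a)"] by (intro add_pos_nonneg) auto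
  show ?thesis
  proof (rule ccontr)
    assume "g x \<noteq> 0"
    then have "\<bar>g x\<bar> / (2 * C) > 0" using C by simp
    from est[OF this, of x] have "\<bar>g x\<bar> \<le> C * (\<bar>g x\<bar> / (2 * C))" unfolding C_def .
    then show False using C \<open>g x \<noteq> 0\<close> by simp
  qed
qed

text \<open>
  The top iterate of the remainder vanishes on the boundary because \<open>h\<^sub>f\<close> also matches \<open>\<Delta>\<^sup>r f\<close> there; this is what makes
  the extension by zero continuous.
\<close>

lemma remainder_top_properties:
  fixes D :: "'a::euclidean_space set"
  assumes D: "open D" and f: "f \<in> HC r D" and sub: "closure D \<subseteq> ball 0 \<rho>"
    and hc: "continuous_on (closure D) (h r)"
    and hb: "\<And>x. x \<in> frontier D \<Longrightarrow> h r x = laplacian_cl D r f x"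
    and bvp: "\<And>x. x \<in> closure D \<Longrightarrow> laplacian_cl D r (bvp_solution r D f) x = h r x"
  shows "continuous_on UNIV (remainder r D f r)"
    and "norm y \<ge> \<rho> \<Longrightarrow> remainder r D f r y = 0"
    and "x \<in> closure D \<Longrightarrow> remainder r D f r x = laplacian_cl D r f x - h r x"
proof -
  let ?g = "remainder r D f r"
  show on: "?g x = laplacian_cl D r f x - h r x" if "x \<in> closure D" for x
    using that bvp unfolding remainder_def by simp
  have off: "?g x = 0" if "x \<in> - D" for x
  proof (cases "x \<in> closure D")
    case True
    then have "x \<in> frontier D" using that D by (simp add: frontier_def interior_open)
    then show ?thesis using on[OF True] hb by simp
  qed (simp add: remainder_def)
  have "continuous_on (closure D) (\<lambda>x. laplacian_cl D r f x - h r x)"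
    using f hc unfolding HC_def by (intro continuous_intros) auto
  then have c1: "continuous_on (closure D) ?g" by (rule continuous_on_eq) (use on in auto)
  have c2: "continuous_on (- D) ?g" using continuous_on_const[of "- D" "0::real"] by (rule continuous_on_eq) (use off in auto)
  have "continuous_on (closure D \<union> - D) ?g" using D by (intro continuous_on_closed_Un c1 c2) auto
  moreover have "closure D \<union> - D = UNIV" using closure_subset by blast
  ultimately show "continuous_on UNIV ?g" by simp
  show "?g y = 0" if "norm y \<ge> \<rho>"
  proof -
    have "y \<notin> D" using sub closure_subset that by force
    then show ?thesis using off by simp
  qed
qed

section \<open>The approximation theorem\<close>

lemma compactly_supported_approximant:
  fixes g :: "'a::euclidean_space \<Rightarrow> real"
  assumes g: "continuous_on UNIV g" and supp: "\<And>y. norm y \<ge> \<rho> \<Longrightarrow> g y = 0" and E: "E \<ge> 0"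
    and z: "E = 0 \<Longrightarrow> (\<And>x. g x = 0)"
  obtains v where "Ck_on N UNIV v" "\<And>y. norm y \<ge> \<rho> + 1 \<Longrightarrow> v y = 0" "\<And>x. \<bar>g x - v x\<bar> \<le> E"
proof (cases "E = 0")
  case True
  then show ?thesis using z by (intro that[of "\<lambda>_. 0"]) (auto intro: Ck_on_const)
next
  case False
  then have "E > 0" using E by simp
  show ?thesis
    using supp by (rule mollify_approx[where N = N and \<rho> = \<rho>, OF g _ \<open>E > 0\<close>]) (blast intro: that)+
qed

lemma laplacian_funpow_support:
  fixes v :: "'a::euclidean_space \<Rightarrow> real"
  assumes "\<And>y. norm y \<ge> \<rho> \<Longrightarrow> v y = 0" "norm y \<ge> \<rho> + 1"
  shows "(laplacian ^^ i) v y = 0"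
proof -
  have z: "(laplacian ^^ i) (\<lambda>_. 0) y = 0" for y :: 'a
  proof (induction i arbitrary: y)
    case (Suc i)
    have "(laplacian ^^ i) (\<lambda>_. 0) = (\<lambda>_::'a. 0)" using Suc by blast
    then show ?case by (simp add: laplacian_const)
  qed simp
  have "(laplacian ^^ i) v y = (laplacian ^^ i) (\<lambda>_. 0) y"
    by (rule laplacian_funpow_cong[of "- cball 0 \<rho>"]) (use assms in auto)
  then show ?thesis using z by simp
qed

text \<open>
  The index \<open>j\<close> counts Laplacians applied to \<open>P 0\<close>: the given combination of averages is \<open>\<Delta>\<^sup>r (P 0)\<close>.
  A monomial of degree \<open>l \<le> d\<close> of the kernel comes from the potential of index \<open>l + r\<close>, so that \<open>d + r + 1\<close>
  Laplacians annihilate \<open>P 0\<close>.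
\<close>

lemma kernel_polynomial_potential:
  fixes w :: "nat \<Rightarrow> 'a::euclidean_space \<Rightarrow> real"
  assumes K: "radial_kernel R DIM('a) k" and kc: "\<And>s. k s = (\<Sum>l\<le>d. c l * s ^ (2 * l))"
    and w: "\<And>i. i \<le> r \<Longrightarrow> continuous_on UNIV (w i)" "\<And>i y. i \<le> r \<Longrightarrow> norm y \<ge> \<rho> \<Longrightarrow> w i y = 0"
  obtains P :: "nat \<Rightarrow> 'a \<Rightarrow> real" where "\<And>j m. Ck_on m UNIV (P j)" "\<And>j x. laplacian (P j) x = P (Suc j) x"
    "\<And>j x. d + r < j \<Longrightarrow> P j x = 0"
    "\<And>x. norm x + \<rho> \<le> R \<Longrightarrow> P r x = (\<Sum>i\<le>r. a i * radial_kernel.kmean R DIM('a) k (spherical_mean (w i) x))"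
proof -
  let ?n = "DIM('a)"
  interpret K: radial_kernel R ?n k by (rule K)
  define m where "m = sphere_area TYPE('a) * integral {0..R} (\<lambda>s. k s * s ^ (?n - 1))"
  have m: "m \<noteq> 0" unfolding m_def using sphere_area_pos[where 'a='a] K.k_mass by simp
  define G where "G y = (\<Sum>i\<le>r. (a i / m) * w i y)" for y
  have cG: "continuous_on UNIV G" unfolding G_def by (intro continuous_intros w(1)) simp
  obtain N :: "nat \<Rightarrow> 'a \<Rightarrow> real" where N: "\<And>i k. Ck_on k UNIV (N i)" "\<And>i x. laplacian (N (Suc i)) x = N i x" "\<And>x. laplacian (N 0) x = 0"
    "\<And>i x. (LINT y:cball 0 \<rho>|lborel. norm (x - y) ^ (2 * i) * G y) = almansi_factor ?n i * N i x"
    using norm_power_potentials[OF cG, of \<rho>] by blast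
  \<comment> \<open>The \<open>j\<close>-th iterated Laplacian of the potential of index \<open>l + r\<close>.\<close>
  define M where "M l j = (if j \<le> l + r then N (l + r - j) else (\<lambda>_. 0))" for l j
  define P where "P j x = (\<Sum>l\<le>d. (c l * almansi_factor ?n l) * M l j x)" for j x
  have CM: "Ck_on m UNIV (M l j)" for m l j unfolding M_def by (auto intro: N(1) Ck_on_const)
  have LM: "laplacian (M l j) x = M l (Suc j) x" for l j x
  proof -
    consider "l + r < j" | "j = l + r" | "j < l + r" by linarith
    then show ?thesis
    proof cases
      case 1 then show ?thesis unfolding M_def by (simp add: laplacian_const)
    next
      case 2 then show ?thesis unfolding M_def using N(3) by simp
    next
      case 3
      then have "l + r - j = Suc (l + r - Suc j)" by simp
      then show ?thesis unfolding M_def using N(2)[of "l + r - Suc j" x] 3 by simp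
    qed
  qed
  show ?thesis
  proof (rule that[of P])
    show "Ck_on m UNIV (P j)" for j m unfolding P_def by (intro Ck_on_sum Ck_on_cmult CM) auto
    show "laplacian (P j) x = P (Suc j) x" for j x
      unfolding P_def LM[symmetric] by (rule laplacian_sum_C2[OF open_UNIV UNIV_I CM])
    show "P j x = 0" if "d + r < j" for j x
      unfolding P_def by (rule sum.neutral) (use that in \<open>auto simp: M_def\<close>)
    fix x :: 'a assume x: "norm x + \<rho> \<le> R"
    have ck: "continuous_on UNIV k" unfolding kc by (intro continuous_intros)
    have ckx: "continuous_on (cball 0 \<rho>) (\<lambda>y. k (norm (x - y)))"
      by (rule continuous_on_compose2[OF ck]) (auto intro!: continuous_intros)
    note L = bounded_functional_integral[OF ckx]
    have cw: "continuous_on (cball 0 \<rho>) (w i)" if "i \<le> r" for i using w(1)[OF that] by (rule continuous_on_subset) simp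
    have Ls: "(LINT y:cball 0 \<rho>|lborel. k (norm (x - y)) * (a' * w i y)) = a' * (LINT y:cball 0 \<rho>|lborel. k (norm (x - y)) * w i y)" if "i \<le> r" for a' i
      using bounded_functionalD(1)[OF L cw[OF that] cw[OF that], of a' 0] by simp
    have "(\<Sum>i\<le>r. a i * K.kmean (spherical_mean (w i) x)) = (\<Sum>i\<le>r. (a i / m) * (LINT y:cball 0 \<rho>|lborel. k (norm (x - y)) * w i y))"
      by (intro sum.cong refl) (simp add: kmean_eq_integral[OF K w(1) w(2) x] m_def)
    also have "\<dots> = (\<Sum>i\<le>r. (LINT y:cball 0 \<rho>|lborel. k (norm (x - y)) * ((a i / m) * w i y)))"
      by (intro sum.cong refl) (simp add: Ls)
    also have "\<dots> = (LINT y:cball 0 \<rho>|lborel. k (norm (x - y)) * G y)"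
      unfolding G_def
      by (rule bounded_functional_sum[OF L, symmetric]) (use cw m in \<open>auto intro!: continuous_intros\<close>)
    also have "\<dots> = (LINT y:cball 0 \<rho>|lborel. 1 * (\<Sum>l\<le>d. c l * (norm (x - y) ^ (2 * l) * G y)))"
      unfolding kc by (simp add: sum_distrib_right mult.assoc)
    also have "\<dots> = (\<Sum>l\<le>d. (LINT y:cball 0 \<rho>|lborel. 1 * (c l * (norm (x - y) ^ (2 * l) * G y))))"
      by (rule bounded_functional_sum[OF bounded_functional_integral[OF continuous_on_const]])
         (auto intro!: continuous_intros continuous_on_subset[OF cG])
    also have "\<dots> = P r x"
      unfolding P_def M_def by (intro sum.cong refl) (simp add: N(4))
    finally show "P r x = (\<Sum>i\<le>r. a i * K.kmean (spherical_mean (w i) x))" ..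
  qed
qed

theorem theorem6:
  fixes D :: "'a::euclidean_space set" and r :: nat
  assumes "DIM('a) \<ge> 2"
    and "open D" and "connected D" and "bounded D" and "dirichlet_regular D"
  shows "\<exists>C::real. C > 0 \<and>
    (\<forall>f \<in> HC r D. \<forall>p::nat. p \<ge> r + 1 \<longrightarrow>
      (\<exists>T :: 'a \<Rightarrow> real. polyharmonic_on p D T \<and>
        (\<forall>x \<in> closure D.
          \<bar>f x - T x\<bar> \<le> C * harmonicity_modulus (remainder r D f r) (1 / real p) * (1 / real p ^ (2 * r)))))"
proof -
  note D = assms(2,4,5)
  let ?n = "DIM('a)"
  obtain \<rho> where \<rho>: "\<rho> > 0" "closure D \<subseteq> ball 0 \<rho>"
    using bounded_subset_ballD[OF bounded_closure[OF D(2)], of 0] by blast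
  have D\<rho>: "D \<subseteq> ball 0 \<rho>" using \<rho>(2) closure_subset by blast
  \<comment> \<open>Balls of radius \<open>R\<close> around points of \<open>D\<close> contain the support of the smooth function near \<open>g\<close>.\<close>
  define R where "R = 2 * \<rho> + 2"
  have R: "R > 0" using \<rho>(1) unfolding R_def by simp
  obtain A B where AB: "A \<ge> 0" "B > 0"
    "\<And>d. \<exists>k c \<theta>. radial_kernel R ?n k \<and> (\<forall>s. k s = (\<Sum>i\<le>d. c i * s ^ (2 * i))) \<and>
      (\<forall>i\<le>r + 1. radial_kernel.kmean R ?n k (\<lambda>t. t ^ (2 * i)) \<le> A * \<theta> ^ i) \<and> 0 \<le> \<theta> \<and> \<theta> \<le> B / (real (d + 1))\<^sup>2"
    by (rule jackson_kernel[where n = ?n and J = "r + 1", OF R DIM_positive]) blast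
  define B' where "B' = B * (real (r + 1))\<^sup>2"
  have B': "B' \<ge> 0" unfolding B'_def using AB(2) by simp
  let ?bc = "bump_constant ?n"
  define C where "C = (1 + A) ^ (r + 1) * (1 + ?bc * B') * B' ^ r * 3 + 1"
  have C1: "(1 + A) ^ (r + 1) * (1 + ?bc * B') * B' ^ r * 3 \<ge> 0"
    using AB(1) B' bump_constant_nonneg[of ?n] by simp
  have main: "\<exists>T. polyharmonic_on p D T \<and> (\<forall>x\<in>closure D.
      \<bar>f x - T x\<bar> \<le> C * harmonicity_modulus (remainder r D f r) (1 / real p) * (1 / real p ^ (2 * r)))"
    if f: "f \<in> HC r D" and p: "p \<ge> r + 1" for f p
  proof -
    obtain h where h: "\<And>j. continuous_on (closure D) (h j)" "\<And>j k. Ck_on k D (h j)"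
      "\<And>j x. x \<in> D \<Longrightarrow> laplacian (h j) x = h (Suc j) x"
      "\<And>j x. j \<le> r \<Longrightarrow> x \<in> frontier D \<Longrightarrow> h j x = laplacian_cl D j f x"
      "\<And>j x. j > r \<Longrightarrow> h j x = 0"
      "\<And>j x. j \<le> r \<Longrightarrow> x \<in> closure D \<Longrightarrow> laplacian_cl D j (bvp_solution r D f) x = h j x"
      using bvp_solution_eq_chain[OF D f] by blast
    define g where "g = remainder r D f r"
    have g: "continuous_on UNIV g" "\<And>y. norm y \<ge> \<rho> \<Longrightarrow> g y = 0"
      "\<And>x. x \<in> closure D \<Longrightarrow> g x = laplacian_cl D r f x - h r x"
    proof -
      note props = remainder_top_properties[where h = h and r = r, OF D(1) f \<rho>(2) h(1)]
      show "continuous_on UNIV g" unfolding g_def by (rule props(1)) (simp_all add: h(4,6))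
      show "g y = 0" if "norm y \<ge> \<rho>" for y
        unfolding g_def by (rule props(2)) (use that in \<open>simp_all add: h(4,6)\<close>)
      show "g x = laplacian_cl D r f x - h r x" if "x \<in> closure D" for x
        unfolding g_def by (rule props(3)) (use that in \<open>simp_all add: h(4,6)\<close>)
    qed
    define \<omega> where "\<omega> = harmonicity_modulus g (1 / real p)"
    have p0: "real p > 0" using p by simp
    have "bounded (g ` cball 0 \<rho>)"
      by (intro compact_imp_bounded compact_continuous_image continuous_on_subset[OF g(1)] compact_cball) simp
    then obtain G where G: "\<And>x. x \<in> cball 0 \<rho> \<Longrightarrow> norm (g x) \<le> G" unfolding bounded_iff by blast
    have G': "\<bar>g x\<bar> \<le> max G 0" for x
      using G[of x] g(2)[of x] by (cases "norm x \<le> \<rho>") auto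
    have mod: "\<bar>spherical_mean g x s - g x\<bar> \<le> \<omega>" if "0 < s" "s \<le> 1 / real p" for s x
      unfolding \<omega>_def by (rule harmonicity_modulus_upper[OF g(1) G' that])
    have \<omega>: "\<omega> \<ge> 0" using mod[of "1 / real p" 0] p0 by auto
    define \<kappa> where "\<kappa> = (\<rho>\<^sup>2) ^ r"
    have \<kappa>: "\<kappa> \<ge> 0" unfolding \<kappa>_def by simp
    \<comment> \<open>The accuracy of the smooth function near \<open>g\<close>: it must not enlarge the modulus, and after \<open>r\<close> applications of the maximum principle it must be of the size of the claimed error.\<close>
    define E where "E = \<omega> / (1 + \<kappa> * real p ^ (2 * r))"
    have den: "1 + \<kappa> * real p ^ (2 * r) \<ge> 1" using \<kappa> by simp
    have E: "E \<ge> 0" "E \<le> \<omega>" "\<kappa> * E \<le> \<omega> / real p ^ (2 * r)"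
    proof -
      show "E \<ge> 0" unfolding E_def using \<omega> den by simp
      have "E * 1 \<le> E * (1 + \<kappa> * real p ^ (2 * r))" using den \<open>E \<ge> 0\<close> by (intro mult_left_mono)
      also have "\<dots> = \<omega>" unfolding E_def using den by simp
      finally show "E \<le> \<omega>" by simp
      have "E * (1 + \<kappa> * real p ^ (2 * r)) = \<omega>" unfolding E_def using den by simp
      then have "\<kappa> * E * real p ^ (2 * r) \<le> \<omega>" using \<open>E \<ge> 0\<close> by (simp add: algebra_simps)
      then show "\<kappa> * E \<le> \<omega> / real p ^ (2 * r)" using p0 by (simp add: pos_le_divide_eq)
    qed
    have "g x = 0" if "E = 0" for x
    proof (rule zero_of_zero_modulus[OF g(1,2) \<rho>(1)])
      show "0 < 1 / real p" "1 / real p \<le> 1" using p by auto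
      have "\<omega> = 0" using that den unfolding E_def by auto
      then show "spherical_mean g x s = g x" if "0 < s" "s \<le> 1 / real p" for s x
        using mod[OF that, of x] by simp
    qed
    then obtain v where v: "Ck_on (2 * r + 2) UNIV v" "\<And>y. norm y \<ge> \<rho> + 1 \<Longrightarrow> v y = 0" "\<And>x. \<bar>g x - v x\<bar> \<le> E"
      using compactly_supported_approximant[where N = "2 * r + 2" and \<rho> = \<rho> and E = E, OF g(1) g(2) E(1)] by blast
    have cv: "continuous_on UNIV v" by (rule Ck_on_imp_continuous[OF v(1)])
    have vmod: "\<bar>spherical_mean v x s - v x\<bar> \<le> 3 * \<omega>" if s: "0 < s" "s \<le> 1 / real p" for s x
    proof -
      have "\<bar>spherical_mean g x s - spherical_mean v x s\<bar> \<le> E"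
        by (rule spherical_mean_diff_le_at[OF g(1) cv subset_UNIV]) (use s v(3) in auto)
      then show ?thesis using mod[OF s, of x] v(3)[of x] E(2) by linarith
    qed
    \<comment> \<open>A kernel of degree \<open>d\<close> gives averages of order \<open>d + 1 = p - r\<close>; their \<open>r\<close>-fold potentials have order \<open>p\<close>.\<close>
    define d where "d = p - 1 - r"
    obtain k c \<theta> where K: "radial_kernel R ?n k" and kc: "\<And>s. k s = (\<Sum>i\<le>d. c i * s ^ (2 * i))"
      and moments: "\<And>i. i \<le> r + 1 \<Longrightarrow> radial_kernel.kmean R ?n k (\<lambda>t. t ^ (2 * i)) \<le> A * \<theta> ^ i"
      and \<theta>: "0 \<le> \<theta>" "\<theta> \<le> B / (real (d + 1))\<^sup>2"
      using AB(3)[of d] by blast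
    interpret K: radial_kernel R ?n k by (rule K)
    have \<theta>p: "\<theta> \<le> B' / (real p)\<^sup>2"
    proof -
      have "p \<le> (r + 1) * (d + 1)"
      proof -
        obtain e where e: "p = r + 1 + e" using p le_Suc_ex by blast
        then show ?thesis unfolding d_def by simp
      qed
      then have "real p \<le> real (r + 1) * real (d + 1)" by (metis of_nat_le_iff of_nat_mult)
      then have "(real p)\<^sup>2 \<le> (real (r + 1) * real (d + 1))\<^sup>2" by (intro power_mono) auto
      then have "B * (real p)\<^sup>2 \<le> B * ((real (r + 1))\<^sup>2 * (real (d + 1))\<^sup>2)"
        using AB(2) by (simp add: power_mult_distrib)
      then have "B / (real (d + 1))\<^sup>2 \<le> B' / (real p)\<^sup>2"
        unfolding B'_def using p0 by (simp add: divide_simps mult_ac)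
      then show ?thesis using \<theta>(2) by linarith
    qed
    define V where "V j x = K.defect r (spherical_mean ((laplacian ^^ j) v) x)" for j x
    have V0: "\<bar>V 0 x\<bar> \<le> (1 + A) ^ (r + 1) * (1 + ?bc * B') * B' ^ r * 3 * \<omega> * (1 / real p ^ (2 * r))" for x
    proof -
      have v2: "Ck_on 2 UNIV v" by (rule Ck_on_mono[OF v(1)]) simp
      have "\<bar>V 0 x\<bar> \<le> (1 + A) ^ (r + 1) * (1 + ?bc / (1 / real p)\<^sup>2 * \<theta>) * \<theta> ^ r * (3 * \<omega>)"
        unfolding V_def funpow_0
        by (rule K.defect_spherical_mean_bound[OF refl v2 moments AB(1) \<theta>(1) _ vmod]) (use p0 in auto)
      also have "\<dots> \<le> (1 + A) ^ (r + 1) * (1 + ?bc * B') * (B' / (real p)\<^sup>2) ^ r * (3 * \<omega>)"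
      proof -
        have "?bc / (1 / real p)\<^sup>2 * \<theta> = ?bc * ((real p)\<^sup>2 * \<theta>)" by (simp add: power_divide)
        also have "\<dots> \<le> ?bc * B'"
          using \<theta>p p0 bump_constant_nonneg[of ?n] by (intro mult_left_mono) (auto simp: field_simps)
        finally have "(1 + A) ^ (r + 1) * (1 + ?bc / (1 / real p)\<^sup>2 * \<theta>) \<le> (1 + A) ^ (r + 1) * (1 + ?bc * B')"
          using AB(1) by (intro mult_left_mono) auto
        moreover have "\<theta> ^ r \<le> (B' / (real p)\<^sup>2) ^ r" using \<theta>p \<theta>(1) by (rule power_mono)
        ultimately have "(1 + A) ^ (r + 1) * (1 + ?bc / (1 / real p)\<^sup>2 * \<theta>) * \<theta> ^ r
            \<le> (1 + A) ^ (r + 1) * (1 + ?bc * B') * (B' / (real p)\<^sup>2) ^ r"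
          using AB(1) \<theta>(1) B' bump_constant_nonneg[of ?n] by (intro mult_mono) auto
        then show ?thesis using \<omega> by (intro mult_right_mono) auto
      qed
      also have "\<dots> = (1 + A) ^ (r + 1) * (1 + ?bc * B') * B' ^ r * 3 * \<omega> * (1 / real p ^ (2 * r))"
        unfolding power_divide power_mult[symmetric] by simp
      finally show ?thesis .
    qed
    have vj: "Ck_on 2 UNIV ((laplacian ^^ j) v)" if "j \<le> r" for j
    proof -
      have "Ck_on (2 + 2 * j) UNIV v" by (rule Ck_on_mono[OF v(1)]) (use that in simp)
      then show ?thesis by (rule Ck_on_laplacian_funpow[OF open_UNIV])
    qed
    obtain Cr where Cr: "profile_functional R Cr (K.defect r)" using K.defect_functional by blast
    note L = bounded_functional_of_profile[OF Cr, where 'a = 'a]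
    have Vt: "V j x = K.defect r (spherical_mean (\<lambda>z. (laplacian ^^ j) v (x + z)) 0)" for j x
    proof -
      have "spherical_mean ((laplacian ^^ j) v) x = spherical_mean (\<lambda>z. (laplacian ^^ j) v (x + z)) 0"
        using spherical_mean_translate[of "(laplacian ^^ j) v" x] by blast
      then show ?thesis unfolding V_def by simp
    qed
    have R0: "R \<ge> 0" using R by simp
    have CV: "Ck_on 2 UNIV (V j)" if "j \<le> r" for j
      unfolding Vt[abs_def] using bounded_functional_Ck_on[OF L R0 open_UNIV vj[OF that]] by simp
    have LV: "laplacian (V j) x = V (Suc j) x" if "j \<le> r" for j x
      unfolding Vt[abs_def] using bounded_functional_laplacian[OF L R0 open_UNIV vj[OF that] subset_UNIV, of x] by simp
    \<comment> \<open>The coefficients in the telescoped Green formula; \<open>1\<close> belongs to the average of \<open>v\<close> itself.\<close>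
    define a where "a i = (case i of 0 \<Rightarrow> 1 | Suc i \<Rightarrow> K.defect i (radial_potential ?n (\<lambda>_. 1)))" for i
    obtain P :: "nat \<Rightarrow> 'a \<Rightarrow> real" where P: "\<And>j m. Ck_on m UNIV (P j)" "\<And>j x. laplacian (P j) x = P (Suc j) x"
      "\<And>j x. d + r < j \<Longrightarrow> P j x = 0"
      "\<And>x. norm x + (\<rho> + 2) \<le> R \<Longrightarrow> P r x = (\<Sum>i\<le>r. a i * K.kmean (spherical_mean ((laplacian ^^ i) v) x))"
    proof (rule kernel_polynomial_potential[where r = r and w = "\<lambda>i. (laplacian ^^ i) v" and a = a and \<rho> = "\<rho> + 2", OF K kc])
      show "continuous_on UNIV ((laplacian ^^ i) v)" if "i \<le> r" for i by (rule Ck_on_imp_continuous[OF vj[OF that]])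
      show "(laplacian ^^ i) v y = 0" if "i \<le> r" "norm y \<ge> \<rho> + 2" for i y
        by (rule laplacian_funpow_support[where \<rho> = "\<rho> + 1"]) (use v(2) that in auto)
    qed blast
    have VP: "V r x + P r x = v x" if x: "x \<in> closure D" for x
    proof -
      have "norm x + (\<rho> + 2) \<le> R" using \<rho>(2) x unfolding R_def by force
      then have "P r x = (\<Sum>i\<le>r. a i * K.kmean (spherical_mean ((laplacian ^^ i) v) x))" by (rule P(4))
      also have "\<dots> = K.kmean (spherical_mean v x) + (\<Sum>i<r. K.defect i (radial_potential ?n (\<lambda>_. 1)) * K.kmean (spherical_mean ((laplacian ^^ Suc i) v) x))"
        unfolding lessThan_Suc_atMost[symmetric] sum.lessThan_Suc_shift by (simp add: a_def)
      finally show ?thesis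
        using K.defect_telescope[OF refl Ck_on_mono[OF v(1)], of r x] unfolding V_def by (simp add: spherical_mean_0)
    qed
    have "continuous_on (frontier D) (\<lambda>x. (-1) * V j x + (-1) * P j x)" if "j < r" for j
      using that
      by (intro continuous_intros continuous_on_subset[OF Ck_on_imp_continuous[OF CV]] continuous_on_subset[OF Ck_on_imp_continuous[OF P(1)]]) auto
    from polyharmonic_chain_exists[where r = r and \<phi> = "\<lambda>j x. (-1) * V j x + (-1) * P j x", OF D this]
    obtain H where H': "\<forall>j. continuous_on (closure D) (H j)" "\<forall>j k. Ck_on k D (H j)"
      "\<forall>j. \<forall>x\<in>D. laplacian (H j) x = H (Suc j) x"
      "\<forall>j<r. \<forall>x\<in>frontier D. H j x = (-1) * V j x + (-1) * P j x" "\<forall>j\<ge>r. \<forall>x. H j x = 0"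
      by blast
    note H = H'[rule_format]
    have CP: "Ck_on m D (P j)" for m j using P(1) by (rule Ck_on_subset) simp
    \<comment> \<open>\<open>T j\<close> is the \<open>j\<close>-th iterated Laplacian of the approximant \<open>T 0\<close>.\<close>
    define T where "T j x = 1 * h j x + 1 * (1 * P j x + 1 * H j x)" for j x
    have CPH: "Ck_on m D (\<lambda>x. 1 * P j x + 1 * H j x)" for m j by (rule Ck_on_lin[OF D(1) CP H(2)])
    have CT: "Ck_on m D (T j)" for m j unfolding T_def by (rule Ck_on_lin[OF D(1) h(2) CPH])
    have LT: "laplacian (T j) x = T (Suc j) x" if "x \<in> D" for j x
    proof -
      have "laplacian (\<lambda>x. 1 * h j x + 1 * (1 * P j x + 1 * H j x)) x = 1 * laplacian (h j) x + 1 * laplacian (\<lambda>x. 1 * P j x + 1 * H j x) x"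
        by (rule laplacian_lin_C2[OF D(1) h(2) CPH that])
      moreover have "laplacian (\<lambda>x. 1 * P j x + 1 * H j x) x = 1 * laplacian (P j) x + 1 * laplacian (H j) x"
        by (rule laplacian_lin_C2[OF D(1) CP H(2) that])
      ultimately show ?thesis unfolding T_def h(3)[OF that] P(2) H(3)[OF that] by (simp only:)
    qed
    have "polyharmonic_on p D (T 0)"
      unfolding polyharmonic_on_def
    proof (intro conjI CT ballI)
      fix x assume x: "x \<in> D"
      have "(laplacian ^^ p) (T 0) x = T p x"
        using laplacian_funpow_chain[where h = T and j = 0 and i = p, OF D(1) LT x] by simp
      also have "\<dots> = 0" unfolding T_def using h(5)[of p] P(3)[of p] H(5)[of p] p by (simp add: d_def)
      finally show "(laplacian ^^ p) (T 0) x = 0" .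
    qed
    moreover have "\<bar>f x - T 0 x\<bar> \<le> C * \<omega> * (1 / real p ^ (2 * r))" if x: "x \<in> closure D" for x
    proof -
      \<comment> \<open>The iterated Laplacians of the part of the error that is not \<open>V 0\<close>.\<close>
      define e where "e j x = 1 * laplacian_cl D j f x + (-1) * (1 * T j x + 1 * V j x)" for j x
      have CTV: "Ck_on 2 D (\<lambda>x. 1 * T j x + 1 * V j x)" if "j \<le> r" for j
        by (rule Ck_on_lin[OF D(1) CT Ck_on_subset[OF CV[OF that]]]) simp
      have exf: "laplacian_exists_on D ((laplacian ^^ j) f)" if "j < r" for j using f that unfolding HC_def by blast
      note cl = laplacian_of_laplacian_cl[OF D(1) exf]
      have "\<bar>e 0 x\<bar> \<le> (\<rho>\<^sup>2) ^ r * E"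
      proof (rule laplacian_chain_bound[where d = e, OF D(1) D\<rho>])
        fix j assume j: "j < r"
        then have jr: "j \<le> r" by simp
        have "continuous_on (closure D) (laplacian_cl D j f)" using f jr unfolding HC_def by blast
        then show "continuous_on (closure D) (e j)"
          unfolding e_def T_def
          by (intro continuous_intros h(1) H(1) continuous_on_subset[OF Ck_on_imp_continuous[OF CV[OF jr]]]
              continuous_on_subset[OF Ck_on_imp_continuous[OF P(1)]]) auto
        show "laplacian_exists_on D (e j)"
          unfolding e_def by (rule laplacian_lin(1)[OF D(1) cl(1)[OF j] Ck_on_2_laplacian_exists[OF CTV[OF jr]]])
        show "laplacian (e j) y = e (Suc j) y" if y: "y \<in> D" for y
        proof -
          have CVD: "Ck_on 2 D (V j)" by (rule Ck_on_subset[OF CV[OF jr]]) simp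
          have "laplacian (\<lambda>x. 1 * laplacian_cl D j f x + (-1) * (1 * T j x + 1 * V j x)) y
              = 1 * laplacian (laplacian_cl D j f) y + (-1) * laplacian (\<lambda>x. 1 * T j x + 1 * V j x) y"
            by (rule laplacian_lin(2)[OF D(1) cl(1)[OF j] Ck_on_2_laplacian_exists[OF CTV[OF jr]] y])
          moreover have "laplacian (\<lambda>x. 1 * T j x + 1 * V j x) y = 1 * laplacian (T j) y + 1 * laplacian (V j) y"
            by (rule laplacian_lin_C2[OF D(1) CT CVD y])
          ultimately show ?thesis unfolding e_def cl(2)[OF j y] LT[OF y] LV[OF jr] by (simp only:)
        qed
        show "e j y = 0" if y: "y \<in> frontier D" for y
          unfolding e_def T_def using h(4)[OF jr y] H(4)[OF j y] by simp
      next
        fix y assume y: "y \<in> closure D"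
        have "e r y = g y - v y"
          unfolding e_def T_def using g(3)[OF y] VP[OF y] H(5)[of r y] by simp
        then show "\<bar>e r y\<bar> \<le> E" using v(3)[of y] by simp
      qed (use E(1) x in auto)
      then have e0: "\<bar>e 0 x\<bar> \<le> \<omega> * (1 / real p ^ (2 * r))" using E(3) unfolding \<kappa>_def by simp
      have "f x - T 0 x = e 0 x + V 0 x" unfolding e_def by (simp add: laplacian_cl_def)
      then have "\<bar>f x - T 0 x\<bar> \<le> \<omega> * (1 / real p ^ (2 * r)) + (1 + A) ^ (r + 1) * (1 + ?bc * B') * B' ^ r * 3 * \<omega> * (1 / real p ^ (2 * r))"
        using e0 V0[of x] by linarith
      also have "\<dots> = C * \<omega> * (1 / real p ^ (2 * r))" unfolding C_def by (simp only: algebra_simps)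
      finally show ?thesis .
    qed
    ultimately show ?thesis unfolding \<omega>_def g_def by blast
  qed
  have "C > 0" unfolding C_def using C1 by linarith
  with main show ?thesis by (intro exI[of _ C]) blast
qed

end
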